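(* Let the type assumption and the measurement-noise assumption (both stated in the context) hold, and let $\hat\Theta(t)$ be the recursive least-squares estimator and $\lambda_{\min}(t)$ the smallest eigenvalue of $S_t^{-1}$. If $\log t=o(\lambda_{\min}(t))$, then $$\|\hat\Theta(t)-\Theta^*\|_F^2=O\Big(\frac{\log t}{\lambda_{\min}(t)}\Big)\quad\text{a.s.},$$ where $\Theta^*$ is the true type matrix. Consequently, if $\log t=o(\lambda_{\min}(t))$ a.s., then $\hat\Theta(t)\to\Theta^*$ a.s.
   Context: Game. There are $n$ agents. Agent $i\in[n]$ chooses $x_i\in\mathcal X_i$, with $\mathcal X_i\subset\mathbb R$ compact and convex; $\mathcal X=\prod_i\mathcal X_i$. For a fixed degree $d\in\mathbb N$, $\Phi:\mathbb R^n\to\mathbb R^D$, $D=\binom{n+d}{d}$, is the vector of all monomials $x^a$, $a\in\mathbb N^n$, of total degree at most $d$. Agent $i$'s nominal cost $\ell_i:\mathcal X\to\mathbb R$ satisfies $\frac{\partial\ell_i}{\partial x_i}(x)=\theta_i^{*\top}\Phi(x)$, and $\Theta^*=(\theta_1^*,\dots,\theta_n^* )^\top\in\mathbb R^{n\times D}$. Fix a desired profile $(x^\dagger,u^\dagger)\in\mathcal X\times\mathbb R^n$. For $p\in\mathbb R^n$ let $\gamma_i(x,p)=p_ix_i+(u_i^\dagger-p_ix_i^\dagger)$. Type assumption: there exist $m>0$ and a diagonal matrix $R$ with positive diagonal entries such that $\operatorname{Sym}(R\Theta^*\nabla\Phi(x))\succeq\frac12m\mathbb I$ for all $x\in\mathcal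 X$, where $\operatorname{Sym}(A)=\frac12(A+A^\top)$ and $\nabla\Phi$ is the Jacobian. Under it, for each $p\in\mathbb R^n$ the game in which agent $i$ minimizes $\ell_i(x)+\gamma_i(x,p)$ over $x_i\in\mathcal X_i$ has a unique Nash equilibrium, denoted $x^*(p)\in\mathcal X$. Data. At each time $t\ge1$ the planner issues $p(t)\in\mathbb R^n$, which depends only on data available up to time $t-1$ (and possibly randomization independent of the noise). The observed response is $\hat x(t)=x^*(p(t))$ and the observed incentive is $\hat p(t)=p(t)+e(t)$. Measurement-noise assumption: there is no endogenous noise (the response is exactly $x^*(p(t))$), and $\{e(t)\}_t$ is i.i.d., zero-mean, with $\mathbb E(e(t)e(t)^\top)=\sigma_e^2\mathbb I$ and $\sup_t\mathbb E\|e(t)\|_\infty^a<\infty$ for some $a>2$ and $\sigma_e>0$. Estimator. Put $\xi(t)=\Phi(\hat x(t))$ and $\delta(t)=\mathbf 1\{\hat x(t)\in\operatorname{int}\mathcal X\}$. Starting from any initial estimate $\hat\Theta(0)\in\mathbb R^{n\times D}$ and any symmetric $S_0\succ0$, $$\hat\Theta(t)=\hat\Theta(t-1)-\delta(t)\big(\hat p(t)+\hat\Theta(t-1)\xi(t)\big)\frac{\xi(t)^\top S_{t-1}}{1+\delta(t)\xi(t)^\top S_{t-1}\xi(t)},$$ $$S_t=S_{t-1}-\delta(t)S_{t-1}\xi(t)\frac{\xi(t)^\top S_{t-1}}{1+\delta(t)\xi(t)^\top S_{t-1}\xi(t)},$$ so that $S_t^{-1}=S_{t-1}^{-1}+\delta(t)\xi(t)\xi(t)^\top$.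 $\|\cdot\|_F$ is the Frobenius norm. For random sequences, $f(t)=O(g(t))$ a.s. means that with probability one there are (sample-path dependent) $c,t_0>0$ with $|f(t)|\le c|g(t)|$ for $t\ge t_0$; $f=o(g)$ means $f(t)/g(t)\to0$. *)

theory Defs
  imports "HOL-Probability.Probability"
begin

section \<open>Matrices\<close>

definition outer :: "real^'n \<Rightarrow> real^'m \<Rightarrow> real^'m^'n" where
  "outer u v = (\<chi> i j. u $ i * v $ j)"

definition sym_part :: "real^'n^'n \<Rightarrow> real^'n^'n" where
  "sym_part A = (1 / 2) *\<^sub>R (A + transpose A)"

definition psd :: "real^'n^'n \<Rightarrow> bool" where
  "psd A \<longleftrightarrow> transpose A = A \<and> (\<forall>v. 0 \<le> v \<bullet> (A *v v))"

definition pos_def :: "real^'n^'n \<Rightarrow> bool" where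
  "pos_def A \<longleftrightarrow> transpose A = A \<and> (\<forall>v. v \<noteq> 0 \<longrightarrow> 0 < v \<bullet> (A *v v))"

definition loewner_ge :: "real^'n^'n \<Rightarrow> real^'n^'n \<Rightarrow> bool" where
  "loewner_ge A B \<longleftrightarrow> psd (A - B)"

definition eigenvalue :: "real^'n^'n \<Rightarrow> real \<Rightarrow> bool" where
  "eigenvalue A k \<longleftrightarrow> (\<exists>v. v \<noteq> 0 \<and> A *v v = k *\<^sub>R v)"

(* Meaningful for symmetric A, whose set of real eigenvalues is finite and nonempty. *)
definition min_eigenvalue :: "real^'n^'n \<Rightarrow> real" where
  "min_eigenvalue A = Min {k. eigenvalue A k}"

(* The norm of the type real^'m^'n is the Frobenius norm. *)
lemma norm_matrix_eq_frobenius: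
  fixes A :: "real^'m^'n"
  shows "norm A = sqrt (\<Sum>i\<in>UNIV. \<Sum>j\<in>UNIV. (A $ i $ j)\<^sup>2)"
  by (simp add: norm_vec_def L2_set_def sum_nonneg)

section \<open>Monomial features\<close>

(* The index type 'm enumerates the exponents of total degree at most d, so that
   CARD('m) = (CARD('n) + d) choose d. The order of the monomials is immaterial. *)
definition enumerates_exponents :: "nat \<Rightarrow> ('m::finite \<Rightarrow> 'n::finite \<Rightarrow> nat) \<Rightarrow> bool" where
  "enumerates_exponents d \<alpha> \<longleftrightarrow> bij_betw \<alpha> UNIV {a. (\<Sum>j\<in>UNIV. a j) \<le> d}"

definition features :: "('m::finite \<Rightarrow> 'n::finite \<Rightarrow> nat) \<Rightarrow> real^'n \<Rightarrow> real^'m" where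
  "features \<alpha> x = (\<chi> k. \<Prod>j\<in>UNIV. (x $ j) ^ \<alpha> k j)"

section \<open>The game\<close>

definition profiles :: "('n::finite \<Rightarrow> real set) \<Rightarrow> (real^'n) set" where
  "profiles X = {x. \<forall>i. x $ i \<in> X i}"

definition deviate :: "real^'n \<Rightarrow> 'n \<Rightarrow> real \<Rightarrow> real^'n" where
  "deviate x i y = (\<chi> j. if j = i then y else x $ j)"

definition nash_equilibrium ::
  "('n::finite \<Rightarrow> real set) \<Rightarrow> ('n \<Rightarrow> real^'n \<Rightarrow> real) \<Rightarrow> real^'n \<Rightarrow> bool" where
  "nash_equilibrium X c x \<longleftrightarrow>
     x \<in> profiles X \<and> (\<forall>i. \<forall>y\<in>X i. c i x \<le> c i (deviate x i y))"

definition incentive :: "real^'n \<Rightarrow> real^'n \<Rightarrow> 'n \<Rightarrow> real^'n \<Rightarrow> real^'n \<Rightarrow> real" where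
  "incentive xd ud i x p = p $ i * x $ i + (ud $ i - p $ i * xd $ i)"

definition equilibrium_response ::
  "('n::finite \<Rightarrow> real set) \<Rightarrow> ('n \<Rightarrow> real^'n \<Rightarrow> real) \<Rightarrow> real^'n \<Rightarrow> real^'n \<Rightarrow> real^'n \<Rightarrow> real^'n" where
  "equilibrium_response X l xd ud p =
     (THE x. nash_equilibrium X (\<lambda>i x. l i x + incentive xd ud i x p) x)"

(* Row i of Theta is the type of agent i. The partial derivative is taken within X i, hence
   one-sided at the end points, because the cost matters only on the profiles. *)
definition has_types ::
  "('n::finite \<Rightarrow> real set) \<Rightarrow> ('m::finite \<Rightarrow> 'n \<Rightarrow> nat) \<Rightarrow> ('n \<Rightarrow> real^'n \<Rightarrow> real) \<Rightarrow> real^'m^'n \<Rightarrow> bool" where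
  "has_types X \<alpha> l \<Theta> \<longleftrightarrow>
     (\<forall>x\<in>profiles X. \<forall>i.
        ((\<lambda>y. l i (deviate x i y)) has_real_derivative (\<Theta> $ i) \<bullet> features \<alpha> x)
          (at (x $ i) within X i))"

definition type_assumption ::
  "('n::finite \<Rightarrow> real set) \<Rightarrow> ('m::finite \<Rightarrow> 'n \<Rightarrow> nat) \<Rightarrow> real^'m^'n \<Rightarrow> bool" where
  "type_assumption X \<alpha> \<Theta> \<longleftrightarrow>
     (\<exists>m>0. \<exists>R :: real^'n^'n.
        (\<forall>i j. i \<noteq> j \<longrightarrow> R $ i $ j = 0) \<and> (\<forall>i. 0 < R $ i $ i) \<and>
        (\<forall>x\<in>profiles X.
           loewner_ge (sym_part (R ** \<Theta> ** jacobian (features \<alpha>) (at x))) ((m / 2) *\<^sub>R mat 1)))"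

section \<open>Noise and information\<close>

definition noise_assumption :: "'w measure \<Rightarrow> (nat \<Rightarrow> 'w \<Rightarrow> real^'n::finite) \<Rightarrow> bool" where
  "noise_assumption M e \<longleftrightarrow>
     prob_space.indep_vars M (\<lambda>_. borel) e {1..} \<and>
     (\<forall>t\<ge>1. distr M borel (e t) = distr M borel (e 1)) \<and>
     (\<forall>t\<ge>1. integrable M (e t) \<and> (\<integral>\<omega>. e t \<omega> \<partial>M) = 0) \<and>
     (\<exists>\<sigma>>0. \<forall>t\<ge>1. integrable M (\<lambda>\<omega>. outer (e t \<omega>) (e t \<omega>)) \<and>
        (\<integral>\<omega>. outer (e t \<omega>) (e t \<omega>) \<partial>M) = \<sigma>\<^sup>2 *\<^sub>R mat 1) \<and>
     (\<exists>a>2. (SUP t\<in>{1..}. \<integral>\<^sup>+\<omega>. ennreal (infnorm (e t \<omega>) powr a) \<partial>M) < \<infinity>)"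

(* The planner may randomize through U, an arbitrary random element independent of the whole
   noise sequence. *)
definition randomization_independent ::
  "'w measure \<Rightarrow> 'u measure \<Rightarrow> ('w \<Rightarrow> 'u) \<Rightarrow> (nat \<Rightarrow> 'w \<Rightarrow> real^'n::finite) \<Rightarrow> bool" where
  "randomization_independent M N U e \<longleftrightarrow>
     U \<in> M \<rightarrow>\<^sub>M N \<and>
     prob_space.indep_set M
       (sets (vimage_algebra (space M) U N))
       (sets (vimage_algebra (space M) (\<lambda>\<omega>. \<lambda>t\<in>{1..}. e t \<omega>) (Pi\<^sub>M {1..} (\<lambda>_. borel))))"

(* p(t) is a measurable function of U and of the observations (xhat(s), phat(s)), s = 1..t-1;
   by recursion this includes dependence on the planner's own earlier choices p(s). *)
definition non_anticipating ::
  "'w measure \<Rightarrow> 'u measure \<Rightarrow> ('w \<Rightarrow> 'u) \<Rightarrow> (nat \<Rightarrow> 'w \<Rightarrow> real^'n::finite)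
    \<Rightarrow> (nat \<Rightarrow> 'w \<Rightarrow> real^'n) \<Rightarrow> (nat \<Rightarrow> 'w \<Rightarrow> real^'n) \<Rightarrow> bool" where
  "non_anticipating M N U xhat phat p \<longleftrightarrow>
     (\<forall>t\<ge>1. \<exists>\<pi> \<in> N \<Otimes>\<^sub>M Pi\<^sub>M {1..<t} (\<lambda>_. borel) \<rightarrow>\<^sub>M borel.
        \<forall>\<omega>\<in>space M. p t \<omega> = \<pi> (U \<omega>, \<lambda>s\<in>{1..<t}. (xhat s \<omega>, phat s \<omega>)))"

section \<open>Recursive least squares\<close>

(* Pathwise: xs and ps are the observed responses and incentives, used from time 1 on. *)
primrec rls_S ::
  "('n::finite \<Rightarrow> real set) \<Rightarrow> ('m::finite \<Rightarrow> 'n \<Rightarrow> nat) \<Rightarrow> real^'m^'m \<Rightarrow> (nat \<Rightarrow> real^'n)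
    \<Rightarrow> nat \<Rightarrow> real^'m^'m" where
  "rls_S X \<alpha> S0 xs 0 = S0"
| "rls_S X \<alpha> S0 xs (Suc t) =
     (let S = rls_S X \<alpha> S0 xs t;
          \<xi> = features \<alpha> (xs (Suc t));
          \<delta> = indicator (interior (profiles X)) (xs (Suc t))
      in S - (\<delta> / (1 + \<delta> * (\<xi> \<bullet> (S *v \<xi>)))) *\<^sub>R outer (S *v \<xi>) (\<xi> v* S))"

primrec rls_estimate ::
  "('n::finite \<Rightarrow> real set) \<Rightarrow> ('m::finite \<Rightarrow> 'n \<Rightarrow> nat) \<Rightarrow> real^'m^'m \<Rightarrow> real^'m^'n
    \<Rightarrow> (nat \<Rightarrow> real^'n) \<Rightarrow> (nat \<Rightarrow> real^'n) \<Rightarrow> nat \<Rightarrow> real^'m^'n" where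
  "rls_estimate X \<alpha> S0 \<Theta>0 xs ps 0 = \<Theta>0"
| "rls_estimate X \<alpha> S0 \<Theta>0 xs ps (Suc t) =
     (let \<Theta> = rls_estimate X \<alpha> S0 \<Theta>0 xs ps t;
          S = rls_S X \<alpha> S0 xs t;
          \<xi> = features \<alpha> (xs (Suc t));
          \<delta> = indicator (interior (profiles X)) (xs (Suc t))
      in \<Theta> - (\<delta> / (1 + \<delta> * (\<xi> \<bullet> (S *v \<xi>)))) *\<^sub>R outer (ps (Suc t) + \<Theta> *v \<xi>) (\<xi> v* S))"

definition lambda_min ::
  "('n::finite \<Rightarrow> real set) \<Rightarrow> ('m::finite \<Rightarrow> 'n \<Rightarrow> nat) \<Rightarrow> real^'m^'m \<Rightarrow> (nat \<Rightarrow> real^'n)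
    \<Rightarrow> nat \<Rightarrow> real" where
  "lambda_min X \<alpha> S0 xs t = min_eigenvalue (matrix_inv (rls_S X \<alpha> S0 xs t))"

end

theory Submission
  imports Defs
begin

text \<open>
  An interior equilibrium satisfies the first-order conditions \<open>\<Theta>star \<Phi>(xhat) + p = 0\<close>, so each
  observation that the estimator keeps is a noisy linear measurement of \<open>\<Theta>star\<close>, and row \<open>i\<close> of
  the estimator is recursive least squares for a scalar regression with noise \<open>e $ i\<close>.

  Let \<open>E t\<close> be the error in one row and \<open>P t\<close> the inverse of \<open>S t\<close>. The function
  \<open>V t = E t \<bullet> (P t *v E t)\<close> dominates \<open>lambda_min * (norm (E t))\<^sup>2\<close>, so everything reduces to
  \<open>V t = O(ln t)\<close>. With \<open>\<zeta>\<close> the regressor, \<open>h = \<zeta> \<bullet> (S *v \<zeta>)\<close> and \<open>\<eta> = E \<bullet> \<zeta>\<close>, one step changes \<open>V\<close> by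
  \<open>\<epsilon>\<^sup>2 h / (1 + h) - 2 \<epsilon> \<eta> / (1 + h) - \<eta>\<^sup>2 / (1 + h)\<close> (lemma \<open>V_Suc\<close>), and the three terms are treated
  as follows.

  The gains \<open>h / (1 + h)\<close> sum to \<open>O(ln t)\<close> along every path, because the product of the factors
  \<open>1 + h\<close> is a quotient of determinants that grows polynomially (lemma \<open>sum_gain_le_ln\<close>). Weighting
  them with \<open>\<epsilon>\<^sup>2\<close> does not change the order, since the noise has more than two moments: truncate
  \<open>\<epsilon>\<^sup>2\<close> at the level \<open>1 + ln t\<close>, compare the truncated part with its mean and bound the rest in
  expectation (lemma \<open>AE_weighted_square_sum_growth\<close>). The martingale \<open>\<Sum> \<epsilon> w\<close> with \<open>w = \<eta> / (1 + h)\<close>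
  is almost surely \<open>O((1 + \<Sum> w\<^sup>2) powr (3/4))\<close> (lemma \<open>AE_noise_sum_growth\<close>), which is of smaller
  order than the negative term \<open>\<Sum> \<eta>\<^sup>2 / (1 + h)\<close> and is absorbed by it (lemma \<open>V_le\<close>).

  Both almost sure bounds come from one fact: martingales with bounded second moments have
  bounded paths (lemma \<open>AE_bounded_partial_sums\<close>). To apply it the regressors and errors must be
  functions of the past. This needs the equilibrium response to be a measurable function of the
  incentive. Nash equilibria are the solutions of a strongly monotone variational inequality, so
  they exist by Brouwer's theorem and depend on the incentive in a Lipschitz continuous way
  (lemmas \<open>VI_exists\<close> and \<open>VI_lipschitz\<close>).
\<close>

section \<open>Rank-one updates, determinants and extreme eigenvalues\<close>

lemma outer_mult_vec: "outer u v *v x = (v \<bullet> x) *\<^sub>R u"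
  by (simp add: outer_def matrix_vector_mult_def vec_eq_iff inner_vec_def sum_distrib_left mult_ac)

lemma matrix_mult_outer: "A ** outer u v = outer (A *v u) v"
  by (simp add: outer_def matrix_matrix_mult_def matrix_vector_mult_def vec_eq_iff sum_distrib_left mult_ac)

lemma outer_mult_matrix: "outer u v ** A = outer u (transpose A *v v)"
  by (simp add: outer_def matrix_matrix_mult_def matrix_vector_mult_def transpose_def vec_eq_iff sum_distrib_left mult_ac)

lemma matrix_matrix_mult_add_rdistrib: "(A + B) ** C = A ** C + B ** C" for A B :: "real^'k^'n"
  by (simp add: matrix_matrix_mult_def vec_eq_iff sum.distrib distrib_right)

lemma matrix_inv_eqI:
  fixes A B :: "real^'m^'m"
  assumes "A ** B = mat 1" "B ** A = mat 1"
  shows "matrix_inv A = B"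
  unfolding matrix_inv_def
proof (rule some_equality)
  show "C = B" if "A ** C = mat 1 \<and> C ** A = mat 1" for C
    using assms that by (metis matrix_mul_assoc matrix_mul_lid matrix_mul_rid)
qed (use assms in simp)

lemma transpose_outer: "transpose (outer u v) = outer v u"
  by (simp add: outer_def transpose_def vec_eq_iff mult.commute)

lemma symmetric_inner: "transpose A = A \<Longrightarrow> u \<bullet> (A *v w) = (A *v u) \<bullet> w" for A :: "real^'m^'m"
  by (metis dot_lmul_matrix transpose_matrix_vector)

text \<open>The matrix differs from the identity in row \<open>k\<close> only, and row operations with the other rows
  reduce that row to its diagonal entry.\<close>

lemma det_mat_1_plus_outer_axis:
  fixes c :: "real^'m"
  shows "det (mat 1 + outer (axis k 1) c) = 1 + c $ k"
proof -
  define A :: "real^'m^'m" where "A = (\<chi> i. if i = k then (1 + c $ k) *s axis k 1 else axis i 1)"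
  define x where "x = (\<Sum>j\<in>UNIV - {k}. c $ j *s axis j (1::real))"
  have rows: "row j A = axis j 1" if "j \<noteq> k" for j
    using that by (simp add: A_def row_def vec_eq_iff)
  have "x \<in> vec.span {row j A |j. j \<noteq> k}"
    unfolding x_def
    by (intro vec.span_sum vec.span_scale vec.span_base) (auto intro!: exI[of _ "_::'m"] simp: rows[symmetric])
  then have "det (\<chi> i. if i = k then row k A + x else row i A) = det A"
    by (rule det_row_span)
  moreover have "(\<chi> i. if i = k then row k A + x else row i A) = mat 1 + outer (axis k 1) c"
  proof -
    have "x $ j = (if j = k then 0 else c $ j)" for j
    proof -
      have "x $ j = (\<Sum>i\<in>UNIV - {k}. if i = j then c $ i else 0)"
        unfolding x_def by (simp add: axis_def if_distrib cong: if_cong)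
      then show ?thesis by (simp add: sum.delta)
    qed
    then show ?thesis
      by (auto simp: vec_eq_iff row_def A_def outer_def mat_def axis_def)
  qed
  moreover have "det A = (1 + c $ k) * det (\<chi> i. if i = k then axis k (1::real) else axis i 1)"
    unfolding A_def by (rule det_row_mul)
  moreover have "(\<chi> i. if i = k then axis k (1::real) else axis i 1) = mat 1"
    by (auto simp: vec_eq_iff mat_def axis_def)
  ultimately show ?thesis by simp
qed

text \<open>An orthogonal change of basis turns \<open>u\<close> into a multiple of a basis vector, and the perturbation
  into a change of a single row.\<close>

lemma det_mat_1_plus_outer:
  fixes u v :: "real^'m"
  shows "det (mat 1 + outer u v) = 1 + u \<bullet> v"
proof (cases "u = 0")
  case True
  then have "outer u v = 0" by (simp add: outer_def vec_eq_iff)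
  then show ?thesis using True by simp
next
  case False
  obtain k :: 'm where "k \<in> UNIV" by blast
  define a where "a = u /\<^sub>R norm u"
  have "norm a = 1" using False by (simp add: a_def)
  then obtain Q where Q: "orthogonal_matrix Q" "Q *v axis k 1 = a"
    using orthogonal_matrix_exists_basis by metis
  have QQ: "transpose Q ** Q = mat 1" using Q(1) by (simp add: orthogonal_matrix_def)
  have "transpose Q *v a = axis k 1"
    unfolding Q(2)[symmetric] by (simp add: matrix_vector_mul_assoc QQ)
  then have Qu: "transpose Q *v u = norm u *\<^sub>R axis k 1"
  proof -
    have "u = norm u *\<^sub>R a" using False by (simp add: a_def)
    then show ?thesis using \<open>transpose Q *v a = axis k 1\<close> by (metis matrix_vector_mult_scaleR)
  qed
  define c where "c = norm u *\<^sub>R (transpose Q *v v)"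
  have "transpose Q ** (mat 1 + outer u v) ** Q = mat 1 + outer (transpose Q *v u) (transpose Q *v v)"
    by (simp add: matrix_add_ldistrib matrix_matrix_mult_add_rdistrib QQ matrix_mult_outer outer_mult_matrix)
  also have "\<dots> = mat 1 + outer (axis k 1) c"
    by (simp only: Qu c_def) (simp add: outer_def vec_eq_iff)
  finally have "det (mat 1 + outer (axis k 1) c) = det (transpose Q) * det (mat 1 + outer u v) * det Q"
    by (metis det_mul)
  also have "\<dots> = det (mat 1 + outer u v) * det (transpose Q ** Q)"
    by (simp add: det_mul)
  finally have "det (mat 1 + outer u v) = 1 + c $ k"
    by (simp add: QQ det_mat_1_plus_outer_axis)
  also have "c $ k = u \<bullet> v"
  proof -
    have "c $ k = (norm u *\<^sub>R axis k 1) \<bullet> (transpose Q *v v)"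
      by (simp add: c_def inner_axis' )
    also have "\<dots> = (transpose Q *v u) \<bullet> (transpose Q *v v)" by (simp only: Qu)
    also have "\<dots> = u \<bullet> v"
    proof -
      have "orthogonal_transformation ((*v) (transpose Q))"
        using Q(1) by (simp add: orthogonal_transformation_matrix)
      then show ?thesis by (simp add: orthogonal_transformation_def)
    qed
    finally show ?thesis .
  qed
  finally show ?thesis .
qed

lemma det_plus_outer:
  fixes P S :: "real^'m^'m"
  assumes "P ** S = mat 1"
  shows "det (P + outer u v) = det P * (1 + (S *v u) \<bullet> v)"
proof -
  have "P + outer u v = P ** (mat 1 + outer (S *v u) v)"
    by (simp add: matrix_add_ldistrib matrix_mult_outer matrix_vector_mul_assoc assms)
  then show ?thesis by (simp add: det_mul det_mat_1_plus_outer)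
qed

text \<open>Leibniz' formula. The constant is crude, but only the logarithm of the determinant will matter,
  for which polynomial growth in \<open>c\<close> is enough.\<close>

lemma abs_det_le:
  fixes A :: "real^'m^'m"
  assumes "\<And>i j. \<bar>A $ i $ j\<bar> \<le> c"
  shows "\<bar>det A\<bar> \<le> fact CARD('m) * c ^ CARD('m)"
proof -
  have "\<bar>det A\<bar> \<le> (\<Sum>p | p permutes (UNIV :: 'm set). \<bar>of_int (sign p) * (\<Prod>i\<in>UNIV. A $ i $ p i)\<bar>)"
    unfolding det_def by (rule sum_abs)
  also have "\<dots> \<le> (\<Sum>p | p permutes (UNIV :: 'm set). c ^ CARD('m))"
  proof (rule sum_mono)
    fix p :: "'m \<Rightarrow> 'm"
    have "\<bar>of_int (sign p) * (\<Prod>i\<in>UNIV. A $ i $ p i)\<bar> = (\<Prod>i\<in>UNIV. \<bar>A $ i $ p i\<bar>)"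
      by (simp add: abs_mult abs_prod sign_def)
    also have "\<dots> \<le> (\<Prod>i\<in>(UNIV::'m set). c)" by (intro prod_mono) (auto simp: assms)
    finally show "\<bar>of_int (sign p) * (\<Prod>i\<in>UNIV. A $ i $ p i)\<bar> \<le> c ^ CARD('m)" by simp
  qed
  also have "\<dots> = fact CARD('m) * c ^ CARD('m)"
    by (simp add: card_permutations[of "UNIV :: 'm set" "CARD('m)"])
  finally show ?thesis .
qed

text \<open>Eigenvectors for different eigenvalues are orthogonal, and an orthogonal family in a Euclidean
  space is finite. This makes the minimum in \<open>min_eigenvalue\<close> meaningful.\<close>

lemma finite_eigenvalues_symmetric:
  fixes A :: "real^'m^'m"
  assumes "transpose A = A"
  shows "finite {k. eigenvalue A k}"
proof -
  define f where "f k = (SOME v. v \<noteq> 0 \<and> A *v v = k *\<^sub>R v)" for k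
  have f: "f k \<noteq> 0" "A *v f k = k *\<^sub>R f k" if "eigenvalue A k" for k
    using someI_ex[of "\<lambda>v. v \<noteq> 0 \<and> A *v v = k *\<^sub>R v"] that by (auto simp: eigenvalue_def f_def)
  have orth: "f k \<bullet> f l = 0" if "eigenvalue A k" "eigenvalue A l" "k \<noteq> l" for k l
    using symmetric_inner[OF assms, of "f k" "f l"] f[OF that(1)] f[OF that(2)] that(3) by simp
  have "pairwise orthogonal (f ` {k. eigenvalue A k})"
    using orth by (auto simp: pairwise_def orthogonal_def)
  then have "finite (f ` {k. eigenvalue A k})" by (rule pairwise_orthogonal_imp_finite)
  moreover have "inj_on f {k. eigenvalue A k}"
    using orth f by (intro inj_onI) (metis inner_eq_zero_iff mem_Collect_eq)
  ultimately show ?thesis by (rule finite_imageD)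
qed

text \<open>The quadratic form attains its minimum \<open>k\<close> on the unit sphere at some \<open>v0\<close>. Then \<open>A - k I\<close> is
  positive semidefinite with a zero at \<open>v0\<close>, which forces \<open>A v0 = k v0\<close>: along the residual
  \<open>w = A v0 - k v0\<close> the form would otherwise decrease to first order.\<close>

lemma exists_eigenvalue_le_rayleigh:
  fixes A :: "real^'m^'m"
  assumes sym: "transpose A = A"
  obtains k where "eigenvalue A k" "\<And>v. k * (v \<bullet> v) \<le> v \<bullet> (A *v v)"
proof -
  have cont: "continuous_on (sphere 0 1) (\<lambda>v. v \<bullet> (A *v v))"
    by (intro continuous_intros matrix_vector_mult_linear_continuous_on)
  have ne: "sphere (0::real^'m) 1 \<noteq> {}" by simp
  obtain v0 where v0: "v0 \<in> sphere 0 1" and min: "\<And>v. v \<in> sphere 0 1 \<Longrightarrow> v0 \<bullet> (A *v v0) \<le> v \<bullet> (A *v v)"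
    using continuous_attains_inf[OF compact_sphere ne cont] by blast
  define k where "k = v0 \<bullet> (A *v v0)"
  have ray: "k * (v \<bullet> v) \<le> v \<bullet> (A *v v)" for v
  proof (cases "v = 0")
    case False
    have "k \<le> (v /\<^sub>R norm v) \<bullet> (A *v (v /\<^sub>R norm v))"
      unfolding k_def using False by (intro min) simp
    also have "\<dots> = (v \<bullet> (A *v v)) / (v \<bullet> v)"
      using False by (simp add: matrix_vector_mult_scaleR dot_square_norm power2_eq_square field_simps)
    finally show ?thesis using False by (simp add: field_simps)
  qed simp
  define w where "w = A *v v0 - k *\<^sub>R v0"
  define q where "q v = v \<bullet> (A *v v) - k * (v \<bullet> v)" for v
  have qpos: "0 \<le> q v" for v using ray by (simp add: q_def)
  have q0: "q v0 = 0" using v0 by (simp add: q_def k_def dot_square_norm)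
  have expand: "q (v0 + t *\<^sub>R w) = 2 * t * (w \<bullet> w) + t\<^sup>2 * q w" for t
  proof -
    have "q (v0 + t *\<^sub>R w) = q v0 + 2 * t * (w \<bullet> (A *v v0) - k * (w \<bullet> v0)) + t\<^sup>2 * q w"
      using symmetric_inner[OF sym, of v0 w]
      by (simp add: q_def matrix_vector_right_distrib matrix_vector_mult_scaleR inner_add_left inner_add_right
          inner_commute power2_eq_square algebra_simps)
    then show ?thesis by (simp add: q0) (simp add: w_def inner_diff_right)
  qed
  have "w \<bullet> w = 0"
  proof (rule ccontr)
    assume ne: "w \<bullet> w \<noteq> 0"
    define a b where "a = w \<bullet> w" and "b = q w"
    have ab: "0 < a" "0 \<le> b" using ne qpos by (auto simp: a_def b_def)
    \<comment> \<open>The step \<open>- a / (b + 1)\<close> is short enough for the linear term to beat the quadratic one; the \<open>1\<close> covers \<open>b = 0\<close>.\<close>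
    have "0 \<le> 2 * (- a / (b + 1)) * a + (- a / (b + 1))\<^sup>2 * b"
      using qpos[of "v0 + (- a / (b + 1)) *\<^sub>R w"] unfolding expand a_def b_def .
    also have "\<dots> = - (a\<^sup>2 * (b + 2)) / (b + 1)\<^sup>2"
      using ab by (simp add: divide_simps power2_eq_square) (simp add: algebra_simps)
    also have "\<dots> < 0" using ab by (intro divide_neg_pos) auto
    finally show False by simp
  qed
  then have "A *v v0 = k *\<^sub>R v0" by (simp add: w_def)
  moreover have "v0 \<noteq> 0" using v0 by auto
  ultimately have "eigenvalue A k" by (auto simp: eigenvalue_def)
  then show thesis using ray that by blast
qed

lemma min_eigenvalue_le_rayleigh:
  fixes A :: "real^'m^'m"
  assumes "transpose A = A"
  shows "min_eigenvalue A * (v \<bullet> v) \<le> v \<bullet> (A *v v)"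
proof -
  obtain k where k: "eigenvalue A k" "\<And>v. k * (v \<bullet> v) \<le> v \<bullet> (A *v v)"
    using exists_eigenvalue_le_rayleigh[OF assms] by blast
  have "min_eigenvalue A \<le> k"
    unfolding min_eigenvalue_def using finite_eigenvalues_symmetric[OF assms] k by (intro Min_le) auto
  then have "min_eigenvalue A * (v \<bullet> v) \<le> k * (v \<bullet> v)" by (intro mult_right_mono) auto
  then show ?thesis using k(2)[of v] by linarith
qed

lemma min_eigenvalue_pos:
  fixes A :: "real^'m^'m"
  assumes "pos_def A"
  shows "0 < min_eigenvalue A"
proof -
  have sym: "transpose A = A" using assms by (simp add: pos_def_def)
  have "{k. eigenvalue A k} \<noteq> {}" using exists_eigenvalue_le_rayleigh[OF sym] by blast
  then have "eigenvalue A (min_eigenvalue A)"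
    unfolding min_eigenvalue_def using Min_in[OF finite_eigenvalues_symmetric[OF sym]] by blast
  then obtain v where v: "v \<noteq> 0" "A *v v = min_eigenvalue A *\<^sub>R v" by (auto simp: eigenvalue_def)
  then have "0 < min_eigenvalue A * (v \<bullet> v)" using assms by (auto simp: pos_def_def)
  then show ?thesis using inner_ge_zero[of v] by (auto simp: zero_less_mult_iff)
qed

section \<open>Least squares along one sample path\<close>

text \<open>Times are shifted by one: \<open>\<zeta> t\<close> is the regressor of observation \<open>t + 1\<close>. An observation that the
  estimator discards is represented by \<open>\<zeta> t = 0\<close>, for which the update is trivial.\<close>

locale rls_path =
  fixes S :: "nat \<Rightarrow> real^'m^'m" and \<zeta> :: "nat \<Rightarrow> real^'m"
  assumes S0: "pos_def (S 0)"
    and S_Suc: "\<And>t. S (Suc t) = S t - (1 / (1 + \<zeta> t \<bullet> (S t *v \<zeta> t))) *\<^sub>R outer (S t *v \<zeta> t) (S t *v \<zeta> t)"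
begin

text \<open>The information matrix, which turns out to be the inverse of \<open>S t\<close>.\<close>

definition P :: "nat \<Rightarrow> real^'m^'m" where
  "P t = matrix_inv (S 0) + (\<Sum>s<t. outer (\<zeta> s) (\<zeta> s))"

text \<open>The leverage of the new regressor; \<open>1 + h t\<close> is the factor by which \<open>det (P t)\<close> grows.\<close>

definition h :: "nat \<Rightarrow> real" where
  "h t = \<zeta> t \<bullet> (S t *v \<zeta> t)"

lemma P_Suc: "P (Suc t) = P t + outer (\<zeta> t) (\<zeta> t)"
  by (simp add: P_def)

lemma P_Suc_vec: "P (Suc t) *v x = P t *v x + (\<zeta> t \<bullet> x) *\<^sub>R \<zeta> t"
  by (simp add: P_Suc matrix_vector_mult_add_rdistrib outer_mult_vec)

lemma S_symmetric: "transpose (S t) = S t"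
proof (induction t)
  case 0 then show ?case using S0 by (simp add: pos_def_def)
next
  case (Suc t)
  have "transpose (S (Suc t)) = transpose (S t) - (1 / (1 + \<zeta> t \<bullet> (S t *v \<zeta> t))) *\<^sub>R transpose (outer (S t *v \<zeta> t) (S t *v \<zeta> t))"
    by (simp add: S_Suc transpose_def vec_eq_iff)
  then show ?case using Suc by (simp add: S_Suc transpose_outer)
qed

lemma P0_S0: "P 0 ** S 0 = mat 1" "S 0 ** P 0 = mat 1"
proof -
  have "inj ((*v) (S 0))"
  proof (rule injI)
    fix x y assume eq: "S 0 *v x = S 0 *v y"
    have "(x - y) \<bullet> (S 0 *v (x - y)) = 0" by (simp add: matrix_vector_mult_diff_distrib eq)
    then show "x = y" using S0 by (metis less_irrefl pos_def_def right_minus_eq)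
  qed
  then have "invertible (S 0)"
    by (metis invertible_left_inverse matrix_left_invertible_injective)
  then obtain B where B: "S 0 ** B = mat 1" "B ** S 0 = mat 1" by (auto simp: invertible_def)
  then have "P 0 = B" by (simp add: P_def matrix_inv_eqI)
  then show "P 0 ** S 0 = mat 1" "S 0 ** P 0 = mat 1" using B by simp_all
qed

lemma pos_def_P: "pos_def (P t)"
proof (induction t)
  case 0
  have "transpose (P 0) = P 0"
  proof -
    have "transpose (P 0) ** S 0 = mat 1"
      using arg_cong[OF P0_S0(2), of transpose] S_symmetric[of 0] by (simp add: matrix_transpose_mul transpose_mat)
    then have "transpose (P 0) ** (S 0 ** P 0) = mat 1 ** P 0" by (metis matrix_mul_assoc)
    then show ?thesis by (simp add: P0_S0)
  qed
  moreover have "0 < v \<bullet> (P 0 *v v)" if "v \<noteq> 0" for v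
  proof -
    define w where "w = P 0 *v v"
    have v: "v = S 0 *v w" by (simp add: w_def matrix_vector_mul_assoc P0_S0)
    then have "w \<noteq> 0" using that by auto
    then have "0 < w \<bullet> (S 0 *v w)" using S0 by (simp add: pos_def_def)
    then show ?thesis by (simp add: v[symmetric] w_def[symmetric] inner_commute)
  qed
  ultimately show ?case by (simp add: pos_def_def)
next
  case (Suc t)
  have "transpose (P (Suc t)) = transpose (P t) + transpose (outer (\<zeta> t) (\<zeta> t))"
    by (simp add: P_Suc transpose_def vec_eq_iff)
  moreover have "0 < v \<bullet> (P (Suc t) *v v)" if "v \<noteq> 0" for v
  proof -
    have "v \<bullet> (P (Suc t) *v v) = v \<bullet> (P t *v v) + (\<zeta> t \<bullet> v)\<^sup>2"
      by (simp add: P_Suc_vec inner_add_right inner_commute[of v "\<zeta> t"] power2_eq_square)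
    then show ?thesis using Suc that by (simp add: pos_def_def add_pos_nonneg)
  qed
  ultimately show ?case using Suc by (simp add: pos_def_def P_Suc transpose_outer)
qed

text \<open>Positivity of \<open>S t\<close> is inherited from its inverse \<open>P t\<close>, which is a sum of positive matrices. The
  inverse property appears as a hypothesis because the induction that establishes it divides by \<open>1 + h t\<close>.\<close>

lemma h_nonneg_if_inverse:
  assumes "P t ** S t = mat 1"
  shows "0 \<le> h t"
proof -
  define w where "w = S t *v \<zeta> t"
  have "P t *v w = \<zeta> t" by (simp add: w_def matrix_vector_mul_assoc assms)
  then have "h t = w \<bullet> (P t *v w)" by (simp add: h_def w_def inner_commute)
  also have "\<dots> \<ge> 0" using pos_def_P[of t] by (cases "w = 0") (auto simp: pos_def_def less_imp_le)
  finally show ?thesis .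
qed

text \<open>The Sherman--Morrison formula.\<close>

lemma P_S: "P t ** S t = mat 1"
proof (induction t)
  case 0 then show ?case by (rule P0_S0)
next
  case (Suc t)
  define c where "c = 1 / (1 + h t)"
  have h0: "0 \<le> h t" by (rule h_nonneg_if_inverse[OF Suc])
  have "(P (Suc t) ** S (Suc t)) *v x = x" for x
  proof -
    define a where "a = \<zeta> t \<bullet> (S t *v x)"
    have Px: "P t *v (S t *v y) = y" for y by (simp add: matrix_vector_mul_assoc Suc)
    have Sx: "S (Suc t) *v x = S t *v x - (c * a) *\<^sub>R (S t *v \<zeta> t)"
      using symmetric_inner[OF S_symmetric, of "\<zeta> t" t x]
      by (simp add: S_Suc matrix_vector_mult_diff_rdistrib scaleR_matrix_vector_assoc[symmetric] outer_mult_vec c_def h_def a_def)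
    have "(P (Suc t) ** S (Suc t)) *v x = P (Suc t) *v (S t *v x - (c * a) *\<^sub>R (S t *v \<zeta> t))"
      by (simp add: matrix_vector_mul_assoc[symmetric] Sx)
    also have "\<dots> = x - (c * a) *\<^sub>R \<zeta> t + (a - c * a * h t) *\<^sub>R \<zeta> t"
      by (simp add: P_Suc_vec matrix_vector_mult_diff_distrib matrix_vector_mult_scaleR Px inner_diff_right a_def[symmetric] h_def[symmetric])
         (simp add: algebra_simps)
    also have "\<dots> = x + (a - c * a * (1 + h t)) *\<^sub>R \<zeta> t"
      by (simp add: algebra_simps)
    also have "a - c * a * (1 + h t) = 0" using h0 by (simp add: c_def)
    finally show ?thesis by simp
  qed
  then show ?case by (simp add: matrix_eq)
qed

lemma h_nonneg: "0 \<le> h t"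
  by (rule h_nonneg_if_inverse[OF P_S])

lemma S_P: "S t ** P t = mat 1"
  using P_S matrix_left_right_inverse by blast

lemma matrix_inv_S: "matrix_inv (S t) = P t"
  using P_S[of t] S_P[of t] by (rule matrix_inv_eqI[rotated])

lemma det_P_Suc: "det (P (Suc t)) = det (P t) * (1 + h t)"
  using det_plus_outer[OF P_S, of t "\<zeta> t" "\<zeta> t"] by (simp add: P_Suc h_def inner_commute)

lemma det_P: "det (P t) = det (P 0) * (\<Prod>s<t. 1 + h s)"
  by (induction t) (simp_all add: det_P_Suc)

text \<open>Each gain is at most \<open>ln (1 + h s)\<close>, and the product of the factors \<open>1 + h s\<close> telescopes to
  \<open>det (P t) / det (P 0)\<close>. The entries of \<open>P t\<close> grow at most linearly, hence its determinant grows
  polynomially and the logarithm of the product is \<open>O(ln t)\<close>.\<close>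

lemma sum_gain_le_ln:
  assumes bdd: "\<And>s. norm (\<zeta> s) \<le> B"
  shows "(\<Sum>s<t. h s / (1 + h s)) \<le>
    (\<bar>ln (fact CARD('m) * (norm (P 0) + B\<^sup>2 + 1) ^ CARD('m) / \<bar>det (P 0)\<bar>)\<bar> + CARD('m)) * (1 + ln (1 + real t))"
proof -
  define c where "c = norm (P 0) + B\<^sup>2 + 1"
  define q where "q = fact CARD('m) * c ^ CARD('m) / \<bar>det (P 0)\<bar>"
  have c0: "0 < c" by (simp add: c_def add_nonneg_pos)
  have d0: "det (P 0) \<noteq> 0" by (metis P0_S0(1) det_I det_mul mult_zero_left zero_neq_one)
  have q0: "0 < q" using c0 d0 by (simp add: q_def)
  have entries: "\<bar>P t $ i $ j\<bar> \<le> c * (1 + real t)" for i j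
  proof -
    have "norm (P t) \<le> norm (P 0) + real t * B\<^sup>2"
    proof (induction t)
      case (Suc t)
      have "norm (outer (\<zeta> t) (\<zeta> t)) = (norm (\<zeta> t))\<^sup>2"
      proof -
        have "norm (outer (\<zeta> t) (\<zeta> t)) = sqrt (\<Sum>i\<in>UNIV. \<Sum>j\<in>UNIV. (\<zeta> t $ i)\<^sup>2 * (\<zeta> t $ j)\<^sup>2)"
          by (simp add: norm_matrix_eq_frobenius outer_def power_mult_distrib)
        also have "(\<Sum>i\<in>UNIV. \<Sum>j\<in>UNIV. (\<zeta> t $ i)\<^sup>2 * (\<zeta> t $ j)\<^sup>2) = ((norm (\<zeta> t))\<^sup>2)\<^sup>2"
          by (simp add: norm_vec_def L2_set_def sum_nonneg sum_product power2_eq_square[of "\<Sum>i\<in>UNIV. (\<zeta> t $ i)\<^sup>2"])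
        finally show ?thesis by (simp only: real_sqrt_abs) simp
      qed
      also have "\<dots> \<le> B\<^sup>2" using bdd[of t] by (intro power_mono) auto
      finally show ?case using Suc norm_triangle_ineq[of "P t" "outer (\<zeta> t) (\<zeta> t)"]
        by (simp add: P_Suc algebra_simps)
    qed simp
    also have "\<dots> \<le> c * (1 + real t)" by (simp add: c_def algebra_simps)
    moreover have "\<bar>P t $ i $ j\<bar> \<le> norm (P t)"
      using component_le_norm_cart[of "P t $ i" j] Finite_Cartesian_Product.norm_nth_le[of "P t" i] by linarith
    ultimately show ?thesis by linarith
  qed
  have prod: "(\<Prod>s<t. 1 + h s) \<le> q * (1 + real t) ^ CARD('m)"
  proof -
    have "\<bar>det (P 0)\<bar> * (\<Prod>s<t. 1 + h s) = \<bar>det (P t)\<bar>"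
      using h_nonneg by (simp add: det_P[of t] abs_mult abs_prod add_nonneg_nonneg)
    also have "\<dots> \<le> fact CARD('m) * (c * (1 + real t)) ^ CARD('m)" by (rule abs_det_le[OF entries])
    finally have "\<bar>det (P 0)\<bar> * (\<Prod>s<t. 1 + h s) \<le> fact CARD('m) * c ^ CARD('m) * (1 + real t) ^ CARD('m)"
      by (simp only: power_mult_distrib mult.assoc)
    then have "(\<Prod>s<t. 1 + h s) \<le> fact CARD('m) * c ^ CARD('m) * (1 + real t) ^ CARD('m) / \<bar>det (P 0)\<bar>"
      using d0 by (subst pos_le_divide_eq) (simp_all add: mult.commute)
    then show ?thesis by (simp add: q_def)
  qed
  have "(\<Sum>s<t. h s / (1 + h s)) \<le> (\<Sum>s<t. ln (1 + h s))"
  proof (rule sum_mono)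
    fix s
    have "ln (1 / (1 + h s)) \<le> 1 / (1 + h s) - 1" using h_nonneg[of s] by (intro ln_le_minus_one) simp
    then show "h s / (1 + h s) \<le> ln (1 + h s)" using h_nonneg[of s] by (simp add: ln_div field_simps)
  qed
  also have "\<dots> = ln (\<Prod>s<t. 1 + h s)" 
  proof (rule ln_prod[symmetric])
    show "1 + h s \<noteq> 0" for s using h_nonneg[of s] by linarith
  qed simp
  also have "\<dots> \<le> ln (q * (1 + real t) ^ CARD('m))"
    using prod h_nonneg by (intro ln_mono) (auto intro!: prod_pos add_pos_nonneg)
  also have "\<dots> = ln q + CARD('m) * ln (1 + real t)"
    using q0 by (simp add: ln_mult ln_realpow)
  also have "\<dots> \<le> (\<bar>ln q\<bar> + CARD('m)) * (1 + ln (1 + real t))"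
  proof -
    have "0 \<le> \<bar>ln q\<bar> * ln (1 + real t)" by simp
    then show ?thesis
      using abs_ge_self[of "ln q"] by (simp only: ring_distribs mult_1_right)
  qed
  finally show ?thesis by (simp add: q_def c_def)
qed

end

text \<open>A term of order \<open>3/4\<close> in \<open>B\<close> is absorbed by \<open>B\<close> up to a constant: if \<open>K\<close> exceeds the fourth root of
  \<open>B\<close>, the left-hand side is at most \<open>K ^ 4\<close>, and otherwise it is at most \<open>B\<close>.\<close>

lemma powr_three_quarters_le:
  fixes K B :: real
  assumes "0 \<le> K" "0 \<le> B"
  shows "K * B powr (3/4) \<le> B + K ^ 4"
proof (cases "B powr (1/4) \<le> K")
  case True
  have "B powr (3/4) = (B powr (1/4)) ^ 3" by (simp add: power3_eq_cube flip: powr_add)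
  also have "\<dots> \<le> K ^ 3" using True by (intro power_mono) auto
  finally have "K * B powr (3/4) \<le> K * K ^ 3" using assms by (intro mult_left_mono)
  then show ?thesis using assms by (simp add: power_eq_if)
next
  case False
  then have "K * B powr (3/4) \<le> B powr (1/4) * B powr (3/4)" by (intro mult_right_mono) auto
  also have "\<dots> = B" using assms by (simp flip: powr_add)
  finally show ?thesis by (smt (verit) zero_le_power assms(1))
qed

text \<open>\<open>E\<close> is one row of the estimation error. Subtracting the true parameter from the estimate leaves
  this recursion, in which the noise \<open>\<epsilon>\<close> is the only data besides the regressors.\<close>

locale rls_row = rls_path S \<zeta> for S :: "nat \<Rightarrow> real^'m^'m" and \<zeta> +
  fixes \<epsilon> :: "nat \<Rightarrow> real" and E :: "nat \<Rightarrow> real^'m"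
  assumes E_Suc: "\<And>t. E (Suc t) = E t - ((\<epsilon> t + E t \<bullet> \<zeta> t) / (1 + \<zeta> t \<bullet> (S t *v \<zeta> t))) *\<^sub>R (S t *v \<zeta> t)"
begin

text \<open>The Lyapunov function of least squares: the squared error in the metric of the information matrix.\<close>

definition V :: "nat \<Rightarrow> real" where
  "V t = E t \<bullet> (P t *v E t)"

text \<open>The update of \<open>E\<close> is the one for which \<open>P (Suc t) *v E (Suc t) = P t *v E t - \<epsilon> t *\<^sub>R \<zeta> t\<close>, so both
  factors of \<open>V (Suc t)\<close> are explicit.\<close>

lemma V_Suc:
  "V (Suc t) = V t + (\<epsilon> t)\<^sup>2 * (h t / (1 + h t)) - 2 * (\<epsilon> t * (E t \<bullet> \<zeta> t / (1 + h t))) - (E t \<bullet> \<zeta> t)\<^sup>2 / (1 + h t)"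
proof -
  define \<eta> c where "\<eta> = E t \<bullet> \<zeta> t" and "c = (\<epsilon> t + \<eta>) / (1 + h t)"
  have h0: "0 \<le> h t" by (rule h_nonneg)
  have E: "E (Suc t) = E t - c *\<^sub>R (S t *v \<zeta> t)" by (simp add: E_Suc c_def \<eta>_def h_def)
  have PS: "P t *v (S t *v y) = y" for y by (simp add: matrix_vector_mul_assoc P_S)
  have SP: "(S t *v \<zeta> t) \<bullet> (P t *v E t) = \<eta>"
  proof -
    have "(S t *v \<zeta> t) \<bullet> (P t *v E t) = (P t *v (S t *v \<zeta> t)) \<bullet> E t"
      using pos_def_P[of t] by (intro symmetric_inner) (simp add: pos_def_def)
    then show ?thesis by (simp add: PS \<eta>_def inner_commute)
  qed
  have "P (Suc t) *v E (Suc t) = P t *v E t + (\<eta> - c * (1 + h t)) *\<^sub>R \<zeta> t"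
    by (simp add: P_Suc_vec E matrix_vector_mult_diff_distrib matrix_vector_mult_scaleR PS inner_diff_right
        h_def[symmetric] inner_commute[of "\<zeta> t" "E t"] \<eta>_def[symmetric] algebra_simps)
  also have "\<eta> - c * (1 + h t) = - \<epsilon> t" using h0 by (simp add: c_def)
  finally have "V (Suc t) = (E t - c *\<^sub>R (S t *v \<zeta> t)) \<bullet> (P t *v E t - \<epsilon> t *\<^sub>R \<zeta> t)"
    by (simp add: V_def E)
  also have "\<dots> = V t - \<epsilon> t * \<eta> - c * \<eta> + c * \<epsilon> t * h t"
    by (simp add: inner_diff_left inner_diff_right SP V_def[symmetric] \<eta>_def[symmetric])
       (simp add: h_def inner_commute algebra_simps)
  also have "\<dots> = V t + (\<epsilon> t)\<^sup>2 * (h t / (1 + h t)) - 2 * (\<epsilon> t * (\<eta> / (1 + h t))) - \<eta>\<^sup>2 / (1 + h t)"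
    using h0 unfolding c_def by (simp add: divide_simps power2_eq_square) (simp add: algebra_simps)
  finally show ?thesis by (simp add: \<eta>_def)
qed

lemma V_eq:
  "V t + (\<Sum>s<t. (E s \<bullet> \<zeta> s)\<^sup>2 / (1 + h s)) =
   V 0 + (\<Sum>s<t. (\<epsilon> s)\<^sup>2 * (h s / (1 + h s))) - 2 * (\<Sum>s<t. \<epsilon> s * (E s \<bullet> \<zeta> s / (1 + h s)))"
  by (induction t) (simp_all add: V_Suc algebra_simps)

text \<open>With \<open>w = E \<bullet> \<zeta> / (1 + h)\<close> one has \<open>w\<^sup>2 \<le> (E \<bullet> \<zeta>)\<^sup>2 / (1 + h)\<close>, so a noise term of order \<open>3/4\<close> in
  \<open>\<Sum> w\<^sup>2\<close> is dominated by the negative drift of \<open>V\<close>.\<close>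

lemma V_le:
  assumes "\<bar>\<Sum>s<t. \<epsilon> s * (E s \<bullet> \<zeta> s / (1 + h s))\<bar> \<le> K * (1 + (\<Sum>s<t. (E s \<bullet> \<zeta> s / (1 + h s))\<^sup>2)) powr (3/4)"
  shows "V t \<le> V 0 + (\<Sum>s<t. (\<epsilon> s)\<^sup>2 * (h s / (1 + h s))) + 1 + (2 * \<bar>K\<bar>) ^ 4"
proof -
  define W where "W = (\<Sum>s<t. (E s \<bullet> \<zeta> s / (1 + h s))\<^sup>2)"
  have W0: "0 \<le> W" unfolding W_def by (intro sum_nonneg) simp
  have "W \<le> (\<Sum>s<t. (E s \<bullet> \<zeta> s)\<^sup>2 / (1 + h s))"
    unfolding W_def
  proof (rule sum_mono)
    fix s
    have "1 + h s \<le> (1 + h s)\<^sup>2" using h_nonneg[of s] by (simp add: power2_eq_square)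
    then show "(E s \<bullet> \<zeta> s / (1 + h s))\<^sup>2 \<le> (E s \<bullet> \<zeta> s)\<^sup>2 / (1 + h s)"
      using h_nonneg[of s] unfolding power_divide by (intro divide_left_mono) (auto intro: mult_pos_pos)
  qed
  moreover have "\<bar>\<Sum>s<t. \<epsilon> s * (E s \<bullet> \<zeta> s / (1 + h s))\<bar> \<le> \<bar>K\<bar> * (1 + W) powr (3/4)"
    using assms mult_right_mono[OF abs_ge_self[of K] powr_ge_zero[of "1 + W" "3/4"]] unfolding W_def by linarith
  moreover have "2 * \<bar>K\<bar> * (1 + W) powr (3/4) \<le> (1 + W) + (2 * \<bar>K\<bar>) ^ 4"
    using W0 by (intro powr_three_quarters_le) auto
  ultimately show ?thesis using V_eq[of t] by linarith
qed

lemma min_eigenvalue_mult_norm_le: "min_eigenvalue (matrix_inv (S t)) * (norm (E t))\<^sup>2 \<le> V t"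
  using min_eigenvalue_le_rayleigh[of "P t" "E t"] pos_def_P[of t]
  by (simp add: V_def matrix_inv_S pos_def_def dot_square_norm)

end

section \<open>Bounded martingales and predictable weights\<close>

text \<open>The hypothesis \<open>orth\<close> says that the partial sums are a martingale, tested against bounded functions
  of the past. Stop them when they first leave \<open>[-K, K]\<close>. The stopped sum \<open>N'\<close> is again a sum of
  orthogonal increments, so its second moment is at most \<open>C\<close>, and Chebyshev's inequality bounds the
  probability of ever leaving by \<open>C / K\<^sup>2\<close>.\<close>

lemma (in prob_space) AE_bounded_partial_sums:
  fixes m :: "nat \<Rightarrow> 'a \<Rightarrow> real" and F :: "nat \<Rightarrow> 'a measure"
  assumes sub: "\<And>t. subalgebra M (F t)"
    and mono: "\<And>s t. s \<le> t \<Longrightarrow> subalgebra (F t) (F s)"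
    and meas: "\<And>t. m t \<in> borel_measurable (F (Suc t))"
    and sq: "\<And>t. integrable M (\<lambda>\<omega>. (m t \<omega>)\<^sup>2)"
    and orth: "\<And>t H B. H \<in> borel_measurable (F t) \<Longrightarrow> (\<And>\<omega>. \<omega> \<in> space M \<Longrightarrow> \<bar>H \<omega>\<bar> \<le> B)
                \<Longrightarrow> expectation (\<lambda>\<omega>. m t \<omega> * H \<omega>) = 0"
    and bound: "\<And>t. (\<Sum>s<t. expectation (\<lambda>\<omega>. (m s \<omega>)\<^sup>2)) \<le> C"
  shows "AE \<omega> in M. \<exists>K. \<forall>t. \<bar>\<Sum>s<t. m s \<omega>\<bar> \<le> K"
proof -
  define N where "N t \<omega> = (\<Sum>s<t. m s \<omega>)" for t \<omega>
  have measM: "f \<in> borel_measurable M" if "f \<in> borel_measurable (F t)" for f :: "'a \<Rightarrow> real" and t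
    using measurable_from_subalg[OF sub that] .
  have measF: "f \<in> borel_measurable (F t)" if "f \<in> borel_measurable (F s)" "s \<le> t" for f :: "'a \<Rightarrow> real" and s t
    using measurable_from_subalg[OF mono[OF that(2)] that(1)] .
  have spF: "space (F t) = space M" for t using sub[of t] by (simp add: subalgebra_def)
  have mF: "m s \<in> borel_measurable (F t)" if "s < t" for s t
    using measF[OF meas, of s t] that by simp
  have NF: "N s \<in> borel_measurable (F t)" if "s \<le> t" for s t
    unfolding N_def using mF that by (intro borel_measurable_sum) auto
  have mM[measurable]: "m t \<in> borel_measurable M" for t using measM[OF meas] .
  have NM[measurable]: "N t \<in> borel_measurable M" for t using measM[OF NF[OF order_refl]] .
  have intm: "integrable M (m t)" for t
    using square_integrable_imp_integrable[OF mM sq] .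
  have maximal: "prob {\<omega>\<in>space M. \<exists>r. K < \<bar>N r \<omega>\<bar>} \<le> C / K\<^sup>2" if K: "0 < K" for K
  proof -
    \<comment> \<open>The weight \<open>J s\<close> keeps the increment \<open>m s\<close> while the sums have stayed in \<open>[-K, K]\<close> up to time \<open>s\<close>; it depends on the past only.\<close>
    define J where "J s \<omega> = (if \<forall>r\<le>s. \<bar>N r \<omega>\<bar> \<le> K then 1 else 0 :: real)" for s \<omega>
    have JF: "J s \<in> borel_measurable (F s)" for s
    proof -
      have [measurable]: "\<And>r. r \<le> s \<Longrightarrow> N r \<in> borel_measurable (F s)" using NF by blast
      have "{\<omega>\<in>space (F s). \<forall>r\<in>{..s}. \<bar>N r \<omega>\<bar> \<le> K} \<in> sets (F s)"
        by (intro sets.sets_Collect_finite_All') (auto intro!: borel_measurable_le borel_measurable_abs NF)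
      then have "{\<omega>\<in>space (F s). \<forall>r\<le>s. \<bar>N r \<omega>\<bar> \<le> K} \<in> sets (F s)" by simp
      then show ?thesis unfolding J_def by (intro measurable_If) auto
    qed
    define N' where "N' t \<omega> = (\<Sum>s<t. J s \<omega> * m s \<omega>)" for t \<omega>
    have N'F: "N' t \<in> borel_measurable (F t)" for t
      unfolding N'_def by (intro borel_measurable_sum borel_measurable_times) (auto intro: measF[OF JF] mF)
    have N'M[measurable]: "N' t \<in> borel_measurable M" for t using measM[OF N'F] .
    have JM[measurable]: "J t \<in> borel_measurable M" for t using measM[OF JF] .
    have J01: "0 \<le> J s \<omega>" "J s \<omega> \<le> 1" "J s \<omega> * J s \<omega> = J s \<omega>" for s \<omega> by (auto simp: J_def)
    have eqN: "N' t \<omega> = N t \<omega>" if "\<forall>r<t. \<bar>N r \<omega>\<bar> \<le> K" for t \<omega>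
      unfolding N'_def N_def using that by (intro sum.cong) (auto simp: J_def)
    have bdd: "\<bar>N' t \<omega> * J t \<omega>\<bar> \<le> K" for t \<omega>
    proof (cases "\<forall>r\<le>t. \<bar>N r \<omega>\<bar> \<le> K")
      case True
      then show ?thesis using eqN[of t \<omega>] by (auto simp: J_def)
    next
      case False
      then show ?thesis using K unfolding J_def by auto
    qed
    have second: "integrable M (\<lambda>\<omega>. (N' t \<omega>)\<^sup>2) \<and>
        expectation (\<lambda>\<omega>. (N' t \<omega>)\<^sup>2) \<le> (\<Sum>s<t. expectation (\<lambda>\<omega>. (m s \<omega>)\<^sup>2))" for t
    proof (induction t)
      case 0 then show ?case by (simp add: N'_def)
    next
      case (Suc t)
      have eq: "(N' (Suc t) \<omega>)\<^sup>2 = (N' t \<omega>)\<^sup>2 + J t \<omega> * (m t \<omega>)\<^sup>2 + 2 * (m t \<omega> * (N' t \<omega> * J t \<omega>))" for \<omega>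
        by (cases "J t \<omega> = 0") (auto simp: N'_def J_def power2_eq_square algebra_simps split: if_splits)
      have i1: "integrable M (\<lambda>\<omega>. J t \<omega> * (m t \<omega>)\<^sup>2)"
        by (rule Bochner_Integration.integrable_bound[OF sq[of t]])
           (auto intro!: AE_I2 simp: abs_mult J01 mult_left_le_one_le)
      have i2: "integrable M (\<lambda>\<omega>. m t \<omega> * (N' t \<omega> * J t \<omega>))"
      proof (rule Bochner_Integration.integrable_bound[of _ "\<lambda>\<omega>. K * m t \<omega>"])
        show "AE x in M. norm (m t x * (N' t x * J t x)) \<le> norm (K * m t x)"
        proof (rule AE_I2)
          fix x
          show "norm (m t x * (N' t x * J t x)) \<le> norm (K * m t x)"
            using mult_left_mono[OF bdd[of t x], of "\<bar>m t x\<bar>"] K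
            by (simp only: real_norm_def abs_mult[of "m t x"] abs_mult[of K]) (simp add: mult.commute)
        qed
      qed (use intm in auto)
      have z: "expectation (\<lambda>\<omega>. m t \<omega> * (N' t \<omega> * J t \<omega>)) = 0"
        by (rule orth[of _ t K]) (auto intro!: borel_measurable_times N'F JF bdd)
      have le: "expectation (\<lambda>\<omega>. J t \<omega> * (m t \<omega>)\<^sup>2) \<le> expectation (\<lambda>\<omega>. (m t \<omega>)\<^sup>2)"
        by (rule integral_mono[OF i1 sq]) (simp add: J01 mult_left_le_one_le)
      show ?case
        unfolding eq using Suc i1 i2 z le by simp
    qed
    have stop: "\<exists>r\<le>t. K < \<bar>N r \<omega>\<bar> \<Longrightarrow> K < \<bar>N' t \<omega>\<bar>" for t \<omega>
    proof -
      assume ex: "\<exists>r\<le>t. K < \<bar>N r \<omega>\<bar>"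
      define \<tau> where "\<tau> = (LEAST r. K < \<bar>N r \<omega>\<bar>)"
      have \<tau>: "K < \<bar>N \<tau> \<omega>\<bar>" "\<tau> \<le> t"
        unfolding \<tau>_def using ex by (auto intro: LeastI Least_le order_trans)
      have before: "\<bar>N r \<omega>\<bar> \<le> K" if "r < \<tau>" for r
        using not_less_Least[of r "\<lambda>r. K < \<bar>N r \<omega>\<bar>"] that by (auto simp: \<tau>_def)
      have "N' t \<omega> = N' \<tau> \<omega>"
        unfolding N'_def using \<tau>
        by (intro sum.mono_neutral_right) (auto simp: J_def not_less dest!: spec[of _ \<tau>])
      then show "K < \<bar>N' t \<omega>\<bar>" using eqN[of \<tau> \<omega>] before \<tau> by simp
    qed
    have fin: "prob {\<omega>\<in>space M. \<exists>r\<le>t. K < \<bar>N r \<omega>\<bar>} \<le> C / K\<^sup>2" for t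
    proof -
      have "prob {\<omega>\<in>space M. \<exists>r\<le>t. K < \<bar>N r \<omega>\<bar>} \<le> prob {\<omega>\<in>space M. K\<^sup>2 \<le> (N' t \<omega>)\<^sup>2}"
      proof (rule finite_measure_mono)
        show "{\<omega> \<in> space M. \<exists>r\<le>t. K < \<bar>N r \<omega>\<bar>} \<subseteq> {\<omega> \<in> space M. K\<^sup>2 \<le> (N' t \<omega>)\<^sup>2}"
        proof safe
          fix \<omega> r assume "r \<le> t" "K < \<bar>N r \<omega>\<bar>"
          then have "K < \<bar>N' t \<omega>\<bar>" using stop by blast
          then have "\<bar>K\<bar> \<le> \<bar>N' t \<omega>\<bar>" using K by simp
          then show "K\<^sup>2 \<le> (N' t \<omega>)\<^sup>2" by (simp only: abs_le_square_iff)
        qed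
      qed measurable
      also have "\<dots> \<le> expectation (\<lambda>\<omega>. (N' t \<omega>)\<^sup>2) / K\<^sup>2"
        by (rule integral_Markov_inequality_measure[where A="space M"]) (use second K in auto)
      also have "\<dots> \<le> C / K\<^sup>2"
        using second[of t] bound[of t] K by (intro divide_right_mono) auto
      finally show ?thesis .
    qed
    have "(\<lambda>t. prob {\<omega>\<in>space M. \<exists>r\<le>t. K < \<bar>N r \<omega>\<bar>})
        \<longlonglongrightarrow> prob (\<Union>t. {\<omega>\<in>space M. \<exists>r\<le>t. K < \<bar>N r \<omega>\<bar>})"
      by (rule finite_Lim_measure_incseq) (auto simp: incseq_def intro: order_trans)
    also have "(\<Union>t. {\<omega>\<in>space M. \<exists>r\<le>t. K < \<bar>N r \<omega>\<bar>}) = {\<omega>\<in>space M. \<exists>r. K < \<bar>N r \<omega>\<bar>}"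
      by auto
    finally show ?thesis
      by (rule Lim_bounded[where M=0]) (use fin in auto)
  qed
  have C0: "0 \<le> C" using bound[of 0] by simp
  have "prob {\<omega>\<in>space M. \<forall>k::nat. \<exists>r. real (Suc k) < \<bar>N r \<omega>\<bar>} \<le> 0"
  proof (rule field_le_epsilon)
    fix \<epsilon> :: real assume \<epsilon>: "0 < \<epsilon>"
    obtain k :: nat where k: "C / \<epsilon> < real k" using reals_Archimedean2 by blast
    have "prob {\<omega>\<in>space M. \<forall>k::nat. \<exists>r. real (Suc k) < \<bar>N r \<omega>\<bar>} \<le> prob {\<omega>\<in>space M. \<exists>r. real (Suc k) < \<bar>N r \<omega>\<bar>}"
      by (rule finite_measure_mono) auto
    also have "\<dots> \<le> C / (real (Suc k))\<^sup>2" by (rule maximal) simp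
    also have "\<dots> \<le> C / real (Suc k)"
      using C0 by (intro divide_left_mono) (auto simp: power2_eq_square)
    also have "\<dots> \<le> \<epsilon>"
      using k \<epsilon> by (simp add: field_simps)
    finally show "prob {\<omega>\<in>space M. \<forall>k::nat. \<exists>r. real (Suc k) < \<bar>N r \<omega>\<bar>} \<le> 0 + \<epsilon>" by simp
  qed
  then have "AE \<omega> in M. \<not> (\<forall>k::nat. \<exists>r. real (Suc k) < \<bar>N r \<omega>\<bar>)"
    by (intro AE_I[where N="{\<omega>\<in>space M. \<forall>k::nat. \<exists>r. real (Suc k) < \<bar>N r \<omega>\<bar>}"])
       (auto simp: emeasure_eq_measure measure_le_0_iff)
  then show ?thesis
    by eventually_elim (auto simp: not_less N_def)
qed

text \<open>Summation by parts. In the applications \<open>m s\<close> is a quantity of interest divided by \<open>b (Suc s)\<close>, as in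
  Kronecker's lemma, and its own partial sums are then \<open>O(b t)\<close>.\<close>

lemma weighted_partial_sums_bound:
  fixes b m :: "nat \<Rightarrow> real"
  assumes "mono b" "0 \<le> b 0" "\<And>t. \<bar>\<Sum>s<t. m s\<bar> \<le> K"
  shows "\<bar>\<Sum>s<t. b (Suc s) * m s\<bar> \<le> 2 * K * b t"
proof -
  define N where "N t = (\<Sum>s<t. m s)" for t
  have b0: "0 \<le> b s" for s using assms(1,2) by (meson dual_order.trans le0 monoD)
  have "(\<Sum>s<t. b (Suc s) * m s) = b t * N t - (\<Sum>s<t. (b (Suc s) - b s) * N s)"
    by (induction t) (simp_all add: N_def algebra_simps)
  moreover have "\<bar>b t * N t\<bar> \<le> b t * K"
    using assms(3) b0 by (simp add: abs_mult N_def mult_left_mono)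
  moreover have "\<bar>\<Sum>s<t. (b (Suc s) - b s) * N s\<bar> \<le> (\<Sum>s<t. (b (Suc s) - b s) * K)"
  proof (rule sum_abs[THEN order_trans], rule sum_mono)
    fix s
    have "b s \<le> b (Suc s)" using assms(1) by (simp add: monoD)
    then show "\<bar>(b (Suc s) - b s) * N s\<bar> \<le> (b (Suc s) - b s) * K"
      using assms(3) by (simp add: abs_mult N_def mult_left_mono)
  qed
  moreover have "(\<Sum>s<t. (b (Suc s) - b s) * K) = (b t - b 0) * K"
    by (simp add: sum_lessThan_telescope flip: sum_distrib_right)
  moreover have "0 \<le> K" using assms(3)[of 0] by simp
  then have "0 \<le> b 0 * K" using assms(2) by simp
  ultimately show ?thesis by (simp add: algebra_simps)
qed

text \<open>The sum is a lower Riemann sum of the integral of \<open>x powr (-r)\<close> over \<open>[1, \<infinity>)\<close>.\<close>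

lemma sum_increments_powr_le:
  fixes B :: "nat \<Rightarrow> real"
  assumes "mono B" "1 \<le> B 0" "1 < r"
  shows "(\<Sum>s<t. (B (Suc s) - B s) * B (Suc s) powr (-r)) \<le> 1 / (r - 1)"
proof -
  have B1: "1 \<le> B s" for s using assms by (meson dual_order.trans le0 monoD)
  have step: "(y - x) * y powr (-r) \<le> (x powr (1 - r) - y powr (1 - r)) / (r - 1)" if "1 \<le> x" "x \<le> y" for x y
  proof (cases "x = y")
    case False
    then have xy: "x < y" using that by simp
    have "\<exists>z. x < z \<and> z < y \<and> y powr (1 - r) - x powr (1 - r) = (y - x) * ((1 - r) * z powr (1 - r - 1))"
      using xy that by (intro MVT2) (use has_real_derivative_powr[where r="1 - r"] in auto)
    then obtain z where z: "x < z" "z < y" and eq: "y powr (1 - r) - x powr (1 - r) = (y - x) * ((1 - r) * z powr (-r))"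
      by auto
    have "y powr (-r) \<le> z powr (-r)" using z that assms by (intro powr_mono2') auto
    then have "(y - x) * y powr (-r) \<le> (y - x) * z powr (-r)" using xy by (intro mult_left_mono) auto
    also have "\<dots> = (x powr (1 - r) - y powr (1 - r)) / (r - 1)"
      using eq assms(3) by (simp add: field_simps)
    finally show ?thesis .
  qed simp
  have "(\<Sum>s<t. (B (Suc s) - B s) * B (Suc s) powr (-r)) \<le> (\<Sum>s<t. (B s powr (1 - r) - B (Suc s) powr (1 - r)) / (r - 1))"
    using step B1 assms(1) by (intro sum_mono) (simp add: monoD)
  also have "\<dots> = (B 0 powr (1 - r) - B t powr (1 - r)) / (r - 1)"
    by (induction t) (simp_all add: diff_divide_distrib)
  also have "\<dots> \<le> 1 / (r - 1)"
  proof -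
    have "B 0 powr (1 - r) \<le> 1 powr (1 - r)" using assms by (intro powr_mono2') auto
    then have "B 0 powr (1 - r) - B t powr (1 - r) \<le> 1" by (smt (verit) powr_ge_zero powr_one_eq_one)
    then show ?thesis using assms(3) by (intro divide_right_mono) auto
  qed
  finally show ?thesis .
qed

lemma (in prob_space) indep_set_mono:
  assumes "indep_set A B" "A' \<subseteq> A" "B' \<subseteq> B"
  shows "indep_set A' B'"
  using assms unfolding indep_sets2_eq by (meson order_trans subsetD)

text \<open>\<open>F t\<close> is the information before the noise \<open>\<epsilon> t\<close> is drawn.\<close>

locale predictable_noise = prob_space M for M :: "'a measure" +
  fixes F :: "nat \<Rightarrow> 'a measure" and \<epsilon> :: "nat \<Rightarrow> 'a \<Rightarrow> real"
  assumes subalg: "\<And>t. subalgebra M (F t)"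
    and filtration: "\<And>s t. s \<le> t \<Longrightarrow> subalgebra (F t) (F s)"
    and noise_adapted: "\<And>t. \<epsilon> t \<in> borel_measurable (F (Suc t))"
    and noise_indep: "\<And>t. indep_set (sets (vimage_algebra (space M) (\<epsilon> t) borel)) (sets (F t))"
begin

lemma measurable_M: "f \<in> borel_measurable (F t) \<Longrightarrow> f \<in> borel_measurable M"
  for f :: "'a \<Rightarrow> 'b::topological_space"
  by (rule measurable_from_subalg[OF subalg])

lemma measurable_later: "f \<in> borel_measurable (F s) \<Longrightarrow> s \<le> t \<Longrightarrow> f \<in> borel_measurable (F t)"
  for f :: "'a \<Rightarrow> 'b::topological_space"
  by (rule measurable_from_subalg[OF filtration])

lemma noise_measurable[measurable]: "\<epsilon> t \<in> borel_measurable M"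
  by (rule measurable_M[OF noise_adapted])

lemma space_F: "space (F t) = space M"
  using subalg[of t] by (simp add: subalgebra_def)

lemma expectation_noise_mult:
  assumes f[measurable]: "f \<in> borel_measurable borel" and int: "integrable M (\<lambda>\<omega>. f (\<epsilon> t \<omega>) :: real)"
    and H: "H \<in> borel_measurable (F t)" and bdd: "\<And>\<omega>. \<omega> \<in> space M \<Longrightarrow> \<bar>H \<omega>\<bar> \<le> B"
  shows "expectation (\<lambda>\<omega>. f (\<epsilon> t \<omega>) * H \<omega>) = expectation (\<lambda>\<omega>. f (\<epsilon> t \<omega>)) * expectation H"
    and "integrable M (\<lambda>\<omega>. f (\<epsilon> t \<omega>) * H \<omega>)"
proof -
  have HM[measurable]: "H \<in> borel_measurable M" by (rule measurable_M[OF H])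
  have sub1: "sigma_sets (space M) {H -` A \<inter> space M |A. A \<in> sets borel} \<subseteq> sets (F t)"
  proof -
    have "{H -` A \<inter> space M |A. A \<in> sets borel} \<subseteq> sets (F t)"
      using measurable_sets[OF H] by (auto simp: space_F)
    then show ?thesis using sets.sigma_sets_subset[of _ "F t"] by (simp add: space_F)
  qed
  have fe: "(\<lambda>\<omega>. f (\<epsilon> t \<omega>)) \<in> borel_measurable (vimage_algebra (space M) (\<epsilon> t) borel)"
    by (rule measurable_compose[OF measurable_vimage_algebra1 f]) auto
  have sub2: "sigma_sets (space M) {(\<lambda>\<omega>. f (\<epsilon> t \<omega>)) -` A \<inter> space M |A. A \<in> sets borel}
      \<subseteq> sets (vimage_algebra (space M) (\<epsilon> t) borel)"
  proof -
    have "{(\<lambda>\<omega>. f (\<epsilon> t \<omega>)) -` A \<inter> space M |A. A \<in> sets borel} \<subseteq> sets (vimage_algebra (space M) (\<epsilon> t) borel)"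
      using measurable_sets[OF fe] by auto
    then show ?thesis using sets.sigma_sets_subset[of _ "vimage_algebra (space M) (\<epsilon> t) borel"] by simp
  qed
  have "indep_var borel (\<lambda>\<omega>. f (\<epsilon> t \<omega>)) borel H"
    unfolding indep_var_eq
  proof (intro conjI)
    show "indep_set (sigma_sets (space M) {(\<lambda>\<omega>. f (\<epsilon> t \<omega>)) -` A \<inter> space M |A. A \<in> sets borel})
       (sigma_sets (space M) {H -` A \<inter> space M |A. A \<in> sets borel})"
      using indep_set_mono[OF noise_indep[of t] sub2 sub1] .
  qed auto
  moreover have "integrable M H"
    by (rule integrable_const_bound[where B=B]) (use bdd in auto)
  ultimately show "expectation (\<lambda>\<omega>. f (\<epsilon> t \<omega>) * H \<omega>) = expectation (\<lambda>\<omega>. f (\<epsilon> t \<omega>)) * expectation H"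
    and "integrable M (\<lambda>\<omega>. f (\<epsilon> t \<omega>) * H \<omega>)"
    using indep_var_lebesgue_integral[of "\<lambda>\<omega>. f (\<epsilon> t \<omega>)" H] indep_var_integrable[of "\<lambda>\<omega>. f (\<epsilon> t \<omega>)" H] int
    by auto
qed

lemma AE_bounded_weighted_noise:
  fixes f :: "nat \<Rightarrow> real \<Rightarrow> real"
  assumes f: "\<And>t. f t \<in> borel_measurable borel"
    and sq: "\<And>t. integrable M (\<lambda>\<omega>. (f t (\<epsilon> t \<omega>))\<^sup>2)"
    and mean: "\<And>t. expectation (\<lambda>\<omega>. f t (\<epsilon> t \<omega>)) = 0"
    and v: "\<And>t. v t \<in> borel_measurable (F t)"
    and v1: "\<And>t \<omega>. \<omega> \<in> space M \<Longrightarrow> \<bar>v t \<omega>\<bar> \<le> 1"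
    and bound: "\<And>t. (\<Sum>s<t. expectation (\<lambda>\<omega>. (f s (\<epsilon> s \<omega>))\<^sup>2) * expectation (\<lambda>\<omega>. (v s \<omega>)\<^sup>2)) \<le> C"
  shows "AE \<omega> in M. \<exists>K. \<forall>t. \<bar>\<Sum>s<t. f s (\<epsilon> s \<omega>) * v s \<omega>\<bar> \<le> K"
proof (rule AE_bounded_partial_sums[OF subalg filtration])
  have fM[measurable]: "(\<lambda>\<omega>. f t (\<epsilon> t \<omega>)) \<in> borel_measurable M" for t
    by (rule measurable_compose[OF noise_measurable f])
  have int: "integrable M (\<lambda>\<omega>. f t (\<epsilon> t \<omega>))" for t
    by (rule square_integrable_imp_integrable[OF fM sq])
  have v2: "\<bar>(v t \<omega>)\<^sup>2\<bar> \<le> 1" if "\<omega> \<in> space M" for t \<omega>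
    using v1[OF that, of t] by (simp add: abs_square_le_1)
  have fsq: "(\<lambda>x. (f t x)\<^sup>2) \<in> borel_measurable borel" for t using f[of t] by measurable
  have vsq: "(\<lambda>\<omega>. (v t \<omega>)\<^sup>2) \<in> borel_measurable (F t)" for t using v[of t] by measurable
  show "(\<lambda>\<omega>. f t (\<epsilon> t \<omega>) * v t \<omega>) \<in> borel_measurable (F (Suc t))" for t
    by (intro borel_measurable_times measurable_compose[OF noise_adapted f] measurable_later[OF v]) auto
  show "integrable M (\<lambda>\<omega>. (f t (\<epsilon> t \<omega>) * v t \<omega>)\<^sup>2)" for t
    using expectation_noise_mult(2)[OF fsq sq vsq v2] by (simp add: power_mult_distrib)
  show "(\<Sum>s<t. expectation (\<lambda>\<omega>. (f s (\<epsilon> s \<omega>) * v s \<omega>)\<^sup>2)) \<le> C" for t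
    using bound[of t] expectation_noise_mult(1)[OF fsq sq vsq v2] by (simp add: power_mult_distrib)
  show "expectation (\<lambda>\<omega>. f t (\<epsilon> t \<omega>) * v t \<omega> * H \<omega>) = 0"
    if H: "H \<in> borel_measurable (F t)" and B: "\<And>\<omega>. \<omega> \<in> space M \<Longrightarrow> \<bar>H \<omega>\<bar> \<le> B" for t H B
  proof -
    have bd: "\<bar>v t \<omega> * H \<omega>\<bar> \<le> B" if "\<omega> \<in> space M" for \<omega>
    proof -
      have "\<bar>v t \<omega>\<bar> * \<bar>H \<omega>\<bar> \<le> 1 * B" by (intro mult_mono v1 B that) auto
      then show ?thesis by (simp add: abs_mult)
    qed
    have "expectation (\<lambda>\<omega>. f t (\<epsilon> t \<omega>) * (v t \<omega> * H \<omega>)) = 0"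
      using expectation_noise_mult(1)[OF f[of t] int borel_measurable_times[OF v H] bd] mean by simp
    then show ?thesis by (simp add: mult.assoc)
  qed
qed

text \<open>Divide the weight \<open>w s\<close> by \<open>B (Suc s) powr (3/4)\<close>, where \<open>B (Suc s)\<close> is known before the noise
  \<open>\<epsilon> s\<close>. The squares of the new weights are increments of \<open>B\<close> over \<open>B powr (3/2)\<close> and have a bounded
  sum, so the normalized martingale is bounded. Every exponent strictly between \<open>1/2\<close> and \<open>1\<close> would
  do: above \<open>1/2\<close> for this series, below \<open>1\<close> for the result to be of smaller order than \<open>B\<close>.\<close>

lemma AE_noise_sum_growth:
  assumes mean: "\<And>t. expectation (\<epsilon> t) = 0"
    and sq: "\<And>t. integrable M (\<lambda>\<omega>. (\<epsilon> t \<omega>)\<^sup>2)" and var: "\<And>t. expectation (\<lambda>\<omega>. (\<epsilon> t \<omega>)\<^sup>2) \<le> c"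
    and w: "\<And>t. w t \<in> borel_measurable (F t)"
  shows "AE \<omega> in M. \<exists>K. \<forall>t. \<bar>\<Sum>s<t. \<epsilon> s \<omega> * w s \<omega>\<bar> \<le> K * (1 + (\<Sum>s<t. (w s \<omega>)\<^sup>2)) powr (3/4)"
proof -
  define B where "B t \<omega> = 1 + (\<Sum>s<t. (w s \<omega>)\<^sup>2)" for t \<omega>
  define v where "v s \<omega> = w s \<omega> * B (Suc s) \<omega> powr (-3/4)" for s \<omega>
  have B1: "1 \<le> B t \<omega>" for t \<omega> by (auto simp: B_def intro: sum_nonneg)
  have BF: "B (Suc t) \<in> borel_measurable (F t)" for t
    unfolding B_def using w
    by (intro borel_measurable_add borel_measurable_sum borel_measurable_power borel_measurable_const)
       (auto intro!: measurable_later[OF w])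
  have vF: "v t \<in> borel_measurable (F t)" for t
    unfolding v_def using w[of t] BF[of t] by measurable
  have v2: "(v s \<omega>)\<^sup>2 = (B (Suc s) \<omega> - B s \<omega>) * B (Suc s) \<omega> powr (-(3/2))" for s \<omega>
    using B1[of "Suc s" \<omega>] by (simp add: v_def B_def power_mult_distrib powr_power)
  have v21: "(v s \<omega>)\<^sup>2 \<le> 1" for s \<omega>
  proof -
    have "(v s \<omega>)\<^sup>2 \<le> B (Suc s) \<omega> * B (Suc s) \<omega> powr (-(3/2))"
      unfolding v2 using B1[of s \<omega>] by (intro mult_right_mono) auto
    also have "\<dots> = B (Suc s) \<omega> powr (-(1/2))"
      using B1[of "Suc s" \<omega>] powr_add[of "B (Suc s) \<omega>" 1 "-(3/2)"] by simp
    also have "\<dots> \<le> 1"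
      using powr_mono2'[of "-(1/2)" 1 "B (Suc s) \<omega>"] B1[of "Suc s" \<omega>] by simp
    finally show ?thesis .
  qed
  have v1: "\<bar>v s \<omega>\<bar> \<le> 1" for s \<omega> using v21[of s \<omega>] by (simp add: abs_square_le_1)
  have vM[measurable]: "v t \<in> borel_measurable M" for t by (rule measurable_M[OF vF])
  have vint: "integrable M (\<lambda>\<omega>. (v s \<omega>)\<^sup>2)" for s
    by (rule integrable_const_bound[where B=1]) (use v21 in auto)
  have c0: "0 \<le> c" using var[of 0] order_trans[of 0 "expectation (\<lambda>\<omega>. (\<epsilon> 0 \<omega>)\<^sup>2)" c] by simp
  have Bmono: "mono (\<lambda>s. B s \<omega>)" for \<omega>
    by (intro monoI) (auto simp: B_def intro!: sum_mono2)
  have "AE \<omega> in M. \<exists>K. \<forall>t. \<bar>\<Sum>s<t. \<epsilon> s \<omega> * v s \<omega>\<bar> \<le> K"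
  proof (rule AE_bounded_weighted_noise[where f="\<lambda>_ x. x" and C="c * 2"])
    fix t
    have "(\<Sum>s<t. expectation (\<lambda>\<omega>. (\<epsilon> s \<omega>)\<^sup>2) * expectation (\<lambda>\<omega>. (v s \<omega>)\<^sup>2))
        \<le> (\<Sum>s<t. c * expectation (\<lambda>\<omega>. (v s \<omega>)\<^sup>2))"
      by (intro sum_mono mult_right_mono var) auto
    also have "\<dots> = c * expectation (\<lambda>\<omega>. \<Sum>s<t. (v s \<omega>)\<^sup>2)"
      using vint by (simp add: sum_distrib_left)
    also have "\<dots> \<le> c * 2"
    proof (intro mult_left_mono c0)
      have "expectation (\<lambda>\<omega>. \<Sum>s<t. (v s \<omega>)\<^sup>2) \<le> expectation (\<lambda>\<omega>. 2)"
      proof (rule integral_mono)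
        show "(\<Sum>s<t. (v s \<omega>)\<^sup>2) \<le> 2" for \<omega>
          unfolding v2 using sum_increments_powr_le[OF Bmono, of \<omega> "3/2" t] B1[of 0 \<omega>] by simp
      qed (use vint in auto)
      then show "expectation (\<lambda>\<omega>. \<Sum>s<t. (v s \<omega>)\<^sup>2) \<le> 2" by (simp add: prob_space)
    qed
    finally show "(\<Sum>s<t. expectation (\<lambda>\<omega>. (\<epsilon> s \<omega>)\<^sup>2) * expectation (\<lambda>\<omega>. (v s \<omega>)\<^sup>2)) \<le> c * 2" .
  qed (use mean sq vF v1 in auto)
  then show ?thesis
  proof eventually_elim
    fix \<omega> assume "\<exists>K. \<forall>t. \<bar>\<Sum>s<t. \<epsilon> s \<omega> * v s \<omega>\<bar> \<le> K"
    then obtain K where K: "\<bar>\<Sum>s<t. \<epsilon> s \<omega> * v s \<omega>\<bar> \<le> K" for t by blast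
    define b where "b s = B s \<omega> powr (3/4)" for s
    have "mono b" unfolding b_def
      using monoD[OF Bmono[of \<omega>]] B1 by (intro monoI powr_mono2) (auto intro: order_trans[OF zero_le_one])
    moreover have "0 \<le> b 0" by (simp add: b_def)
    ultimately have le: "\<bar>\<Sum>s<t. b (Suc s) * (\<epsilon> s \<omega> * v s \<omega>)\<bar> \<le> 2 * K * b t" for t
      by (rule weighted_partial_sums_bound[OF _ _ K])
    have eq: "b (Suc s) * (\<epsilon> s \<omega> * v s \<omega>) = \<epsilon> s \<omega> * w s \<omega>" for s
      using B1[of "Suc s" \<omega>] by (simp add: b_def v_def powr_minus)
    have "\<bar>\<Sum>s<t. \<epsilon> s \<omega> * w s \<omega>\<bar> \<le> 2 * K * (1 + (\<Sum>s<t. (w s \<omega>)\<^sup>2)) powr (3/4)" for t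
      using le[of t] unfolding eq by (simp add: b_def B_def)
    then show "\<exists>K. \<forall>t. \<bar>\<Sum>s<t. \<epsilon> s \<omega> * w s \<omega>\<bar> \<le> K * (1 + (\<Sum>s<t. (w s \<omega>)\<^sup>2)) powr (3/4)" by blast
  qed
qed

end

text \<open>Monotone convergence.\<close>

lemma (in prob_space) AE_bounded_sum_if_expectation_bounded:
  fixes u :: "nat \<Rightarrow> 'a \<Rightarrow> real"
  assumes int: "\<And>s. integrable M (u s)" and nonneg: "\<And>s \<omega>. \<omega> \<in> space M \<Longrightarrow> 0 \<le> u s \<omega>"
    and bound: "\<And>t. (\<Sum>s<t. expectation (u s)) \<le> C"
  shows "AE \<omega> in M. \<exists>K. \<forall>t. (\<Sum>s<t. u s \<omega>) \<le> K"
proof -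
  have e0: "0 \<le> expectation (u s)" for s using nonneg by (intro integral_nonneg_AE AE_I2)
  have eq: "(\<integral>\<^sup>+\<omega>. ennreal (u s \<omega>) \<partial>M) = ennreal (expectation (u s))" for s
    using int nonneg by (intro nn_integral_eq_integral) auto
  have "(\<integral>\<^sup>+\<omega>. (\<Sum>s. ennreal (u s \<omega>)) \<partial>M) = (\<Sum>s. \<integral>\<^sup>+\<omega>. ennreal (u s \<omega>) \<partial>M)"
    using int by (intro nn_integral_suminf) auto
  also have "\<dots> = (SUP t. \<Sum>s<t. ennreal (expectation (u s)))"
    by (simp add: eq suminf_eq_SUP)
  also have "\<dots> \<le> ennreal C"
    using bound e0 by (intro SUP_least) (simp add: sum_ennreal ennreal_leI)
  finally have "(\<integral>\<^sup>+\<omega>. (\<Sum>s. ennreal (u s \<omega>)) \<partial>M) \<noteq> \<infinity>"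
    by (auto simp: top_unique)
  then have "AE \<omega> in M. (\<Sum>s. ennreal (u s \<omega>)) \<noteq> \<infinity>"
    using int by (intro nn_integral_noteq_infinite) auto
  then show ?thesis
    using AE_space
  proof eventually_elim
    fix \<omega> assume fin: "(\<Sum>s. ennreal (u s \<omega>)) \<noteq> \<infinity>" and \<omega>: "\<omega> \<in> space M"
    have "(\<Sum>s<t. u s \<omega>) \<le> enn2real (\<Sum>s. ennreal (u s \<omega>))" for t
    proof -
      have "ennreal (\<Sum>s<t. u s \<omega>) = (\<Sum>s<t. ennreal (u s \<omega>))"
        using nonneg[OF \<omega>] by (simp add: sum_ennreal)
      also have "\<dots> \<le> (\<Sum>s. ennreal (u s \<omega>))" by (rule sum_le_suminf) auto
      also have "\<dots> = ennreal (enn2real (\<Sum>s. ennreal (u s \<omega>)))"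
        using fin by (simp add: less_top)
      finally show ?thesis by (simp add: ennreal_le_iff)
    qed
    then show "\<exists>K. \<forall>t. (\<Sum>s<t. u s \<omega>) \<le> K" by blast
  qed
qed

text \<open>Split off the factor \<open>(x\<^sup>2) powr \<rho>\<close>. The remaining power of \<open>x\<^sup>2\<close> has an exponent \<open>2 - \<rho> \<ge> 0\<close> below
  the level \<open>b\<close> and \<open>1 - \<rho> < 0\<close> above it, so in both ranges it is largest at \<open>b\<close>.\<close>

lemma truncated_square_bounds:
  fixes x b \<rho> :: real
  assumes "1 < \<rho>" "\<rho> \<le> 2" "1 \<le> b"
  shows "x\<^sup>2 \<le> b \<Longrightarrow> (x\<^sup>2)\<^sup>2 \<le> \<bar>x\<bar> powr (2 * \<rho>) * b powr (2 - \<rho>)"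
    and "b < x\<^sup>2 \<Longrightarrow> x\<^sup>2 \<le> \<bar>x\<bar> powr (2 * \<rho>) * b powr (1 - \<rho>)"
    and "x\<^sup>2 \<le> 1 + \<bar>x\<bar> powr (2 * \<rho>)"
proof -
  have pow: "\<bar>x\<bar> powr (2 * \<rho>) = (x\<^sup>2) powr \<rho>"
  proof (cases "x = 0")
    case False
    then have "x\<^sup>2 = \<bar>x\<bar> powr 2" by (simp add: powr_numeral)
    then show ?thesis by (simp only: powr_powr)
  qed simp
  show "(x\<^sup>2)\<^sup>2 \<le> \<bar>x\<bar> powr (2 * \<rho>) * b powr (2 - \<rho>)" if "x\<^sup>2 \<le> b"
  proof (cases "x = 0")
    case False
    then have "(x\<^sup>2)\<^sup>2 = (x\<^sup>2) powr \<rho> * (x\<^sup>2) powr (2 - \<rho>)"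
      by (simp add: powr_numeral flip: powr_add)
    also have "\<dots> \<le> (x\<^sup>2) powr \<rho> * b powr (2 - \<rho>)"
      using that assms by (intro mult_left_mono powr_mono2) auto
    finally show ?thesis by (simp add: pow)
  qed simp
  show "x\<^sup>2 \<le> \<bar>x\<bar> powr (2 * \<rho>) * b powr (1 - \<rho>)" if "b < x\<^sup>2"
  proof -
    have x0: "0 < x\<^sup>2" using that assms by linarith
    then have "x\<^sup>2 = (x\<^sup>2) powr \<rho> * (x\<^sup>2) powr (1 - \<rho>)"
      by (simp flip: powr_add)
    also have "\<dots> \<le> (x\<^sup>2) powr \<rho> * b powr (1 - \<rho>)"
      using that assms by (intro mult_left_mono powr_mono2') auto
    finally show ?thesis by (simp add: pow)
  qed
  show "x\<^sup>2 \<le> 1 + \<bar>x\<bar> powr (2 * \<rho>)"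
  proof (cases "x\<^sup>2 \<le> 1")
    case True then show ?thesis by (smt (verit) powr_ge_zero)
  next
    case False
    then have "(x\<^sup>2) powr 1 \<le> (x\<^sup>2) powr \<rho>" using assms by (intro powr_mono) auto
    then show ?thesis using False by (simp add: pow)
  qed
qed

context predictable_noise
begin

text \<open>Truncate \<open>\<epsilon>\<^sup>2\<close> at the level \<open>b\<close> and normalize by \<open>b\<close>. The centred truncated part is a martingale
  with second moments of order \<open>b powr (-\<rho>) * g\<close>, and the part cut off has first moments of the same
  order. Since \<open>b\<close> dominates the sums of \<open>g\<close>, these quantities are summable by the comparison with
  an integral. What remains is the mean of the truncated part times the sum of \<open>g\<close>.\<close>

lemma AE_weighted_square_sum_growth:
  fixes g :: "nat \<Rightarrow> 'a \<Rightarrow> real" and b :: "nat \<Rightarrow> real"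
  assumes \<rho>: "1 < \<rho>" "\<rho> \<le> 2"
    and mom: "\<And>t. integrable M (\<lambda>\<omega>. \<bar>\<epsilon> t \<omega>\<bar> powr (2 * \<rho>))"
    and momL: "\<And>t. expectation (\<lambda>\<omega>. \<bar>\<epsilon> t \<omega>\<bar> powr (2 * \<rho>)) \<le> L"
    and g: "\<And>t. g t \<in> borel_measurable (F t)"
    and g01: "\<And>t \<omega>. \<omega> \<in> space M \<Longrightarrow> 0 \<le> g t \<omega>" "\<And>t \<omega>. \<omega> \<in> space M \<Longrightarrow> g t \<omega> \<le> 1"
    and b: "mono b" "1 \<le> b 0"
    and G: "\<And>t \<omega>. \<omega> \<in> space M \<Longrightarrow> (\<Sum>s<t. g s \<omega>) \<le> C * b t"
  shows "AE \<omega> in M. \<exists>K. \<forall>t. (\<Sum>s<t. (\<epsilon> s \<omega>)\<^sup>2 * g s \<omega>) \<le> K * b t"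
proof -
  have b1: "1 \<le> b t" for t using b by (meson le0 monoD order_trans)
  obtain \<omega>0 where \<omega>0: "\<omega>0 \<in> space M" using not_empty by blast
  have C0: "0 \<le> C" using G[OF \<omega>0, of 0] b1[of 0] by (simp add: zero_le_mult_iff)
  have L0: "0 \<le> L" using momL[of 0] order_trans[of 0 "expectation (\<lambda>\<omega>. \<bar>\<epsilon> 0 \<omega>\<bar> powr (2 * \<rho>))" L] by simp
  have gM[measurable]: "g t \<in> borel_measurable M" for t by (rule measurable_M[OF g])
  define Y where "Y s x = (if x\<^sup>2 \<le> b (Suc s) then x\<^sup>2 else 0)" for s and x :: real
  define Z where "Z s x = (if x\<^sup>2 \<le> b (Suc s) then 0 else x\<^sup>2)" for s and x :: real
  have [measurable]: "Y s \<in> borel_measurable borel" "Z s \<in> borel_measurable borel" for s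
    unfolding Y_def Z_def by measurable
  \<comment> \<open>The running sum \<open>B = 1 + \<Sum> g\<close> is at most \<open>(1 + C) * b\<close>, which turns the series with \<open>b\<close> into an integral comparison for \<open>B\<close>.\<close>
  define D where "D = (1 + C) powr \<rho> / (\<rho> - 1)"
  have series: "(\<Sum>s<t. g s \<omega> * b (Suc s) powr (-\<rho>)) \<le> D" if \<omega>: "\<omega> \<in> space M" for t \<omega>
  proof -
    define B where "B t = 1 + (\<Sum>s<t. g s \<omega>)" for t
    have B1: "1 \<le> B t" for t using g01(1)[OF \<omega>] by (auto simp: B_def intro: sum_nonneg)
    have Bb: "B t \<le> (1 + C) * b t" for t using G[OF \<omega>, of t] b1[of t] by (simp add: B_def algebra_simps)
    have "mono B" using g01(1)[OF \<omega>] by (intro monoI) (auto simp: B_def intro!: sum_mono2)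
    then have S: "(\<Sum>s<t. (B (Suc s) - B s) * B (Suc s) powr (-\<rho>)) \<le> 1 / (\<rho> - 1)"
      using B1 \<rho> by (intro sum_increments_powr_le)
    have "(\<Sum>s<t. g s \<omega> * b (Suc s) powr (-\<rho>))
        \<le> (\<Sum>s<t. (1 + C) powr \<rho> * ((B (Suc s) - B s) * B (Suc s) powr (-\<rho>)))"
    proof (rule sum_mono)
      fix s
      have "((1 + C) * b (Suc s)) powr (-\<rho>) \<le> B (Suc s) powr (-\<rho>)"
        using B1[of "Suc s"] Bb[of "Suc s"] \<rho> by (intro powr_mono2') auto
      then have "(1 + C) powr \<rho> * ((1 + C) * b (Suc s)) powr (-\<rho>) \<le> (1 + C) powr \<rho> * B (Suc s) powr (-\<rho>)"
        by (intro mult_left_mono) auto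
      moreover have "(1 + C) powr \<rho> * ((1 + C) * b (Suc s)) powr (-\<rho>) = b (Suc s) powr (-\<rho>)"
        using C0 b1[of "Suc s"] by (simp add: powr_mult powr_minus)
      ultimately have "g s \<omega> * b (Suc s) powr (-\<rho>) \<le> g s \<omega> * ((1 + C) powr \<rho> * B (Suc s) powr (-\<rho>))"
        using g01(1)[OF \<omega>] by (intro mult_left_mono) auto
      then show "g s \<omega> * b (Suc s) powr (-\<rho>) \<le> (1 + C) powr \<rho> * ((B (Suc s) - B s) * B (Suc s) powr (-\<rho>))"
        by (simp add: B_def algebra_simps)
    qed
    also have "\<dots> \<le> (1 + C) powr \<rho> * (1 / (\<rho> - 1))"
      unfolding sum_distrib_left[symmetric] by (intro mult_left_mono S) auto
    finally show ?thesis by (simp add: D_def)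
  qed
  have gint: "integrable M (g s)" for s
    by (rule integrable_const_bound[where B=1]) (use g01 in auto)
  have eseries: "(\<Sum>s<t. expectation (g s) * b (Suc s) powr (-\<rho>)) \<le> D" for t
  proof -
    have "(\<Sum>s<t. expectation (g s) * b (Suc s) powr (-\<rho>)) = expectation (\<lambda>\<omega>. \<Sum>s<t. g s \<omega> * b (Suc s) powr (-\<rho>))"
      using gint by simp
    also have "\<dots> \<le> expectation (\<lambda>\<omega>. D)"
      by (rule integral_mono) (use gint series in auto)
    finally show ?thesis by (simp add: prob_space)
  qed
  have eg0: "0 \<le> expectation (g s)" for s using g01(1) by (intro integral_nonneg_AE AE_I2)

  have Ysq_le: "(Y s x)\<^sup>2 \<le> \<bar>x\<bar> powr (2 * \<rho>) * b (Suc s) powr (2 - \<rho>)" for s x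
    using truncated_square_bounds(1)[OF \<rho> b1] by (simp add: Y_def)
  have Z_le: "Z s x \<le> \<bar>x\<bar> powr (2 * \<rho>) * b (Suc s) powr (1 - \<rho>)" for s x
    using truncated_square_bounds(2)[OF \<rho> b1] by (simp add: Z_def)
  have Y0: "0 \<le> Y s x" "Y s x \<le> b (Suc s)" "Y s x \<le> 1 + \<bar>x\<bar> powr (2 * \<rho>)" for s x
    using b1[of "Suc s"] truncated_square_bounds(3)[OF \<rho>, of "b 0" x] b by (auto simp: Y_def add_nonneg_nonneg)
  have Z0: "0 \<le> Z s x" for s x by (simp add: Z_def)
  have Yint: "integrable M (\<lambda>\<omega>. Y s (\<epsilon> s \<omega>))" for s
    by (rule integrable_const_bound[where B="b (Suc s)"]) (use Y0[of s] in auto)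
  have Y2int: "integrable M (\<lambda>\<omega>. (Y s (\<epsilon> s \<omega>))\<^sup>2)" for s
    by (rule integrable_const_bound[where B="(b (Suc s))\<^sup>2"]) (use Y0[of s] in \<open>auto intro!: power_mono\<close>)
  have Zint: "integrable M (\<lambda>\<omega>. Z s (\<epsilon> s \<omega>))" for s
    by (rule Bochner_Integration.integrable_bound[OF integrable_mult_left[OF mom[of s], of "b (Suc s) powr (1 - \<rho>)"]])
       (use Z_le Z0 in auto)
  define y where "y s = expectation (\<lambda>\<omega>. Y s (\<epsilon> s \<omega>))" for s
  have y0: "0 \<le> y s" for s unfolding y_def using Y0 by (intro integral_nonneg_AE AE_I2)
  have yL: "y s \<le> 1 + L" for s
  proof -
    have "y s \<le> expectation (\<lambda>\<omega>. 1 + \<bar>\<epsilon> s \<omega>\<bar> powr (2 * \<rho>))"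
      unfolding y_def by (rule integral_mono) (use Yint mom Y0 in auto)
    then show ?thesis using mom momL[of s] by (simp add: prob_space)
  qed
  have EY2: "expectation (\<lambda>\<omega>. (Y s (\<epsilon> s \<omega>))\<^sup>2) \<le> L * b (Suc s) powr (2 - \<rho>)" for s
  proof -
    have "expectation (\<lambda>\<omega>. (Y s (\<epsilon> s \<omega>))\<^sup>2) \<le> expectation (\<lambda>\<omega>. \<bar>\<epsilon> s \<omega>\<bar> powr (2 * \<rho>) * b (Suc s) powr (2 - \<rho>))"
      by (rule integral_mono) (use Y2int mom Ysq_le in auto)
    also have "\<dots> \<le> L * b (Suc s) powr (2 - \<rho>)" using mom momL[of s] by (simp add: mult_right_mono)
    finally show ?thesis .
  qed
  have EZ: "expectation (\<lambda>\<omega>. Z s (\<epsilon> s \<omega>)) \<le> L * b (Suc s) powr (1 - \<rho>)" for s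
  proof -
    have "expectation (\<lambda>\<omega>. Z s (\<epsilon> s \<omega>)) \<le> expectation (\<lambda>\<omega>. \<bar>\<epsilon> s \<omega>\<bar> powr (2 * \<rho>) * b (Suc s) powr (1 - \<rho>))"
      by (rule integral_mono) (use Zint mom Z_le in auto)
    also have "\<dots> \<le> L * b (Suc s) powr (1 - \<rho>)" using mom momL[of s] by (simp add: mult_right_mono)
    finally show ?thesis .
  qed
  define v where "v s \<omega> = g s \<omega> / b (Suc s)" for s \<omega>
  have vF: "v t \<in> borel_measurable (F t)" for t unfolding v_def using g[of t] by measurable
  have v0: "0 \<le> v s \<omega>" if "\<omega> \<in> space M" for s \<omega>
    using g01[OF that, of s] b1[of "Suc s"] by (auto simp: v_def)
  have v1: "v s \<omega> \<le> 1" if "\<omega> \<in> space M" for s \<omega>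
    using g01(2)[OF that, of s] b1[of "Suc s"] by (simp add: v_def field_simps)
  have vabs: "\<bar>v s \<omega>\<bar> \<le> 1" if "\<omega> \<in> space M" for s \<omega>
    using v0[OF that, of s] v1[OF that, of s] by simp
  have vM[measurable]: "v t \<in> borel_measurable M" for t by (rule measurable_M[OF vF])
  have vint: "integrable M (v s)" for s
    by (rule integrable_const_bound[where B=1]) (use vabs in auto)
  have v2int: "integrable M (\<lambda>\<omega>. (v s \<omega>)\<^sup>2)" for s
    by (rule integrable_const_bound[where B=1]) (use vabs in \<open>auto simp: abs_square_le_1\<close>)
  have Ev: "expectation (v s) = expectation (g s) * b (Suc s) powr (-1)" for s
    using b1[of "Suc s"] by (simp add: v_def[abs_def] powr_minus_divide)
  have Ev2: "expectation (\<lambda>\<omega>. (v s \<omega>)\<^sup>2) \<le> expectation (g s) * b (Suc s) powr (-2)" for s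
  proof -
    have "expectation (\<lambda>\<omega>. (v s \<omega>)\<^sup>2) \<le> expectation (\<lambda>\<omega>. g s \<omega> * b (Suc s) powr (-2))"
    proof (rule integral_mono[OF v2int])
      fix \<omega> assume \<omega>: "\<omega> \<in> space M"
      have "(g s \<omega>)\<^sup>2 \<le> g s \<omega>" using g01[OF \<omega>, of s] by (simp add: power2_eq_square mult_left_le)
      then show "(v s \<omega>)\<^sup>2 \<le> g s \<omega> * b (Suc s) powr (-2)"
        using b1[of "Suc s"] by (simp add: v_def power_divide powr_minus_divide powr_numeral divide_right_mono)
    qed (use gint in auto)
    then show ?thesis using gint by simp
  qed
  have bpowr: "b (Suc s) powr (2 - \<rho>) * b (Suc s) powr (-2) = b (Suc s) powr (-\<rho>)"
    "b (Suc s) powr (1 - \<rho>) * b (Suc s) powr (-1) = b (Suc s) powr (-\<rho>)" for s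
    by (simp_all only: powr_add[symmetric]) simp_all

  have "AE \<omega> in M. \<exists>K. \<forall>t. \<bar>\<Sum>s<t. (Y s (\<epsilon> s \<omega>) - y s) * v s \<omega>\<bar> \<le> K"
  proof (rule AE_bounded_weighted_noise[where f="\<lambda>s x. Y s x - y s" and C="L * D"])
    fix t
    show "expectation (\<lambda>\<omega>. Y t (\<epsilon> t \<omega>) - y t) = 0"
      using Yint by (simp add: y_def prob_space)
    show "integrable M (\<lambda>\<omega>. (Y t (\<epsilon> t \<omega>) - y t)\<^sup>2)"
      using Yint Y2int by (simp add: power2_diff)
    have "expectation (\<lambda>\<omega>. (Y s (\<epsilon> s \<omega>) - y s)\<^sup>2) * expectation (\<lambda>\<omega>. (v s \<omega>)\<^sup>2)
        \<le> L * (expectation (g s) * b (Suc s) powr (-\<rho>))" for s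
    proof -
      have "expectation (\<lambda>\<omega>. (Y s (\<epsilon> s \<omega>) - y s)\<^sup>2) = expectation (\<lambda>\<omega>. (Y s (\<epsilon> s \<omega>))\<^sup>2) - (y s)\<^sup>2"
        using variance_eq[OF Yint Y2int] by (simp add: y_def)
      also have "\<dots> \<le> L * b (Suc s) powr (2 - \<rho>)" using EY2[of s] by (smt (verit) zero_le_power2)
      finally have "expectation (\<lambda>\<omega>. (Y s (\<epsilon> s \<omega>) - y s)\<^sup>2) * expectation (\<lambda>\<omega>. (v s \<omega>)\<^sup>2)
          \<le> (L * b (Suc s) powr (2 - \<rho>)) * (expectation (g s) * b (Suc s) powr (-2))"
        using L0 by (intro mult_mono Ev2) auto
      also have "\<dots> = L * (expectation (g s) * (b (Suc s) powr (2 - \<rho>) * b (Suc s) powr (-2)))"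
        by (simp only: mult_ac)
      finally show ?thesis by (simp only: bpowr)
    qed
    then have "(\<Sum>s<t. expectation (\<lambda>\<omega>. (Y s (\<epsilon> s \<omega>) - y s)\<^sup>2) * expectation (\<lambda>\<omega>. (v s \<omega>)\<^sup>2))
        \<le> L * (\<Sum>s<t. expectation (g s) * b (Suc s) powr (-\<rho>))"
      unfolding sum_distrib_left by (intro sum_mono)
    also have "\<dots> \<le> L * D" by (intro mult_left_mono eseries L0)
    finally show "(\<Sum>s<t. expectation (\<lambda>\<omega>. (Y s (\<epsilon> s \<omega>) - y s)\<^sup>2) * expectation (\<lambda>\<omega>. (v s \<omega>)\<^sup>2)) \<le> L * D" .
  qed (use vF vabs in auto)
  moreover have "AE \<omega> in M. \<exists>K. \<forall>t. (\<Sum>s<t. Z s (\<epsilon> s \<omega>) * v s \<omega>) \<le> K"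
  proof (rule AE_bounded_sum_if_expectation_bounded[where C="L * D"])
    note prod = expectation_noise_mult[OF _ Zint vF vabs]
    show "integrable M (\<lambda>\<omega>. Z s (\<epsilon> s \<omega>) * v s \<omega>)" for s by (rule prod(2)) auto
    show "0 \<le> Z s (\<epsilon> s \<omega>) * v s \<omega>" if "\<omega> \<in> space M" for s \<omega> using Z0 v0[OF that] by simp
    fix t
    have "expectation (\<lambda>\<omega>. Z s (\<epsilon> s \<omega>) * v s \<omega>) \<le> L * (expectation (g s) * b (Suc s) powr (-\<rho>))" for s
    proof -
      have "expectation (\<lambda>\<omega>. Z s (\<epsilon> s \<omega>) * v s \<omega>) = expectation (\<lambda>\<omega>. Z s (\<epsilon> s \<omega>)) * expectation (v s)"
        by (rule prod(1)) auto
      also have "\<dots> \<le> (L * b (Suc s) powr (1 - \<rho>)) * (expectation (g s) * b (Suc s) powr (-1))"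
        unfolding Ev using eg0 by (intro mult_right_mono EZ) auto
      also have "\<dots> = L * (expectation (g s) * (b (Suc s) powr (1 - \<rho>) * b (Suc s) powr (-1)))"
        by (simp only: mult_ac)
      finally show ?thesis by (simp only: bpowr)
    qed
    then have "(\<Sum>s<t. expectation (\<lambda>\<omega>. Z s (\<epsilon> s \<omega>) * v s \<omega>))
        \<le> L * (\<Sum>s<t. expectation (g s) * b (Suc s) powr (-\<rho>))"
      unfolding sum_distrib_left by (intro sum_mono)
    also have "\<dots> \<le> L * D" by (intro mult_left_mono eseries L0)
    finally show "(\<Sum>s<t. expectation (\<lambda>\<omega>. Z s (\<epsilon> s \<omega>) * v s \<omega>)) \<le> L * D" .
  qed
  ultimately show ?thesis
    using AE_space
  proof eventually_elim
    fix \<omega> assume "\<exists>K. \<forall>t. \<bar>\<Sum>s<t. (Y s (\<epsilon> s \<omega>) - y s) * v s \<omega>\<bar> \<le> K"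
      and "\<exists>K. \<forall>t. (\<Sum>s<t. Z s (\<epsilon> s \<omega>) * v s \<omega>) \<le> K" and \<omega>: "\<omega> \<in> space M"
    then obtain K1 K2 where K1: "\<And>t. \<bar>\<Sum>s<t. (Y s (\<epsilon> s \<omega>) - y s) * v s \<omega>\<bar> \<le> K1"
      and K2: "\<And>t. (\<Sum>s<t. Z s (\<epsilon> s \<omega>) * v s \<omega>) \<le> K2" by blast
    have "(\<Sum>s<t. (\<epsilon> s \<omega>)\<^sup>2 * g s \<omega>) \<le> (2 * K1 + (1 + L) * C + K2) * b t" for t
    proof -
      have split: "(\<epsilon> s \<omega>)\<^sup>2 * g s \<omega> = b (Suc s) * ((Y s (\<epsilon> s \<omega>) - y s) * v s \<omega>) + y s * g s \<omega>
          + b (Suc s) * (Z s (\<epsilon> s \<omega>) * v s \<omega>)" for s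
      proof -
        have "(\<epsilon> s \<omega>)\<^sup>2 = Y s (\<epsilon> s \<omega>) + Z s (\<epsilon> s \<omega>)" by (simp add: Y_def Z_def)
        then show ?thesis using b1[of "Suc s"] by (simp add: v_def algebra_simps)
      qed
      have "(\<Sum>s<t. b (Suc s) * ((Y s (\<epsilon> s \<omega>) - y s) * v s \<omega>)) \<le> 2 * K1 * b t"
        using weighted_partial_sums_bound[OF b(1) _ K1, of t] b(2) by (simp add: abs_le_iff)
      moreover have "(\<Sum>s<t. y s * g s \<omega>) \<le> (1 + L) * (C * b t)"
      proof -
        have "(\<Sum>s<t. y s * g s \<omega>) \<le> (\<Sum>s<t. (1 + L) * g s \<omega>)"
          using g01(1)[OF \<omega>] by (intro sum_mono mult_right_mono yL)
        also have "\<dots> \<le> (1 + L) * (C * b t)"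
          unfolding sum_distrib_left[symmetric] using L0 by (intro mult_left_mono G \<omega>) auto
        finally show ?thesis .
      qed
      moreover have "(\<Sum>s<t. b (Suc s) * (Z s (\<epsilon> s \<omega>) * v s \<omega>)) \<le> K2 * b t"
      proof -
        have "(\<Sum>s<t. b (Suc s) * (Z s (\<epsilon> s \<omega>) * v s \<omega>)) \<le> (\<Sum>s<t. b t * (Z s (\<epsilon> s \<omega>) * v s \<omega>))"
          using b(1) Z0 v0[OF \<omega>] by (intro sum_mono mult_right_mono) (auto simp: monoD)
        also have "\<dots> \<le> b t * K2"
          unfolding sum_distrib_left[symmetric] using b1[of t] by (intro mult_left_mono K2) auto
        finally show ?thesis by (simp add: mult.commute)
      qed
      moreover have "(2 * K1 + (1 + L) * C + K2) * b t = 2 * K1 * b t + (1 + L) * (C * b t) + K2 * b t"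
        by (simp add: algebra_simps)
      ultimately show ?thesis
        unfolding split sum.distrib by linarith
    qed
    then show "\<exists>K. \<forall>t. (\<Sum>s<t. (\<epsilon> s \<omega>)\<^sup>2 * g s \<omega>) \<le> K * b t" by blast
  qed
qed

end

section \<open>The equilibrium as a function of the incentive\<close>

lemma features_differentiable: "features \<alpha> differentiable (at x within A)"
proof -
  have "(\<lambda>x. (\<Prod>j\<in>UNIV. (x $ j) ^ \<alpha> k j)) differentiable (at x within A)" for k
  proof -
    have "(\<lambda>x. (\<Prod>j\<in>J. (x $ j) ^ \<alpha> k j)) differentiable (at x within A)" if "finite J" for J
      using that
      by (induction J) (auto intro!: differentiable_mult[OF differentiable_power]
          bounded_linear_imp_differentiable[OF bounded_linear_vec_nth])
    then show ?thesis by simp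
  qed
  then have "(\<lambda>x. \<Sum>k\<in>UNIV. (\<Prod>j\<in>UNIV. (x $ j) ^ \<alpha> k j) *\<^sub>R axis k (1::real)) differentiable (at x within A)"
    by (intro differentiable_sum differentiable_scaleR) auto
  moreover have "(\<Sum>k\<in>UNIV. (\<Prod>j\<in>UNIV. (x $ j) ^ \<alpha> k j) *\<^sub>R axis k (1::real)) = features \<alpha> x" for x
    by (simp add: features_def vec_eq_iff axis_def if_distrib cong: if_cong)
  ultimately show ?thesis by simp
qed

lemma continuous_features: "continuous_on A (features \<alpha>)"
  using features_differentiable by (auto intro!: continuous_at_imp_continuous_on differentiable_imp_continuous_within)

lemma sym_part_quadratic: "v \<bullet> (sym_part A *v v) = v \<bullet> (A *v v)"
proof -
  have "v \<bullet> (transpose A *v v) = v \<bullet> (A *v v)"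
    by (metis dot_lmul_matrix inner_commute transpose_matrix_vector)
  moreover have "sym_part A *v v = (1/2) *\<^sub>R (A *v v) + (1/2) *\<^sub>R (transpose A *v v)"
    by (simp add: sym_part_def scaleR_matrix_vector_assoc[symmetric] matrix_vector_mult_add_rdistrib scaleR_add_right del: transpose_matrix_vector)
  ultimately show ?thesis by (simp add: inner_add_right del: transpose_matrix_vector)
qed

text \<open>Symmetrizing a matrix does not change its quadratic form.\<close>

lemma loewner_ge_scaled_identity:
  assumes "loewner_ge (sym_part A) (c *\<^sub>R mat 1)"
  shows "c * (v \<bullet> v) \<le> v \<bullet> (A *v v)"
proof -
  have "0 \<le> v \<bullet> ((sym_part A - c *\<^sub>R mat 1) *v v)"
    using assms by (simp add: loewner_ge_def psd_def)
  then show ?thesis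
    by (simp add: matrix_vector_mult_diff_rdistrib scaleR_matrix_vector_assoc[symmetric] inner_diff_right sym_part_quadratic)
qed

lemma deviate_simps [simp]:
  "deviate x i y $ i = y" "deviate x i (x $ i) = x" "deviate (deviate x i z) i y = deviate x i y"
  by (auto simp: deviate_def vec_eq_iff)

lemma deviate_in_profiles: "x \<in> profiles X \<Longrightarrow> y \<in> X i \<Longrightarrow> deviate x i y \<in> profiles X"
  by (simp add: profiles_def deviate_def)

lemma deviate_minus: "deviate x i y - x = (y - x $ i) *\<^sub>R axis i 1"
  by (auto simp: deviate_def vec_eq_iff axis_def)

locale typed_game =
  fixes X :: "'n::finite \<Rightarrow> real set" and \<alpha> :: "'m::finite \<Rightarrow> 'n \<Rightarrow> nat"
    and l :: "'n \<Rightarrow> real^'n \<Rightarrow> real" and \<Theta> :: "real^'m^'n" and xd ud :: "real^'n"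
  assumes X: "\<And>i. compact (X i) \<and> convex (X i)" and xd: "xd \<in> profiles X"
    and types: "has_types X \<alpha> l \<Theta>" and type_assm: "type_assumption X \<alpha> \<Theta>"
begin

lemma convex_profiles: "convex (profiles X)"
  using X unfolding convex_def profiles_def by auto

lemma compact_profiles: "compact (profiles X)"
proof -
  have eq: "profiles X = (\<Inter>i. (\<lambda>x. x $ i) -` X i)" by (auto simp: profiles_def)
  have closed: "closed (profiles X)"
    unfolding eq by (intro closed_INT ballI closed_vimage_vec_nth compact_imp_closed) (use X in auto)
  have "\<exists>B. \<forall>y\<in>X i. \<bar>y\<bar> \<le> B" for i
    using X[of i] compact_imp_bounded[of "X i"] by (auto simp: bounded_iff)
  then obtain B where B: "\<And>i y. y \<in> X i \<Longrightarrow> \<bar>y\<bar> \<le> B i" by metis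
  have "norm x \<le> (\<Sum>i\<in>UNIV. B i)" if "x \<in> profiles X" for x
    using that norm_le_l1_cart[of x] sum_mono[of UNIV "\<lambda>i. \<bar>x $ i\<bar>" B] B by (force simp: profiles_def)
  then have "bounded (profiles X)" by (auto simp: bounded_iff)
  then show ?thesis using closed by (simp add: compact_eq_bounded_closed)
qed

definition G :: "real^'n \<Rightarrow> real^'n" where
  "G x = \<Theta> *v features \<alpha> x"

text \<open>The first-order conditions of all agents, as a variational inequality. Stated for each coordinate
  separately it is invariant under scaling by positive diagonal matrices such as \<open>R\<close>.\<close>

definition VI :: "real^'n \<Rightarrow> real^'n \<Rightarrow> bool" where
  "VI p x \<longleftrightarrow> x \<in> profiles X \<and> (\<forall>i. \<forall>y\<in>X i. 0 \<le> (G x $ i + p $ i) * (y - x $ i))"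

text \<open>Integrate the lower bound for the Jacobian of \<open>R G\<close> along a segment of the convex set of profiles.\<close>

lemma strongly_monotone:
  "\<exists>m (R :: real^'n^'n). 0 < m \<and> (\<forall>i. 0 < R $ i $ i) \<and> (\<forall>v i. (R *v v) $ i = R $ i $ i * v $ i) \<and>
    (\<forall>x y. x \<in> profiles X \<longrightarrow> y \<in> profiles X \<longrightarrow> m * ((x - y) \<bullet> (x - y)) \<le> (x - y) \<bullet> (R *v (G x - G y)))"
proof -
  obtain m R where m: "0 < m" and R_assms: "(\<forall>i j. i \<noteq> j \<longrightarrow> R $ i $ j = 0) \<and> (\<forall>i. 0 < R $ i $ i) \<and>
      (\<forall>x\<in>profiles X. loewner_ge (sym_part (R ** \<Theta> ** jacobian (features \<alpha>) (at x))) ((m / 2) *\<^sub>R mat 1))"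
    using type_assm unfolding type_assumption_def
    by - (atomize_elim, elim exE conjE, intro exI conjI; assumption)
  have diag: "\<And>i j. i \<noteq> j \<Longrightarrow> R $ i $ j = 0" and pos: "\<And>i. 0 < R $ i $ i"
    and sym: "\<And>x. x \<in> profiles X \<Longrightarrow>
      loewner_ge (sym_part (R ** \<Theta> ** jacobian (features \<alpha>) (at x))) ((m / 2) *\<^sub>R mat 1)"
    using R_assms by auto
  have R: "(R *v v) $ i = R $ i $ i * v $ i" for v i
  proof -
    have "(R *v v) $ i = (\<Sum>j\<in>UNIV. if j = i then R $ i $ i * v $ i else 0)"
      unfolding matrix_vector_mult_def vec_lambda_beta
    proof (rule sum.cong[OF refl])
      show "R $ i $ j * v $ j = (if j = i then R $ i $ i * v $ i else 0)" for j
        using diag[of i j] by auto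
    qed
    then show ?thesis by simp
  qed
  have "m / 2 * ((x - y) \<bullet> (x - y)) \<le> (x - y) \<bullet> (R *v (G x - G y))"
    if x: "x \<in> profiles X" and y: "y \<in> profiles X" for x y
  proof -
    define v where "v = x - y"
    define c where "c t = y + t *\<^sub>R v" for t
    define J where "J t = jacobian (features \<alpha>) (at (c t))" for t
    have c_in: "c t \<in> profiles X" if "0 \<le> t" "t \<le> 1" for t
    proof -
      have "c t = (1 - t) *\<^sub>R y + t *\<^sub>R x" by (simp add: c_def v_def algebra_simps)
      then show ?thesis using convexD_alt[OF convex_profiles y x that] by simp
    qed
    have der: "((\<lambda>t. v \<bullet> ((R ** \<Theta>) *v features \<alpha> (c t))) has_derivative
        (\<lambda>h. v \<bullet> ((R ** \<Theta>) *v (J t *v (h *\<^sub>R v))))) (at t within A)" for t A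
    proof -
      have "(c has_derivative (\<lambda>h. h *\<^sub>R v)) (at t within A)"
        unfolding c_def by (auto intro!: derivative_eq_intros)
      moreover have "(features \<alpha> has_derivative (\<lambda>h. J t *v h)) (at (c t))"
        unfolding J_def using features_differentiable jacobian_works by blast
      ultimately have "((\<lambda>t. features \<alpha> (c t)) has_derivative (\<lambda>h. J t *v (h *\<^sub>R v))) (at t within A)"
        by (rule has_derivative_compose)
      then show ?thesis
        by (intro has_derivative_inner_right bounded_linear.has_derivative[OF matrix_vector_mul_bounded_linear])
    qed
    obtain z where z: "z \<in> {0<..<1}"
      and eq: "v \<bullet> ((R ** \<Theta>) *v features \<alpha> (c 1)) - v \<bullet> ((R ** \<Theta>) *v features \<alpha> (c 0))
        = v \<bullet> ((R ** \<Theta>) *v (J z *v ((1 - 0) *\<^sub>R v)))"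
      using mvt_simple[of 0 1 "\<lambda>t. v \<bullet> ((R ** \<Theta>) *v features \<alpha> (c t))", OF _ der] by auto
    have "m / 2 * (v \<bullet> v) \<le> v \<bullet> ((R ** \<Theta> ** J z) *v v)"
      unfolding J_def using z by (intro loewner_ge_scaled_identity sym c_in) auto
    also have "\<dots> = v \<bullet> (R *v (G x - G y))"
      using eq by (simp add: c_def v_def G_def matrix_vector_mul_assoc matrix_vector_mult_diff_distrib inner_diff_right)
    finally show ?thesis by (simp add: v_def)
  qed
  then show ?thesis using m pos R by (intro exI[of _ "m / 2"] exI[of _ R] conjI) auto
qed

text \<open>Strong monotonicity for two profiles that differ in coordinate \<open>i\<close> only: the cost of an agent is
  convex in the agent's own action.\<close>

lemma G_monotone_own:
  assumes x: "x \<in> profiles X" and y: "y \<in> X i"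
  shows "0 \<le> (G (deviate x i y) $ i - G x $ i) * (y - x $ i)"
proof -
  obtain m R where m: "0 < m" and R: "\<And>i. 0 < R $ i $ i" "\<And>v i. (R *v v) $ i = R $ i $ i * v $ i"
    and mono: "\<And>x y. x \<in> profiles X \<Longrightarrow> y \<in> profiles X \<Longrightarrow> m * ((x - y) \<bullet> (x - y)) \<le> (x - y) \<bullet> (R *v (G x - G y))"
    using strongly_monotone by atomize_elim
  let ?d = "deviate x i y"
  have "0 \<le> m * ((?d - x) \<bullet> (?d - x))" using m by simp
  also have "\<dots> \<le> (?d - x) \<bullet> (R *v (G ?d - G x))" by (intro mono deviate_in_profiles x y)
  also have "\<dots> = R $ i $ i * ((G ?d $ i - G x $ i) * (y - x $ i))"
    unfolding deviate_minus by (simp add: inner_axis' R(2))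
  finally show ?thesis using R(1)[of i] by (simp add: zero_le_mult_iff)
qed

lemma cost_along_segment:
  fixes p :: "real^'n"
  assumes x: "x \<in> profiles X" and y: "y \<in> X i"
  defines "f \<equiv> \<lambda>t. l i (deviate x i (x $ i + t * (y - x $ i))) + incentive xd ud i (deviate x i (x $ i + t * (y - x $ i))) p"
  assumes t: "0 \<le> t" "t \<le> 1"
  shows "(f has_real_derivative (G (deviate x i (x $ i + t * (y - x $ i))) $ i + p $ i) * (y - x $ i)) (at t within {0..1})"
proof -
  define g where "g t = x $ i + t * (y - x $ i)" for t
  have g_in: "g t \<in> X i" if "0 \<le> t" "t \<le> 1" for t
  proof -
    have "g t = (1 - t) *\<^sub>R (x $ i) + t *\<^sub>R y" by (simp add: g_def algebra_simps)
    moreover have "x $ i \<in> X i" using x by (simp add: profiles_def)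
    ultimately show ?thesis using convexD_alt[of "X i" "x $ i" y t] X[of i] y that by simp
  qed
  have "deviate x i (g t) \<in> profiles X" using deviate_in_profiles[OF x g_in[OF t]] .
  then have "((\<lambda>y. l i (deviate (deviate x i (g t)) i y)) has_real_derivative (\<Theta> $ i) \<bullet> features \<alpha> (deviate x i (g t)))
      (at (deviate x i (g t) $ i) within X i)"
    using types unfolding has_types_def by blast
  then have "((\<lambda>y. l i (deviate x i y)) has_real_derivative G (deviate x i (g t)) $ i) (at (g t) within X i)"
    by (simp add: G_def matrix_vector_mul_component)
  moreover have "((\<lambda>y. incentive xd ud i (deviate x i y) p) has_real_derivative p $ i) (at (g t) within X i)"
    unfolding incentive_def by (auto intro!: derivative_eq_intros)
  ultimately have "((\<lambda>y. l i (deviate x i y) + incentive xd ud i (deviate x i y) p)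
      has_real_derivative G (deviate x i (g t)) $ i + p $ i) (at (g t) within X i)"
    by (rule DERIV_add)
  moreover have "g ` {0..1} \<subseteq> X i" using g_in by auto
  ultimately have "((\<lambda>y. l i (deviate x i y) + incentive xd ud i (deviate x i y) p)
      has_real_derivative G (deviate x i (g t)) $ i + p $ i) (at (g t) within g ` {0..1})"
    by (rule DERIV_subset)
  moreover have "(g has_real_derivative (y - x $ i)) (at t within {0..1})"
    unfolding g_def by (auto intro!: derivative_eq_intros)
  ultimately have "((\<lambda>y. l i (deviate x i y) + incentive xd ud i (deviate x i y) p) \<circ> g
      has_real_derivative (G (deviate x i (g t)) $ i + p $ i) * (y - x $ i)) (at t within {0..1})"
    by (rule DERIV_image_chain)
  then show ?thesis by (simp add: f_def g_def o_def)
qed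

text \<open>An equilibrium satisfies the first-order conditions, where derivatives are one-sided at end points.
  They are sufficient because each cost is convex in the agent's own action.\<close>

lemma nash_iff_VI: "nash_equilibrium X (\<lambda>i x. l i x + incentive xd ud i x p) x \<longleftrightarrow> VI p x"
proof
  assume N: "nash_equilibrium X (\<lambda>i x. l i x + incentive xd ud i x p) x"
  then have x: "x \<in> profiles X" by (simp add: nash_equilibrium_def)
  show "VI p x"
    unfolding VI_def
  proof (intro conjI allI ballI x)
    fix i y assume y: "y \<in> X i"
    let ?g = "\<lambda>t. x $ i + t * (y - x $ i)"
    let ?f = "\<lambda>t. l i (deviate x i (?g t)) + incentive xd ud i (deviate x i (?g t)) p"
    have der: "(?f has_real_derivative (G x $ i + p $ i) * (y - x $ i)) (at 0 within {0..1})"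
      using cost_along_segment[OF x y, of 0 p] by simp
    have min: "?f 0 \<le> ?f t" if "0 \<le> t" "t \<le> 1" for t
    proof -
      have "?g t = (1 - t) *\<^sub>R (x $ i) + t *\<^sub>R y" by (simp add: algebra_simps)
      moreover have "x $ i \<in> X i" using x by (simp add: profiles_def)
      ultimately have "?g t \<in> X i" using convexD_alt[of "X i" "x $ i" y t] X[of i] y that by simp
      then show ?thesis using N by (simp add: nash_equilibrium_def)
    qed
    show "0 \<le> (G x $ i + p $ i) * (y - x $ i)"
    proof (rule ccontr)
      assume "\<not> ?thesis"
      then obtain d where d: "0 < d" "\<And>h. 0 < h \<Longrightarrow> 0 + h \<in> {0..1} \<Longrightarrow> h < d \<Longrightarrow> ?f (0 + h) < ?f 0"
        using has_real_derivative_neg_dec_right[OF der] by (metis not_le)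
      define h where "h = min (d / 2) 1"
      have "?f (0 + h) < ?f 0" using d(1) by (intro d(2)) (auto simp: h_def)
      moreover have "?f 0 \<le> ?f h" using d(1) by (intro min) (auto simp: h_def)
      ultimately show False by simp
    qed
  qed
next
  assume V: "VI p x"
  then have x: "x \<in> profiles X" by (simp add: VI_def)
  show "nash_equilibrium X (\<lambda>i x. l i x + incentive xd ud i x p) x"
    unfolding nash_equilibrium_def
  proof (intro conjI allI ballI x)
    fix i y assume y: "y \<in> X i"
    let ?g = "\<lambda>t. x $ i + t * (y - x $ i)"
    let ?f = "\<lambda>t. l i (deviate x i (?g t)) + incentive xd ud i (deviate x i (?g t)) p"
    let ?f' = "\<lambda>t. (G (deviate x i (?g t)) $ i + p $ i) * (y - x $ i)"
    have "(?f has_derivative (\<lambda>h. h * ?f' t)) (at t within {0..1})" if "0 \<le> t" "t \<le> 1" for t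
      using cost_along_segment[OF x y that, of p] by (simp add: has_field_derivative_def mult_commute_abs)
    then obtain z where z: "z \<in> {0<..<1}" and eq: "?f 1 - ?f 0 = (1 - 0) * ?f' z"
      using mvt_simple[of 0 1 ?f "\<lambda>t h. h * ?f' t"] by auto
    have gz: "?g z \<in> X i"
    proof -
      have "?g z = (1 - z) *\<^sub>R (x $ i) + z *\<^sub>R y" by (simp add: algebra_simps)
      moreover have "x $ i \<in> X i" using x by (simp add: profiles_def)
      ultimately show ?thesis using convexD_alt[of "X i" "x $ i" y z] X[of i] y z by simp
    qed
    have "0 \<le> (G (deviate x i (?g z)) $ i - G x $ i) * (?g z - x $ i)" by (rule G_monotone_own[OF x gz])
    also have "\<dots> = z * ((G (deviate x i (?g z)) $ i - G x $ i) * (y - x $ i))" by simp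
    finally have "0 \<le> (G (deviate x i (?g z)) $ i - G x $ i) * (y - x $ i)"
      using z by (simp add: zero_le_mult_iff)
    moreover have "0 \<le> (G x $ i + p $ i) * (y - x $ i)" using V y by (simp add: VI_def)
    ultimately have "0 \<le> ?f' z" by (simp add: algebra_simps)
    then show "l i x + incentive xd ud i x p \<le> l i (deviate x i y) + incentive xd ud i (deviate x i y) p"
      using eq by simp
  qed
qed

text \<open>A fixed point of \<open>x \<mapsto> closest_point (profiles X) (x - R (G x + p))\<close>, which exists by Brouwer's theorem,
  solves the variational inequality for \<open>R (G + p)\<close>. Testing it with deviations of one agent
  separates the coordinates, and the positive factors \<open>R $ i $ i\<close> cancel.\<close>

lemma VI_exists: "\<exists>x. VI p x"
proof -
  obtain m R where "0 < m" and R: "\<And>i. 0 < R $ i $ i" "\<And>v i. (R *v v) $ i = R $ i $ i * v $ i"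
    and "\<And>x y. x \<in> profiles X \<Longrightarrow> y \<in> profiles X \<Longrightarrow> m * ((x - y) \<bullet> (x - y)) \<le> (x - y) \<bullet> (R *v (G x - G y))"
    using strongly_monotone by atomize_elim
  let ?T = "\<lambda>x. closest_point (profiles X) (x - R *v (G x + p))"
  have ne: "profiles X \<noteq> {}" using xd by auto
  have cl: "closed (profiles X)" by (rule compact_imp_closed[OF compact_profiles])
  have "continuous_on (profiles X) (\<lambda>x. x - R *v (G x + p))"
    unfolding G_def
    by (intro continuous_intros continuous_features bounded_linear.continuous_on[OF matrix_vector_mul_bounded_linear])
  then have cont: "continuous_on (profiles X) ?T"
    by (rule continuous_on_compose2[OF continuous_on_closest_point[OF convex_profiles cl ne]]) (rule subset_UNIV)
  have maps: "?T \<in> profiles X \<rightarrow> profiles X" using closest_point_in_set[OF cl ne] by auto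
  obtain x where x: "x \<in> profiles X" "?T x = x"
    by (rule brouwer[OF compact_profiles convex_profiles ne cont maps])
  have "VI p x"
    unfolding VI_def
  proof (intro conjI allI ballI x(1))
    fix i y assume y: "y \<in> X i"
    have "(x - R *v (G x + p) - x) \<bullet> (deviate x i y - x) \<le> 0"
      using closest_point_dot[OF convex_profiles cl deviate_in_profiles[OF x(1) y], of "x - R *v (G x + p)"] x(2) by simp
    then have "0 \<le> R $ i $ i * ((G x $ i + p $ i) * (y - x $ i))"
      unfolding deviate_minus by (simp add: inner_axis R(2) algebra_simps)
    then show "0 \<le> (G x $ i + p $ i) * (y - x $ i)" using R(1)[of i] by (simp add: zero_le_mult_iff)
  qed
  then show ?thesis by blast
qed

text \<open>Test the inequality for \<open>x\<close> with \<open>y\<close> and conversely, add with the weights \<open>R $ i $ i\<close> and use strong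
  monotonicity. For equal incentives this is uniqueness.\<close>

lemma VI_lipschitz:
  "\<exists>L>0. \<forall>p q x y. VI p x \<longrightarrow> VI q y \<longrightarrow> norm (x - y) \<le> L * norm (p - q)"
proof -
  obtain m R where m: "0 < m" and R: "\<And>i. 0 < R $ i $ i" "\<And>v i. (R *v v) $ i = R $ i $ i * v $ i"
    and mono: "\<And>x y. x \<in> profiles X \<Longrightarrow> y \<in> profiles X \<Longrightarrow> m * ((x - y) \<bullet> (x - y)) \<le> (x - y) \<bullet> (R *v (G x - G y))"
    using strongly_monotone by atomize_elim
  obtain K where K: "0 < K" "\<And>v. norm (R *v v) \<le> norm v * K"
    using bounded_linear.pos_bounded[OF matrix_vector_mul_bounded_linear[of R]] by auto
  have "norm (x - y) \<le> (K / m) * norm (p - q)" if x: "VI p x" and y: "VI q y" for p q x y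
  proof (cases "x = y")
    case False
    have "m * ((x - y) \<bullet> (x - y)) \<le> (x - y) \<bullet> (R *v (G x - G y))"
      using x y by (intro mono) (auto simp: VI_def)
    also have "\<dots> \<le> (x - y) \<bullet> (R *v (q - p))"
      unfolding inner_vec_def inner_real_def
    proof (rule sum_mono)
      fix i
      have "y $ i \<in> X i" "x $ i \<in> X i" using x y by (auto simp: VI_def profiles_def)
      then have "0 \<le> (G x $ i + p $ i) * (y $ i - x $ i)" "0 \<le> (G y $ i + q $ i) * (x $ i - y $ i)"
        using x y by (auto simp: VI_def)
      then have "(x $ i - y $ i) * (G x $ i - G y $ i) \<le> (x $ i - y $ i) * (q $ i - p $ i)"
        by (simp add: algebra_simps)
      then have "R $ i $ i * ((x $ i - y $ i) * (G x $ i - G y $ i)) \<le> R $ i $ i * ((x $ i - y $ i) * (q $ i - p $ i))"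
        using R(1)[of i] by simp
      then show "(x - y) $ i * (R *v (G x - G y)) $ i \<le> (x - y) $ i * (R *v (q - p)) $ i"
        by (simp add: R(2) mult.left_commute)
    qed
    also have "\<dots> \<le> norm (x - y) * norm (R *v (q - p))" by (rule norm_cauchy_schwarz)
    also have "\<dots> \<le> norm (x - y) * (norm (p - q) * K)"
      using K(2)[of "q - p"] by (intro mult_left_mono) (auto simp: norm_minus_commute)
    finally have "norm (x - y) * (m * norm (x - y)) \<le> norm (x - y) * (norm (p - q) * K)"
      by (simp add: dot_square_norm power2_eq_square mult_ac)
    then have "m * norm (x - y) \<le> norm (p - q) * K" using False by simp
    then show ?thesis using m by (simp add: field_simps)
  qed (use m K in auto)
  then show ?thesis using m K(1) by (intro exI[of _ "K / m"]) auto
qed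

lemma response_VI: "VI p (equilibrium_response X l xd ud p)"
proof -
  obtain L where "0 < L" and L: "\<And>p q x y. VI p x \<Longrightarrow> VI q y \<Longrightarrow> norm (x - y) \<le> L * norm (p - q)"
    using VI_lipschitz by atomize_elim
  have "\<exists>!x. VI p x" 
  proof (rule ex_ex1I[OF VI_exists])
    show "x = y" if "VI p x" "VI p y" for x y using L[OF that] by simp
  qed
  then have "VI p (THE x. VI p x)" by (rule theI')
  then show ?thesis by (simp add: equilibrium_response_def nash_iff_VI)
qed

lemma continuous_response: "continuous_on UNIV (equilibrium_response X l xd ud)"
proof -
  obtain L where L0: "0 < L" and L: "\<And>p q x y. VI p x \<Longrightarrow> VI q y \<Longrightarrow> norm (x - y) \<le> L * norm (p - q)"
    using VI_lipschitz by atomize_elim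
  have "L-lipschitz_on UNIV (equilibrium_response X l xd ud)"
    using L[OF response_VI response_VI] L0 by (intro lipschitz_onI) (auto simp: dist_norm)
  then show ?thesis by (rule lipschitz_on_continuous_on)
qed

text \<open>In the interior each agent can deviate in both directions, so the first-order conditions are
  equalities.\<close>

lemma interior_response:
  assumes int: "equilibrium_response X l xd ud p \<in> interior (profiles X)"
  shows "p = - (\<Theta> *v features \<alpha> (equilibrium_response X l xd ud p))"
proof -
  define x where "x = equilibrium_response X l xd ud p"
  obtain e where e: "0 < e" "ball x e \<subseteq> profiles X"
    using int unfolding x_def by (metis mem_interior)
  have "G x $ i + p $ i = 0" for i
  proof -
    have dev: "x $ i + s \<in> X i" if "\<bar>s\<bar> < e" for s
    proof -
      have "deviate x i (x $ i + s) \<in> ball x e"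
        using that deviate_minus[of x i "x $ i + s"] by (simp add: dist_norm norm_minus_commute[of x])
      then have "deviate x i (x $ i + s) \<in> profiles X" using e by blast
      then have "deviate x i (x $ i + s) $ i \<in> X i" by (simp add: profiles_def del: deviate_simps)
      then show ?thesis by simp
    qed
    have "0 \<le> (G x $ i + p $ i) * (x $ i + s - x $ i)" if "\<bar>s\<bar> < e" for s
      using response_VI[of p] dev[OF that] unfolding VI_def x_def[symmetric] by blast
    from this[of "e / 2"] this[of "- e / 2"] show ?thesis using e(1) by (simp add: zero_le_mult_iff mult_le_0_iff)
  qed
  then show ?thesis by (simp add: vec_eq_iff G_def x_def eq_neg_iff_add_eq_0 add.commute)
qed

end

section \<open>The least-squares recursion of the planner\<close>

lemma rls_S_symmetric:
  fixes S0 :: "real^'m^'m"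
  assumes "transpose S0 = S0"
  shows "transpose (rls_S X \<alpha> S0 xs t) = rls_S X \<alpha> S0 xs t"
proof (induction t)
  case 0 then show ?case using assms by simp
next
  case (Suc t)
  have sym: "x v* rls_S X \<alpha> S0 xs t = rls_S X \<alpha> S0 xs t *v x" for x
    using Suc transpose_matrix_vector[of "rls_S X \<alpha> S0 xs t" x] by simp
  have "transpose (A - c *\<^sub>R B) = transpose A - c *\<^sub>R transpose B" for A B :: "real^'m^'m" and c
    by (simp add: transpose_def vec_eq_iff)
  then show ?case using Suc by (simp add: Let_def sym transpose_outer)
qed

text \<open>With the indicator as a factor of the features, an observation that the estimator discards is an
  ordinary observation with a vanishing regressor.\<close>

definition regressor :: "('n::finite \<Rightarrow> real set) \<Rightarrow> ('m::finite \<Rightarrow> 'n \<Rightarrow> nat) \<Rightarrow> real^'n \<Rightarrow> real^'m" where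
  "regressor X \<alpha> x = indicator (interior (profiles X)) x *\<^sub>R features \<alpha> x"

lemma rls_path_rls_S:
  assumes "pos_def S0"
  shows "rls_path (rls_S X \<alpha> S0 xs) (\<lambda>t. regressor X \<alpha> (xs (Suc t)))"
proof
  show "pos_def (rls_S X \<alpha> S0 xs 0)" using assms by simp
  fix t
  have "transpose S0 = S0" using assms by (simp add: pos_def_def)
  then have sym: "x v* rls_S X \<alpha> S0 xs t = rls_S X \<alpha> S0 xs t *v x" for x
    using rls_S_symmetric[of S0 X \<alpha> xs t] transpose_matrix_vector[of "rls_S X \<alpha> S0 xs t" x] by simp
  show "rls_S X \<alpha> S0 xs (Suc t) = rls_S X \<alpha> S0 xs t -
      (1 / (1 + regressor X \<alpha> (xs (Suc t)) \<bullet> (rls_S X \<alpha> S0 xs t *v regressor X \<alpha> (xs (Suc t))))) *\<^sub>R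
      outer (rls_S X \<alpha> S0 xs t *v regressor X \<alpha> (xs (Suc t))) (rls_S X \<alpha> S0 xs t *v regressor X \<alpha> (xs (Suc t)))"
    by (cases "xs (Suc t) \<in> interior (profiles X)")
       (simp_all add: Let_def sym regressor_def outer_def vec_eq_iff)
qed

text \<open>The hypothesis is the regression model for agent \<open>i\<close>. It concerns the interior responses only,
  since all others have regressor \<open>0\<close>.\<close>

lemma rls_row_rls_estimate:
  fixes \<Theta> :: "real^'m^'n"
  assumes "pos_def S0"
    and "\<And>t. xs (Suc t) \<in> interior (profiles X) \<Longrightarrow> ps (Suc t) $ i = \<epsilon> t - \<Theta> $ i \<bullet> features \<alpha> (xs (Suc t))"
  shows "rls_row (rls_S X \<alpha> S0 xs) (\<lambda>t. regressor X \<alpha> (xs (Suc t))) \<epsilon>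
    (\<lambda>t. rls_estimate X \<alpha> S0 \<Theta>0 xs ps t $ i - \<Theta> $ i)"
proof (intro rls_row.intro rls_row_axioms.intro rls_path_rls_S assms(1))
  fix t
  have "transpose S0 = S0" using assms(1) by (simp add: pos_def_def)
  then have sym: "x v* rls_S X \<alpha> S0 xs t = rls_S X \<alpha> S0 xs t *v x" for x
    using rls_S_symmetric[of S0 X \<alpha> xs t] transpose_matrix_vector[of "rls_S X \<alpha> S0 xs t" x] by simp
  let ?S = "rls_S X \<alpha> S0 xs t" and ?T = "rls_estimate X \<alpha> S0 \<Theta>0 xs ps t" and ?\<zeta> = "regressor X \<alpha> (xs (Suc t))"
  show "rls_estimate X \<alpha> S0 \<Theta>0 xs ps (Suc t) $ i - \<Theta> $ i = ?T $ i - \<Theta> $ i -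
      ((\<epsilon> t + (?T $ i - \<Theta> $ i) \<bullet> ?\<zeta>) / (1 + ?\<zeta> \<bullet> (?S *v ?\<zeta>))) *\<^sub>R (?S *v ?\<zeta>)"
  proof (cases "xs (Suc t) \<in> interior (profiles X)")
    case True
    let ?\<xi> = "features \<alpha> (xs (Suc t))"
    have \<zeta>: "?\<zeta> = ?\<xi>" using True by (simp add: regressor_def)
    have row: "outer u v $ i = (u $ i) *\<^sub>R v" for u :: "real^'n" and v :: "real^'m"
      by (simp add: outer_def vec_eq_iff)
    have "rls_estimate X \<alpha> S0 \<Theta>0 xs ps (Suc t) $ i =
        ?T $ i - ((ps (Suc t) $ i + ?T $ i \<bullet> ?\<xi>) / (1 + ?\<xi> \<bullet> (?S *v ?\<xi>))) *\<^sub>R (?S *v ?\<xi>)"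
      using True by (simp add: Let_def sym row matrix_vector_mul_component)
    also have "ps (Suc t) $ i + ?T $ i \<bullet> ?\<xi> = \<epsilon> t + (?T $ i - \<Theta> $ i) \<bullet> ?\<xi>"
      using assms(2)[OF True] by (simp add: inner_diff_left)
    finally show ?thesis by (simp add: \<zeta>)
  qed (simp add: Let_def regressor_def)
qed

section \<open>Past observations and the next noise\<close>

lemma borel_measurable_vec_iff:
  fixes f :: "'w \<Rightarrow> 'a::euclidean_space^'n"
  shows "f \<in> borel_measurable M \<longleftrightarrow> (\<forall>i. (\<lambda>\<omega>. f \<omega> $ i) \<in> borel_measurable M)"
proof
  assume "f \<in> borel_measurable M"
  moreover have "(\<lambda>x :: 'a^'n. x $ i) \<in> borel_measurable borel" for i
    by (intro borel_measurable_continuous_onI linear_continuous_on bounded_linear_vec_nth)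
  ultimately show "\<forall>i. (\<lambda>\<omega>. f \<omega> $ i) \<in> borel_measurable M"
    using measurable_compose by blast
next
  assume comp: "\<forall>i. (\<lambda>\<omega>. f \<omega> $ i) \<in> borel_measurable M"
  show "f \<in> borel_measurable M"
    unfolding borel_measurable_euclidean_space[of f]
  proof
    fix b :: "'a^'n" assume "b \<in> Basis"
    then obtain i u where b: "b = axis i u" by (auto simp: Basis_vec_def)
    have "(\<lambda>\<omega>. f \<omega> $ i \<bullet> u) \<in> borel_measurable M" using comp by (intro borel_measurable_inner) auto
    then show "(\<lambda>\<omega>. f \<omega> \<bullet> b) \<in> borel_measurable M" by (simp add: b inner_axis)
  qed
qed

lemma borel_measurable_vec_nth_comp:
  fixes f :: "'w \<Rightarrow> 'a::euclidean_space^'n"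
  shows "f \<in> borel_measurable M \<Longrightarrow> (\<lambda>\<omega>. f \<omega> $ i) \<in> borel_measurable M"
  by (simp add: borel_measurable_vec_iff)

lemma borel_measurable_matrix_vector_mult:
  fixes A :: "'w \<Rightarrow> real^'m^'n"
  assumes "A \<in> borel_measurable M" "x \<in> borel_measurable M"
  shows "(\<lambda>\<omega>. A \<omega> *v x \<omega>) \<in> borel_measurable M"
  unfolding borel_measurable_vec_iff matrix_vector_mult_def vec_lambda_beta
  by (intro allI borel_measurable_sum borel_measurable_times borel_measurable_vec_nth_comp assms)

lemma borel_measurable_vector_matrix_mult:
  fixes A :: "'w \<Rightarrow> real^'m^'n"
  assumes "A \<in> borel_measurable M" "x \<in> borel_measurable M"
  shows "(\<lambda>\<omega>. x \<omega> v* A \<omega>) \<in> borel_measurable M"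
  unfolding borel_measurable_vec_iff vector_matrix_mult_def vec_lambda_beta
  by (intro allI borel_measurable_sum borel_measurable_times borel_measurable_vec_nth_comp assms)

lemma borel_measurable_outer:
  fixes x :: "'w \<Rightarrow> real^'n" and y :: "'w \<Rightarrow> real^'m"
  assumes "x \<in> borel_measurable M" "y \<in> borel_measurable M"
  shows "(\<lambda>\<omega>. outer (x \<omega>) (y \<omega>)) \<in> borel_measurable M"
  unfolding borel_measurable_vec_iff outer_def vec_lambda_beta
  by (intro allI borel_measurable_times borel_measurable_vec_nth_comp assms)

lemma sets_vimage_algebra_le:
  assumes "f \<in> measurable M N"
  shows "sets (vimage_algebra (space M) f N) \<subseteq> sets M"
  using assms measurable_sets[OF assms]
  by (auto simp: sets_vimage_algebra2 measurable_space)

locale noisy_data = prob_space M for M :: "'w measure" +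
  fixes N :: "'u measure" and U :: "'w \<Rightarrow> 'u" and e :: "nat \<Rightarrow> 'w \<Rightarrow> real^'n::finite"
  assumes noise_indep_vars: "indep_vars (\<lambda>_. borel) e {1..}"
    and randomization: "randomization_independent M N U e"
begin

text \<open>All randomness on which observations and incentives up to time \<open>t\<close> can depend.\<close>

definition history :: "nat \<Rightarrow> 'w \<Rightarrow> 'u \<times> (nat \<Rightarrow> real^'n)" where
  "history t \<omega> = (U \<omega>, \<lambda>s\<in>{1..t}. e s \<omega>)"

definition F :: "nat \<Rightarrow> 'w measure" where
  "F t = vimage_algebra (space M) (history t) (N \<Otimes>\<^sub>M Pi\<^sub>M {1..t} (\<lambda>_. borel))"

lemma space_F [simp]: "space (F t) = space M"
  by (simp add: F_def)

lemma U_measurable [measurable]: "U \<in> M \<rightarrow>\<^sub>M N"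
  using randomization by (simp add: randomization_independent_def)

lemma e_measurable: "1 \<le> t \<Longrightarrow> e t \<in> borel_measurable M"
  using noise_indep_vars by (auto simp: indep_vars_def)

lemma history_measurable: "history t \<in> M \<rightarrow>\<^sub>M (N \<Otimes>\<^sub>M Pi\<^sub>M {1..t} (\<lambda>_. borel))"
  unfolding history_def by (intro measurable_Pair U_measurable measurable_restrict e_measurable) auto

lemma history_measurable_F: "history t \<in> F t \<rightarrow>\<^sub>M (N \<Otimes>\<^sub>M Pi\<^sub>M {1..t} (\<lambda>_. borel))"
  unfolding F_def using measurable_space[OF history_measurable] by (intro measurable_vimage_algebra1) auto

lemma U_measurable_F: "U \<in> F t \<rightarrow>\<^sub>M N"
  using measurable_compose[OF history_measurable_F measurable_fst] by (simp add: history_def)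

lemma e_measurable_F:
  assumes "1 \<le> s" "s \<le> t"
  shows "e s \<in> borel_measurable (F t)"
proof -
  have "(\<lambda>\<omega>. snd (history t \<omega>) s) \<in> borel_measurable (F t)"
    using assms by (intro measurable_compose[OF measurable_compose[OF history_measurable_F measurable_snd] measurable_component_singleton]) auto
  then show ?thesis using assms by (simp add: history_def)
qed

lemma subalgebra_F: "subalgebra M (F t)"
  using sets_vimage_algebra_le[OF history_measurable] by (simp add: subalgebra_def F_def)

lemma filtration_F: "s \<le> t \<Longrightarrow> subalgebra (F t) (F s)"
proof -
  assume "s \<le> t"
  then have "history s \<in> F t \<rightarrow>\<^sub>M (N \<Otimes>\<^sub>M Pi\<^sub>M {1..s} (\<lambda>_. borel))"
    unfolding history_def by (intro measurable_Pair U_measurable_F measurable_restrict e_measurable_F) auto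
  from sets_vimage_algebra_le[OF this] show ?thesis
    by (simp add: subalgebra_def) (simp add: F_def)
qed

text \<open>On product events of the randomization and the past noise, factor the probability twice: the
  randomization is independent of the whole noise sequence, and within that sequence the next
  noise is independent of the earlier ones. Product events generate the history.\<close>

lemma next_noise_indep:
  "indep_set (sets (vimage_algebra (space M) (e (Suc t)) borel)) (sets (F t))"
proof -
  define V where "V = vimage_algebra (space M) (\<lambda>\<omega>. \<lambda>t\<in>{1..}. e t \<omega>) (Pi\<^sub>M {1..} (\<lambda>_. borel :: (real^'n) measure))"
  have UV: "indep_set (sets (vimage_algebra (space M) U N)) (sets V)"
    using randomization by (simp add: randomization_independent_def V_def)
  have eV: "e s \<in> borel_measurable V" if "1 \<le> s" for s
  proof -
    have "(\<lambda>\<omega>. (\<lambda>t\<in>{1..}. e t \<omega>) s) \<in> borel_measurable V"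
      unfolding V_def using that
      by (intro measurable_compose[OF measurable_vimage_algebra1 measurable_component_singleton])
         (auto simp: space_PiM split: if_splits)
    then show ?thesis using that by simp
  qed
  have [simp]: "space V = space M" by (simp add: V_def)
  let ?past = "\<lambda>\<omega>. \<lambda>s\<in>{1..t}. e s \<omega>" and ?P = "Pi\<^sub>M {1..t} (\<lambda>_. borel :: (real^'n) measure)"
  have pastV: "?past \<in> V \<rightarrow>\<^sub>M ?P" by (intro measurable_restrict eV) auto
  define G1 where "G1 = sets (vimage_algebra (space M) (e (Suc t)) borel)"
  have G1_eq: "G1 = {e (Suc t) -` C \<inter> space M |C. C \<in> sets borel}"
    unfolding G1_def by (rule sets_vimage_algebra2) simp
  define G2 where "G2 = {history t -` (A \<times> B) \<inter> space M |A B. A \<in> sets N \<and> B \<in> sets ?P}"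
  let ?Q = "Pi\<^sub>M {Suc t} (\<lambda>_. borel :: (real^'n) measure)" and ?next = "\<lambda>\<omega>. \<lambda>s\<in>{Suc t}. e s \<omega>"
  have iv: "indep_var ?Q ?next ?P ?past"
    by (rule indep_var_restrict[OF noise_indep_vars]) auto
  have "indep_set G1 G2"
  proof (rule indep_setI)
    show "G1 \<subseteq> events" using measurable_sets[OF e_measurable[of "Suc t"]] by (auto simp: G1_eq)
    show "G2 \<subseteq> events" using measurable_sets[OF history_measurable[of t]] by (auto simp: G2_def)
    fix a b assume "a \<in> G1" "b \<in> G2"
    then obtain A B C where C: "C \<in> sets borel" "a = e (Suc t) -` C \<inter> space M"
      and AB: "A \<in> sets N" "B \<in> sets ?P" "b = history t -` (A \<times> B) \<inter> space M"
      by (auto simp: G1_eq G2_def)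
    define u c where "u = U -` A \<inter> space M" and "c = ?past -` B \<inter> space M"
    have b: "b = u \<inter> c" by (auto simp: AB(3) u_def c_def history_def)
    have u: "u \<in> sets (vimage_algebra (space M) U N)" unfolding u_def by (rule in_vimage_algebra[OF AB(1)])
    have aV: "a \<in> sets V" using measurable_sets[OF eV[of "Suc t"] C(1)] by (simp add: C(2))
    have cV: "c \<in> sets V" using measurable_sets[OF pastV AB(2)] by (simp add: c_def)
    have "a \<inter> b = u \<inter> (a \<inter> c)" using b by auto
    then have "prob (a \<inter> b) = prob u * prob (a \<inter> c)"
      using indep_setD[OF UV u] aV cV by auto
    also have "prob (a \<inter> c) = prob a * prob c"
    proof -
      define C' where "C' = (\<lambda>f. f (Suc t)) -` C \<inter> space ?Q"
      have C': "C' \<in> sets ?Q"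
        unfolding C'_def using C(1) by (intro measurable_sets[where A=borel] measurable_component_singleton) auto
      have a: "?next -` C' \<inter> space M = a" by (auto simp: C(2) C'_def space_PiM)
      have "(\<lambda>\<omega>. (?next \<omega>, ?past \<omega>)) -` (C' \<times> B) \<inter> space M = a \<inter> c" using a by (auto simp: c_def)
      then show ?thesis using indep_varD[OF iv C' AB(2)] by (simp only: a c_def)
    qed
    also have "prob u * (prob a * prob c) = prob a * (prob u * prob c)" by simp
    also have "prob u * prob c = prob b"
      using indep_setD[OF UV u cV] by (simp add: b)
    finally show "prob (a \<inter> b) = prob a * prob b" .
  qed
  moreover have "Int_stable G1"
    unfolding G1_def by (rule sets.Int_stable)
  moreover have "Int_stable G2"
  proof (rule Int_stableI)
    fix a b assume "a \<in> G2" "b \<in> G2"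
    then obtain A B A' B' where *: "A \<in> sets N" "B \<in> sets ?P" "a = history t -` (A \<times> B) \<inter> space M"
      "A' \<in> sets N" "B' \<in> sets ?P" "b = history t -` (A' \<times> B') \<inter> space M" by (auto simp: G2_def)
    have "a \<inter> b = history t -` ((A \<inter> A') \<times> (B \<inter> B')) \<inter> space M" using * by auto
    then show "a \<inter> b \<in> G2" unfolding G2_def using * by blast
  qed
  ultimately have "indep_set (sigma_sets (space M) G1) (sigma_sets (space M) G2)"
    by (rule indep_set_sigma_sets)
  moreover have "sets (vimage_algebra (space M) (e (Suc t)) borel) = sigma_sets (space M) G1"
    unfolding G1_def using sets.sigma_sets_eq[of "vimage_algebra (space M) (e (Suc t)) borel"] by simp
  moreover have "sets (F t) = sigma_sets (space M) G2"
  proof -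
    have "sets (F t) = {history t -` A \<inter> space M |A. A \<in> sets (N \<Otimes>\<^sub>M ?P)}"
      unfolding F_def using measurable_space[OF history_measurable] by (intro sets_vimage_algebra2) auto
    also have "\<dots> = sigma_sets (space M) {history t -` A \<inter> space M |A. A \<in> {a \<times> b |a b. a \<in> sets N \<and> b \<in> sets ?P}}"
      unfolding sets_pair_measure
      using measurable_space[OF history_measurable] by (intro sigma_sets_vimage_commute) (auto simp: space_pair_measure)
    also have "{history t -` A \<inter> space M |A. A \<in> {a \<times> b |a b. a \<in> sets N \<and> b \<in> sets ?P}} = G2"
      unfolding G2_def by blast
    finally show ?thesis .
  qed
  ultimately show ?thesis by simp
qed

lemma predictable_noise_component: "predictable_noise M F (\<lambda>t \<omega>. e (Suc t) \<omega> $ i)"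
proof (intro predictable_noise.intro predictable_noise_axioms.intro)
  show "prob_space M" by (rule prob_space_axioms)
  show "subalgebra M (F t)" for t by (rule subalgebra_F)
  show "subalgebra (F t) (F s)" if "s \<le> t" for s t by (rule filtration_F[OF that])
  show "(\<lambda>\<omega>. e (Suc t) \<omega> $ i) \<in> borel_measurable (F (Suc t))" for t
    by (rule borel_measurable_vec_nth_comp[OF e_measurable_F]) simp_all
  fix t
  let ?V = "vimage_algebra (space M) (e (Suc t)) borel"
  have "e (Suc t) \<in> borel_measurable ?V" by (rule measurable_vimage_algebra1) simp
  then have "(\<lambda>\<omega>. e (Suc t) \<omega> $ i) \<in> borel_measurable ?V" by (rule borel_measurable_vec_nth_comp)
  then have "sets (vimage_algebra (space M) (\<lambda>\<omega>. e (Suc t) \<omega> $ i) borel) \<subseteq> sets ?V"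
    using sets_vimage_algebra_le[of _ ?V] by simp
  then show "indep_set (sets (vimage_algebra (space M) (\<lambda>\<omega>. e (Suc t) \<omega> $ i) borel)) (sets (F t))"
    by (rule indep_set_mono[OF next_noise_indep]) (rule order_refl)
qed

end

context noisy_data
begin

lemma measurable_later_F: "f \<in> borel_measurable (F s) \<Longrightarrow> s \<le> t \<Longrightarrow> f \<in> borel_measurable (F t)"
  for f :: "'w \<Rightarrow> 'b::topological_space"
  by (rule measurable_from_subalg[OF filtration_F])

text \<open>Strong induction: the policy at time \<open>t + 1\<close> reads the responses and incentives observed up to
  time \<open>t\<close>, which are functions of the earlier incentives and noise. The response map \<open>\<phi>\<close> has to be
  measurable for this.\<close>

lemma incentives_predictable:
  assumes na: "non_anticipating M N U xhat phat p"
    and \<phi>: "\<phi> \<in> borel_measurable borel"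
    and xhat: "\<And>t \<omega>. 1 \<le> t \<Longrightarrow> \<omega> \<in> space M \<Longrightarrow> xhat t \<omega> = \<phi> (p t \<omega>)"
    and phat: "\<And>t \<omega>. 1 \<le> t \<Longrightarrow> \<omega> \<in> space M \<Longrightarrow> phat t \<omega> = p t \<omega> + e t \<omega>"
  shows "p (Suc t) \<in> borel_measurable (F t)"
proof (induction t rule: less_induct)
  case (less t)
  have "\<exists>\<pi>\<in>N \<Otimes>\<^sub>M Pi\<^sub>M {1..<Suc t} (\<lambda>_. borel) \<rightarrow>\<^sub>M borel. \<forall>\<omega>\<in>space M.
      p (Suc t) \<omega> = \<pi> (U \<omega>, \<lambda>s\<in>{1..<Suc t}. (xhat s \<omega>, phat s \<omega>))"
    using na[unfolded non_anticipating_def, THEN spec, of "Suc t"] by (rule mp) simp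
  then obtain \<pi> where \<pi>: "\<pi> \<in> N \<Otimes>\<^sub>M Pi\<^sub>M {1..<Suc t} (\<lambda>_. borel) \<rightarrow>\<^sub>M borel"
    and p: "\<forall>\<omega>\<in>space M. p (Suc t) \<omega> = \<pi> (U \<omega>, \<lambda>s\<in>{1..<Suc t}. (xhat s \<omega>, phat s \<omega>))" ..
  have past: "(\<lambda>\<omega>. (xhat s \<omega>, phat s \<omega>)) \<in> borel_measurable (F t)" if s: "s \<in> {1..<Suc t}" for s
  proof -
    obtain r where r: "s = Suc r" "r < t" using s by (cases s) auto
    have ps: "p s \<in> borel_measurable (F t)"
      using measurable_later_F[OF less.IH[OF r(2)]] r by simp
    have "(\<lambda>\<omega>. (\<phi> (p s \<omega>), p s \<omega> + e s \<omega>)) \<in> borel_measurable (F t)"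
      using s by (intro borel_measurable_Pair measurable_compose[OF ps \<phi>] borel_measurable_add ps e_measurable_F) auto
    then show ?thesis
      using s xhat phat by (subst measurable_cong[where g="\<lambda>\<omega>. (\<phi> (p s \<omega>), p s \<omega> + e s \<omega>)"]) auto
  qed
  have "(\<lambda>\<omega>. \<pi> (U \<omega>, \<lambda>s\<in>{1..<Suc t}. (xhat s \<omega>, phat s \<omega>))) \<in> borel_measurable (F t)"
    by (intro measurable_compose[OF _ \<pi>] measurable_Pair U_measurable_F measurable_restrict past)
  then show ?case
    using p by (subst measurable_cong[where g="\<lambda>\<omega>. \<pi> (U \<omega>, \<lambda>s\<in>{1..<Suc t}. (xhat s \<omega>, phat s \<omega>))"]) auto
qed

lemma regressor_measurable:
  "x \<in> borel_measurable K \<Longrightarrow> (\<lambda>\<omega>. regressor X \<alpha> (x \<omega>)) \<in> borel_measurable K"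
proof -
  assume x: "x \<in> borel_measurable K"
  have "features \<alpha> \<in> borel_measurable borel"
    by (intro borel_measurable_continuous_onI continuous_features)
  moreover have "indicator (interior (profiles X)) \<in> borel_measurable (borel :: (real^'b) measure)" for X :: "'b::finite \<Rightarrow> real set"
    by (intro borel_measurable_indicator borel_open open_interior)
  ultimately show ?thesis
    unfolding regressor_def
    by (intro borel_measurable_scaleR measurable_compose[OF x]) auto
qed

lemma rls_S_predictable:
  assumes xhat: "\<And>t. xhat (Suc t) \<in> borel_measurable (F t)"
  shows "(\<lambda>\<omega>. rls_S X \<alpha> S0 (\<lambda>s. xhat s \<omega>) t) \<in> borel_measurable (F t)"
proof (induction t)
  case (Suc t)
  have S: "(\<lambda>\<omega>. rls_S X \<alpha> S0 (\<lambda>s. xhat s \<omega>) t) \<in> borel_measurable (F t)" (is "?S \<in> _") by (rule Suc)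
  have f: "(\<lambda>\<omega>. features \<alpha> (xhat (Suc t) \<omega>)) \<in> borel_measurable (F t)" (is "?f \<in> _")
    by (rule measurable_compose[OF xhat]) (intro borel_measurable_continuous_onI continuous_features)
  have \<delta>: "(\<lambda>\<omega>. indicator (interior (profiles X)) (xhat (Suc t) \<omega>) :: real) \<in> borel_measurable (F t)" (is "?\<delta> \<in> _")
    by (rule measurable_compose[OF xhat]) (intro borel_measurable_indicator borel_open open_interior)
  have Sf: "(\<lambda>\<omega>. ?S \<omega> *v ?f \<omega>) \<in> borel_measurable (F t)"
    by (rule borel_measurable_matrix_vector_mult[OF S f])
  have fS: "(\<lambda>\<omega>. ?f \<omega> v* ?S \<omega>) \<in> borel_measurable (F t)"
    by (rule borel_measurable_vector_matrix_mult[OF S f])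
  have "(\<lambda>\<omega>. rls_S X \<alpha> S0 (\<lambda>s. xhat s \<omega>) (Suc t)) \<in> borel_measurable (F t)"
    unfolding rls_S.simps Let_def
    by (intro borel_measurable_diff borel_measurable_scaleR borel_measurable_divide borel_measurable_add
        borel_measurable_times borel_measurable_inner borel_measurable_outer borel_measurable_const S f \<delta> Sf fS)
  then show ?case by (rule measurable_later_F) simp
qed simp

lemma rls_estimate_adapted:
  assumes xhat: "\<And>t. xhat (Suc t) \<in> borel_measurable (F t)"
    and phat: "\<And>t. phat (Suc t) \<in> borel_measurable (F (Suc t))"
  shows "(\<lambda>\<omega>. rls_estimate X \<alpha> S0 \<Theta>0 (\<lambda>s. xhat s \<omega>) (\<lambda>s. phat s \<omega>) t) \<in> borel_measurable (F t)"
proof (induction t)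
  case (Suc t)
  have le: "t \<le> Suc t" by simp
  have T: "(\<lambda>\<omega>. rls_estimate X \<alpha> S0 \<Theta>0 (\<lambda>s. xhat s \<omega>) (\<lambda>s. phat s \<omega>) t) \<in> borel_measurable (F (Suc t))" (is "?T \<in> _")
    by (rule measurable_later_F[OF Suc le])
  have S: "(\<lambda>\<omega>. rls_S X \<alpha> S0 (\<lambda>s. xhat s \<omega>) t) \<in> borel_measurable (F (Suc t))" (is "?S \<in> _")
    by (rule measurable_later_F[OF rls_S_predictable[OF xhat] le])
  have x: "xhat (Suc t) \<in> borel_measurable (F (Suc t))" by (rule measurable_later_F[OF xhat le])
  have f: "(\<lambda>\<omega>. features \<alpha> (xhat (Suc t) \<omega>)) \<in> borel_measurable (F (Suc t))" (is "?f \<in> _")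
    by (rule measurable_compose[OF x]) (intro borel_measurable_continuous_onI continuous_features)
  have \<delta>: "(\<lambda>\<omega>. indicator (interior (profiles X)) (xhat (Suc t) \<omega>) :: real) \<in> borel_measurable (F (Suc t))" (is "?\<delta> \<in> _")
    by (rule measurable_compose[OF x]) (intro borel_measurable_indicator borel_open open_interior)
  have Sf: "(\<lambda>\<omega>. ?S \<omega> *v ?f \<omega>) \<in> borel_measurable (F (Suc t))"
    and Tf: "(\<lambda>\<omega>. ?T \<omega> *v ?f \<omega>) \<in> borel_measurable (F (Suc t))"
    by (rule borel_measurable_matrix_vector_mult[OF S f] borel_measurable_matrix_vector_mult[OF T f])+
  have fS: "(\<lambda>\<omega>. ?f \<omega> v* ?S \<omega>) \<in> borel_measurable (F (Suc t))"
    by (rule borel_measurable_vector_matrix_mult[OF S f])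
  show ?case
    unfolding rls_estimate.simps Let_def
    by (intro borel_measurable_diff borel_measurable_scaleR borel_measurable_divide borel_measurable_add
        borel_measurable_times borel_measurable_inner borel_measurable_outer borel_measurable_const T S f \<delta> Sf Tf fS phat)
qed simp

end

lemma (in prob_space) component_moment:
  fixes e :: "'a \<Rightarrow> real^'n::finite"
  assumes e[measurable]: "e \<in> borel_measurable M" and r: "0 < r" "r \<le> a"
    and mom: "(\<integral>\<^sup>+\<omega>. ennreal (infnorm (e \<omega>) powr a) \<partial>M) \<le> ennreal L" and L: "0 \<le> L"
  shows "integrable M (\<lambda>\<omega>. \<bar>e \<omega> $ i\<bar> powr r)" and "expectation (\<lambda>\<omega>. \<bar>e \<omega> $ i\<bar> powr r) \<le> 1 + L"
proof -
  have [measurable]: "(\<lambda>\<omega>. e \<omega> $ i) \<in> borel_measurable M" by (rule borel_measurable_vec_nth_comp[OF e])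
  have [measurable]: "(\<lambda>\<omega>. infnorm (e \<omega>)) \<in> borel_measurable M"
    by (rule measurable_compose[OF e]) (intro borel_measurable_continuous_onI continuous_on_infnorm continuous_on_id)
  have pt: "\<bar>x $ i\<bar> powr r \<le> 1 + infnorm x powr a" for x :: "real^'n"
  proof (cases "infnorm x \<le> 1")
    case True
    have "\<bar>x $ i\<bar> powr r \<le> 1 powr r"
      using component_le_infnorm_cart[of x i] True r by (intro powr_mono2) auto
    then show ?thesis by (smt (verit) powr_ge_zero powr_one_eq_one)
  next
    case False
    have "\<bar>x $ i\<bar> powr r \<le> infnorm x powr r"
      using component_le_infnorm_cart[of x i] r by (intro powr_mono2) auto
    also have "\<dots> \<le> infnorm x powr a" using False r by (intro powr_mono) auto
    finally show ?thesis by simp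
  qed
  have "(\<integral>\<^sup>+\<omega>. ennreal (\<bar>e \<omega> $ i\<bar> powr r) \<partial>M) \<le> (\<integral>\<^sup>+\<omega>. 1 + ennreal (infnorm (e \<omega>) powr a) \<partial>M)"
    using pt by (intro nn_integral_mono) (simp add: ennreal_plus[symmetric] del: ennreal_plus flip: ennreal_1)
  also have "\<dots> = 1 + (\<integral>\<^sup>+\<omega>. ennreal (infnorm (e \<omega>) powr a) \<partial>M)"
    by (subst nn_integral_add) (auto simp: emeasure_space_1)
  also have "\<dots> \<le> 1 + ennreal L" using mom by (intro add_left_mono)
  also have "\<dots> = ennreal (1 + L)" using L by (simp add: ennreal_plus)
  finally have le: "(\<integral>\<^sup>+\<omega>. ennreal (\<bar>e \<omega> $ i\<bar> powr r) \<partial>M) \<le> ennreal (1 + L)" .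
  show int: "integrable M (\<lambda>\<omega>. \<bar>e \<omega> $ i\<bar> powr r)"
    using le by (intro integrableI_nonneg) (auto simp: less_top[symmetric] top_unique)
  show "expectation (\<lambda>\<omega>. \<bar>e \<omega> $ i\<bar> powr r) \<le> 1 + L"
  proof -
    have "ennreal (expectation (\<lambda>\<omega>. \<bar>e \<omega> $ i\<bar> powr r)) \<le> ennreal (1 + L)"
      using le nn_integral_eq_integral[OF int] by (simp del: ennreal_plus)
    then show ?thesis using L by (subst (asm) ennreal_le_iff) auto
  qed
qed

section \<open>Almost sure convergence rate\<close>

text \<open>Regressors take nonzero values on the compact set of profiles only.\<close>

lemma regressor_bounded:
  assumes "compact (profiles X)"
  shows "\<exists>B. \<forall>x. norm (regressor X \<alpha> x) \<le> B"
proof -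
  have "bounded (features \<alpha> ` profiles X)"
    by (intro compact_imp_bounded compact_continuous_image continuous_features assms)
  then obtain B where B: "\<And>x. x \<in> profiles X \<Longrightarrow> norm (features \<alpha> x) \<le> B"
    by (auto simp: bounded_iff)
  have "norm (regressor X \<alpha> x) \<le> \<bar>B\<bar>" for x
    using B[of x] interior_subset[of "profiles X"]
    by (cases "x \<in> interior (profiles X)") (auto simp: regressor_def intro: order_trans[OF _ abs_ge_self])
  then show ?thesis by blast
qed

locale rls_experiment = noisy_data M N U e + typed_game X \<alpha> l \<Theta> xd ud
  for M :: "'w measure" and N :: "'u measure" and U :: "'w \<Rightarrow> 'u" and e :: "nat \<Rightarrow> 'w \<Rightarrow> real^'n::finite"
    and X :: "'n \<Rightarrow> real set" and \<alpha> :: "'m::finite \<Rightarrow> 'n \<Rightarrow> nat" and l :: "'n \<Rightarrow> real^'n \<Rightarrow> real"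
    and \<Theta> :: "real^'m^'n" and xd ud :: "real^'n" +
  fixes p xhat phat :: "nat \<Rightarrow> 'w \<Rightarrow> real^'n" and S0 :: "real^'m^'m" and \<Theta>0 :: "real^'m^'n"
  assumes noise: "noise_assumption M e"
    and na: "non_anticipating M N U xhat phat p"
    and xhat: "\<And>t \<omega>. 1 \<le> t \<Longrightarrow> \<omega> \<in> space M \<Longrightarrow> xhat t \<omega> = equilibrium_response X l xd ud (p t \<omega>)"
    and phat: "\<And>t \<omega>. 1 \<le> t \<Longrightarrow> \<omega> \<in> space M \<Longrightarrow> phat t \<omega> = p t \<omega> + e t \<omega>"
    and S0: "pos_def S0"
begin

abbreviation S :: "'w \<Rightarrow> nat \<Rightarrow> real^'m^'m" where
  "S \<omega> \<equiv> rls_S X \<alpha> S0 (\<lambda>s. xhat s \<omega>)"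

abbreviation \<zeta> :: "'w \<Rightarrow> nat \<Rightarrow> real^'m" where
  "\<zeta> \<omega> t \<equiv> regressor X \<alpha> (xhat (Suc t) \<omega>)"

abbreviation E :: "'n \<Rightarrow> 'w \<Rightarrow> nat \<Rightarrow> real^'m" where
  "E i \<omega> t \<equiv> rls_estimate X \<alpha> S0 \<Theta>0 (\<lambda>s. xhat s \<omega>) (\<lambda>s. phat s \<omega>) t $ i - \<Theta> $ i"

lemma row:
  assumes "\<omega> \<in> space M"
  shows "rls_row (S \<omega>) (\<zeta> \<omega>) (\<lambda>t. e (Suc t) \<omega> $ i) (E i \<omega>)"
proof (rule rls_row_rls_estimate[OF S0])
  fix t assume "xhat (Suc t) \<omega> \<in> interior (profiles X)"
  then have "p (Suc t) \<omega> = - (\<Theta> *v features \<alpha> (xhat (Suc t) \<omega>))"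
    using interior_response[of "p (Suc t) \<omega>"] xhat[of "Suc t" \<omega>] assms by simp
  then show "phat (Suc t) \<omega> $ i = e (Suc t) \<omega> $ i - \<Theta> $ i \<bullet> features \<alpha> (xhat (Suc t) \<omega>)"
    using phat[of "Suc t" \<omega>] assms by (simp add: matrix_vector_mul_component)
qed

lemma p_predictable: "p (Suc t) \<in> borel_measurable (F t)"
  by (rule incentives_predictable[OF na borel_measurable_continuous_onI[OF continuous_response] xhat phat])

lemma xhat_predictable: "xhat (Suc t) \<in> borel_measurable (F t)"
proof -
  have "(\<lambda>\<omega>. equilibrium_response X l xd ud (p (Suc t) \<omega>)) \<in> borel_measurable (F t)"
    by (rule measurable_compose[OF p_predictable borel_measurable_continuous_onI[OF continuous_response]])
  then show ?thesis
    using xhat by (subst measurable_cong[where g="\<lambda>\<omega>. equilibrium_response X l xd ud (p (Suc t) \<omega>)"]) auto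
qed

lemma phat_adapted: "phat (Suc t) \<in> borel_measurable (F (Suc t))"
proof -
  have "p (Suc t) \<in> borel_measurable (F (Suc t))"
    by (rule measurable_later_F[OF p_predictable]) simp
  then have "(\<lambda>\<omega>. p (Suc t) \<omega> + e (Suc t) \<omega>) \<in> borel_measurable (F (Suc t))"
    by (intro borel_measurable_add e_measurable_F) auto
  then show ?thesis
    using phat by (subst measurable_cong[where g="\<lambda>\<omega>. p (Suc t) \<omega> + e (Suc t) \<omega>"]) auto
qed

lemma \<zeta>_predictable: "(\<lambda>\<omega>. \<zeta> \<omega> t) \<in> borel_measurable (F t)"
  by (rule regressor_measurable[OF xhat_predictable])

lemma h_predictable: "(\<lambda>\<omega>. rls_path.h (S \<omega>) (\<zeta> \<omega>) t) \<in> borel_measurable (F t)"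
proof -
  have eq: "rls_path.h (S \<omega>) (\<zeta> \<omega>) t = \<zeta> \<omega> t \<bullet> (S \<omega> t *v \<zeta> \<omega> t)" for \<omega>
    by (rule rls_path.h_def[OF rls_path_rls_S[OF S0]])
  show ?thesis
    unfolding eq
    by (intro borel_measurable_inner borel_measurable_matrix_vector_mult \<zeta>_predictable
        rls_S_predictable xhat_predictable)
qed

lemma E_adapted: "(\<lambda>\<omega>. E i \<omega> t) \<in> borel_measurable (F t)"
  by (intro borel_measurable_diff borel_measurable_const borel_measurable_vec_nth_comp
      rls_estimate_adapted xhat_predictable phat_adapted)

text \<open>The exponent \<open>2 * \<rho>\<close> is the minimum of \<open>a\<close> and \<open>4\<close>: truncation requires \<open>\<rho> \<le> 2\<close>, and \<open>a > 2\<close> gives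
  \<open>\<rho> > 1\<close>.\<close>

lemma noise_component_moments:
  "\<exists>\<rho> L. 1 < \<rho> \<and> \<rho> \<le> 2 \<and> (\<forall>t i. integrable M (\<lambda>\<omega>. \<bar>e (Suc t) \<omega> $ i\<bar> powr (2 * \<rho>))) \<and>
    (\<forall>t i. expectation (\<lambda>\<omega>. \<bar>e (Suc t) \<omega> $ i\<bar> powr (2 * \<rho>)) \<le> L)"
proof -
  obtain a where a: "2 < a" and fin: "(SUP t\<in>{1..}. \<integral>\<^sup>+\<omega>. ennreal (infnorm (e t \<omega>) powr a) \<partial>M) < \<infinity>"
    using noise unfolding noise_assumption_def by - (atomize_elim, elim exE conjE, intro exI conjI; assumption)
  define L where "L = enn2real (SUP t\<in>{1..}. \<integral>\<^sup>+\<omega>. ennreal (infnorm (e t \<omega>) powr a) \<partial>M)"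
  have le: "(\<integral>\<^sup>+\<omega>. ennreal (infnorm (e (Suc t) \<omega>) powr a) \<partial>M) \<le> ennreal L" for t
  proof -
    have "(\<integral>\<^sup>+\<omega>. ennreal (infnorm (e (Suc t) \<omega>) powr a) \<partial>M) \<le> (SUP t\<in>{1..}. \<integral>\<^sup>+\<omega>. ennreal (infnorm (e t \<omega>) powr a) \<partial>M)"
      by (rule SUP_upper) simp
    then show ?thesis using fin by (simp add: L_def)
  qed
  define \<rho> where "\<rho> = min (a / 2) 2"
  have \<rho>: "1 < \<rho>" "\<rho> \<le> 2" "0 < 2 * \<rho>" "2 * \<rho> \<le> a" using a by (auto simp: \<rho>_def)
  have "0 \<le> L" by (simp add: L_def)
  note mom = component_moment[OF e_measurable \<rho>(3,4) le \<open>0 \<le> L\<close>]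
  show ?thesis by (intro exI[of _ \<rho>] exI[of _ "1 + L"] conjI allI \<rho>(1,2) mom) simp_all
qed

lemma noise_component_mean: "expectation (\<lambda>\<omega>. e (Suc t) \<omega> $ i) = 0"
proof -
  have "integrable M (e (Suc t))" "(\<integral>\<omega>. e (Suc t) \<omega> \<partial>M) = 0"
    using noise unfolding noise_assumption_def by auto
  then show ?thesis
    using integral_bounded_linear[OF bounded_linear_vec_nth, of M "e (Suc t)" i] by simp
qed

text \<open>The two almost sure growth bounds for the noise terms, with \<open>1 + ln (1 + t)\<close> as the level of
  truncation, are inserted in the path-wise estimate \<open>V_le\<close>.\<close>

lemma AE_V_bound:
  "AE \<omega> in M. \<exists>K. \<forall>t. rls_row.V (S \<omega>) (\<zeta> \<omega>) (E i \<omega>) t \<le> K * (1 + ln (1 + real t))"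
proof -
  obtain \<rho> L where \<rho>: "1 < \<rho>" "\<rho> \<le> 2"
    and mom: "\<And>t i. integrable M (\<lambda>\<omega>. \<bar>e (Suc t) \<omega> $ i\<bar> powr (2 * \<rho>))"
    and momL: "\<And>t i. expectation (\<lambda>\<omega>. \<bar>e (Suc t) \<omega> $ i\<bar> powr (2 * \<rho>)) \<le> L"
    using noise_component_moments by atomize_elim
  interpret pn: predictable_noise M F "\<lambda>t \<omega>. e (Suc t) \<omega> $ i" by (rule predictable_noise_component)
  let ?h = "\<lambda>\<omega> t. rls_path.h (S \<omega>) (\<zeta> \<omega>) t"
  let ?b = "\<lambda>t. 1 + ln (1 + real t)"
  have path: "rls_path (S \<omega>) (\<zeta> \<omega>)" for \<omega> by (rule rls_path_rls_S[OF S0])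
  have h0: "0 \<le> ?h \<omega> t" for \<omega> t by (rule rls_path.h_nonneg[OF path])
  have pt: "(x :: real)\<^sup>2 \<le> 1 + \<bar>x\<bar> powr (2 * \<rho>)" for x
    by (rule truncated_square_bounds(3)[OF \<rho> order_refl])
  have em[measurable]: "(\<lambda>\<omega>. e (Suc t) \<omega> $ i) \<in> borel_measurable M" for t by (rule pn.noise_measurable)
  have sq: "integrable M (\<lambda>\<omega>. (e (Suc t) \<omega> $ i)\<^sup>2)" for t
    by (rule Bochner_Integration.integrable_bound[of _ "\<lambda>\<omega>. 1 + \<bar>e (Suc t) \<omega> $ i\<bar> powr (2 * \<rho>)"])
       (use mom pt in \<open>auto simp: add_nonneg_nonneg\<close>)
  have var: "expectation (\<lambda>\<omega>. (e (Suc t) \<omega> $ i)\<^sup>2) \<le> 1 + L" for t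
  proof -
    have "expectation (\<lambda>\<omega>. (e (Suc t) \<omega> $ i)\<^sup>2) \<le> expectation (\<lambda>\<omega>. 1 + \<bar>e (Suc t) \<omega> $ i\<bar> powr (2 * \<rho>))"
      by (rule integral_mono[OF sq]) (use mom pt in auto)
    then show ?thesis using mom momL[of t i] by (simp add: prob_space)
  qed
  have "AE \<omega> in M. \<exists>K. \<forall>t. \<bar>\<Sum>s<t. e (Suc s) \<omega> $ i * (E i \<omega> s \<bullet> \<zeta> \<omega> s / (1 + ?h \<omega> s))\<bar>
      \<le> K * (1 + (\<Sum>s<t. (E i \<omega> s \<bullet> \<zeta> \<omega> s / (1 + ?h \<omega> s))\<^sup>2)) powr (3/4)"
    by (rule pn.AE_noise_sum_growth[OF noise_component_mean sq var])
       (intro borel_measurable_divide borel_measurable_inner borel_measurable_add borel_measurable_const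
         E_adapted \<zeta>_predictable h_predictable)
  moreover have "AE \<omega> in M. \<exists>K. \<forall>t. (\<Sum>s<t. (e (Suc s) \<omega> $ i)\<^sup>2 * (?h \<omega> s / (1 + ?h \<omega> s))) \<le> K * ?b t"
  proof -
    obtain B where B: "\<And>x. norm (regressor X \<alpha> x) \<le> B" using regressor_bounded[OF compact_profiles] by blast
    define C where "C = \<bar>ln (fact CARD('m) * (norm (matrix_inv S0) + B\<^sup>2 + 1) ^ CARD('m) / \<bar>det (matrix_inv S0)\<bar>)\<bar> + CARD('m)"
    have P0: "rls_path.P (S \<omega>) (\<zeta> \<omega>) 0 = matrix_inv S0" for \<omega>
      by (simp add: rls_path.P_def[OF path])
    show ?thesis
    proof (rule pn.AE_weighted_square_sum_growth[OF \<rho> mom momL, where C=C])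
      show "(\<lambda>\<omega>. ?h \<omega> t / (1 + ?h \<omega> t)) \<in> borel_measurable (F t)" for t
        by (intro borel_measurable_divide borel_measurable_add borel_measurable_const h_predictable)
      show "0 \<le> ?h \<omega> t / (1 + ?h \<omega> t)" "?h \<omega> t / (1 + ?h \<omega> t) \<le> 1" for \<omega> t
        using h0[of \<omega> t] by (auto simp: divide_simps)
      show "mono ?b" by (intro monoI) auto
      show "(\<Sum>s<t. ?h \<omega> s / (1 + ?h \<omega> s)) \<le> C * ?b t" for \<omega> t
        using rls_path.sum_gain_le_ln[OF path B, of \<omega> t] by (simp add: C_def P0)
    qed simp
  qed
  ultimately show ?thesis
    using AE_space
  proof eventually_elim
    fix \<omega>
    assume "\<exists>K. \<forall>t. \<bar>\<Sum>s<t. e (Suc s) \<omega> $ i * (E i \<omega> s \<bullet> \<zeta> \<omega> s / (1 + ?h \<omega> s))\<bar>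
        \<le> K * (1 + (\<Sum>s<t. (E i \<omega> s \<bullet> \<zeta> \<omega> s / (1 + ?h \<omega> s))\<^sup>2)) powr (3/4)"
      and "\<exists>K. \<forall>t. (\<Sum>s<t. (e (Suc s) \<omega> $ i)\<^sup>2 * (?h \<omega> s / (1 + ?h \<omega> s))) \<le> K * ?b t"
      and \<omega>: "\<omega> \<in> space M"
    then obtain K1 K2 where K1: "\<And>t. \<bar>\<Sum>s<t. e (Suc s) \<omega> $ i * (E i \<omega> s \<bullet> \<zeta> \<omega> s / (1 + ?h \<omega> s))\<bar>
        \<le> K1 * (1 + (\<Sum>s<t. (E i \<omega> s \<bullet> \<zeta> \<omega> s / (1 + ?h \<omega> s))\<^sup>2)) powr (3/4)"
      and K2: "\<And>t. (\<Sum>s<t. (e (Suc s) \<omega> $ i)\<^sup>2 * (?h \<omega> s / (1 + ?h \<omega> s))) \<le> K2 * ?b t" by blast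
    let ?V = "rls_row.V (S \<omega>) (\<zeta> \<omega>) (E i \<omega>)"
    define c where "c = \<bar>?V 0\<bar> + 1 + (2 * \<bar>K1\<bar>) ^ 4"
    have "?V t \<le> (c + K2) * ?b t" for t
    proof -
      have "?V t \<le> ?V 0 + K2 * ?b t + 1 + (2 * \<bar>K1\<bar>) ^ 4"
        using rls_row.V_le[OF row[OF \<omega>] K1, of t] K2[of t] by linarith
      also have "\<dots> \<le> c * 1 + K2 * ?b t" by (simp add: c_def)
      also have "\<dots> \<le> c * ?b t + K2 * ?b t"
        by (intro add_right_mono mult_left_mono) (auto simp: c_def)
      finally show ?thesis by (simp add: algebra_simps)
    qed
    then show "\<exists>K. \<forall>t. ?V t \<le> K * ?b t" by blast
  qed
qed

text \<open>\<open>V\<close> dominates the smallest eigenvalue of the information matrix times the squared error in each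
  row, and the squared Frobenius norm is the sum over the rows.\<close>

lemma AE_estimation_error:
  "AE \<omega> in M. (\<lambda>t. (norm (rls_estimate X \<alpha> S0 \<Theta>0 (\<lambda>s. xhat s \<omega>) (\<lambda>s. phat s \<omega>) t - \<Theta>))\<^sup>2)
     \<in> O(\<lambda>t. ln (real t) / lambda_min X \<alpha> S0 (\<lambda>s. xhat s \<omega>) t)"
proof -
  have "AE \<omega> in M. \<forall>i. \<exists>K. \<forall>t. rls_row.V (S \<omega>) (\<zeta> \<omega>) (E i \<omega>) t \<le> K * (1 + ln (1 + real t))"
    using AE_V_bound by (simp add: AE_all_countable)
  then show ?thesis
    using AE_space
  proof eventually_elim
    fix \<omega> assume "\<forall>i. \<exists>K. \<forall>t. rls_row.V (S \<omega>) (\<zeta> \<omega>) (E i \<omega>) t \<le> K * (1 + ln (1 + real t))"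
      and \<omega>: "\<omega> \<in> space M"
    then obtain K where K: "\<And>i t. rls_row.V (S \<omega>) (\<zeta> \<omega>) (E i \<omega>) t \<le> K i * (1 + ln (1 + real t))"
      by metis
    let ?lm = "\<lambda>t. lambda_min X \<alpha> S0 (\<lambda>s. xhat s \<omega>) t"
    let ?D = "\<lambda>t. rls_estimate X \<alpha> S0 \<Theta>0 (\<lambda>s. xhat s \<omega>) (\<lambda>s. phat s \<omega>) t - \<Theta>"
    have path: "rls_path (S \<omega>) (\<zeta> \<omega>)" by (rule rls_path_rls_S[OF S0])
    have lm_pos: "0 < ?lm t" for t
      unfolding lambda_min_def rls_path.matrix_inv_S[OF path]
      by (rule min_eigenvalue_pos[OF rls_path.pos_def_P[OF path]])
    define C where "C = (\<Sum>i\<in>UNIV. \<bar>K i\<bar>)"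
    \<comment> \<open>The factor \<open>3\<close>: for \<open>t \<ge> 3\<close> one has \<open>1 \<le> ln t\<close> and \<open>ln (1 + t) \<le> 2 * ln t\<close>.\<close>
    have "norm ((norm (?D t))\<^sup>2) \<le> 3 * C * norm (ln (real t) / ?lm t)" if t: "3 \<le> t" for t
    proof -
      have "?lm t * (norm (?D t))\<^sup>2 = (\<Sum>i\<in>UNIV. ?lm t * (norm (E i \<omega> t))\<^sup>2)"
        by (simp add: norm_vec_def L2_set_def sum_nonneg sum_distrib_left)
      also have "\<dots> \<le> (\<Sum>i\<in>UNIV. K i * (1 + ln (1 + real t)))"
        using rls_row.min_eigenvalue_mult_norm_le[OF row[OF \<omega>], of t] K
        by (intro sum_mono) (auto simp: lambda_min_def intro: order_trans)
      also have "\<dots> \<le> C * (1 + ln (1 + real t))"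
        unfolding C_def sum_distrib_right by (intro sum_mono mult_right_mono) auto
      also have "\<dots> \<le> C * (3 * ln (real t))"
      proof (rule mult_left_mono)
        have l1: "1 \<le> ln (real t)"
        proof -
          have "exp 1 \<le> real t" using t exp_le by linarith
          then show ?thesis using t by (simp add: ln_ge_iff)
        qed
        have "ln (1 + real t) \<le> ln (real t * real t)"
        proof (intro ln_mono)
          have "1 + real t \<le> 3 * real t" using t by simp
          also have "\<dots> \<le> real t * real t" using t by (intro mult_right_mono) auto
          finally show "1 + real t \<le> real t * real t" .
        qed simp
        then show "1 + ln (1 + real t) \<le> 3 * ln (real t)" using t l1 by (simp add: ln_mult)
      qed (simp add: C_def sum_nonneg)
      finally have "(norm (?D t))\<^sup>2 \<le> 3 * C * (ln (real t) / ?lm t)"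
        using lm_pos[of t] by (simp add: field_simps)
      then show ?thesis using lm_pos[of t] t by simp
    qed
    then have "\<forall>\<^sub>F t in sequentially. norm ((norm (?D t))\<^sup>2) \<le> 3 * C * norm (ln (real t) / ?lm t)"
      by (intro eventually_sequentiallyI)
    then show "(\<lambda>t. (norm (?D t))\<^sup>2) \<in> O(\<lambda>t. ln (real t) / ?lm t)"
      by (rule bigoI)
  qed
qed

end

theorem lemma3:
  fixes M :: "'w measure" and N :: "'u measure" and U :: "'w \<Rightarrow> 'u"
    and d :: nat and \<alpha> :: "'m::finite \<Rightarrow> 'n::finite \<Rightarrow> nat"
    and X :: "'n \<Rightarrow> real set" and l :: "'n \<Rightarrow> real^'n \<Rightarrow> real"
    and xd ud :: "real^'n"
    and \<Theta>0 \<Theta>star :: "real^'m^'n" and S0 :: "real^'m^'m"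
    and e p xhat phat :: "nat \<Rightarrow> 'w \<Rightarrow> real^'n"
  assumes "prob_space M"
    and "enumerates_exponents d \<alpha>"
    and "\<And>i. compact (X i) \<and> convex (X i)"
    and "xd \<in> profiles X"
    and "has_types X \<alpha> l \<Theta>star"
    and "type_assumption X \<alpha> \<Theta>star"
    and "noise_assumption M e"
    and "randomization_independent M N U e"
    and "non_anticipating M N U xhat phat p"
    and "\<And>t \<omega>. t \<ge> 1 \<Longrightarrow> \<omega> \<in> space M \<Longrightarrow> xhat t \<omega> = equilibrium_response X l xd ud (p t \<omega>)"
    and "\<And>t \<omega>. t \<ge> 1 \<Longrightarrow> \<omega> \<in> space M \<Longrightarrow> phat t \<omega> = p t \<omega> + e t \<omega>"
    and "pos_def S0"
  shows "((AE \<omega> in M. (\<lambda>t. ln (real t)) \<in> o(\<lambda>t. lambda_min X \<alpha> S0 (\<lambda>s. xhat s \<omega>) t)) \<longrightarrow>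
          (AE \<omega> in M.
             (\<lambda>t. (norm (rls_estimate X \<alpha> S0 \<Theta>0 (\<lambda>s. xhat s \<omega>) (\<lambda>s. phat s \<omega>) t - \<Theta>star))\<^sup>2)
               \<in> O(\<lambda>t. ln (real t) / lambda_min X \<alpha> S0 (\<lambda>s. xhat s \<omega>) t))) \<and>
         ((AE \<omega> in M. (\<lambda>t. ln (real t)) \<in> o(\<lambda>t. lambda_min X \<alpha> S0 (\<lambda>s. xhat s \<omega>) t)) \<longrightarrow>
          (AE \<omega> in M.
             (\<lambda>t. rls_estimate X \<alpha> S0 \<Theta>0 (\<lambda>s. xhat s \<omega>) (\<lambda>s. phat s \<omega>) t) \<longlonglongrightarrow> \<Theta>star))"
proof -
  interpret rls_experiment M N U e X \<alpha> l \<Theta>star xd ud p xhat phat S0 \<Theta>0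
  proof (intro rls_experiment.intro noisy_data.intro noisy_data_axioms.intro typed_game.intro rls_experiment_axioms.intro)
    show "prob_space.indep_vars M (\<lambda>_. borel) e {1..}" using assms(7) by (simp add: noise_assumption_def)
  qed (use assms in auto)
  have "AE \<omega> in M. (\<lambda>t. rls_estimate X \<alpha> S0 \<Theta>0 (\<lambda>s. xhat s \<omega>) (\<lambda>s. phat s \<omega>) t) \<longlonglongrightarrow> \<Theta>star"
    if "AE \<omega> in M. (\<lambda>t. ln (real t)) \<in> o(\<lambda>t. lambda_min X \<alpha> S0 (\<lambda>s. xhat s \<omega>) t)"
    using that AE_estimation_error
  proof eventually_elim
    fix \<omega>
    assume o: "(\<lambda>t. ln (real t)) \<in> o(\<lambda>t. lambda_min X \<alpha> S0 (\<lambda>s. xhat s \<omega>) t)"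
      and O: "(\<lambda>t. (norm (rls_estimate X \<alpha> S0 \<Theta>0 (\<lambda>s. xhat s \<omega>) (\<lambda>s. phat s \<omega>) t - \<Theta>star))\<^sup>2)
         \<in> O(\<lambda>t. ln (real t) / lambda_min X \<alpha> S0 (\<lambda>s. xhat s \<omega>) t)"
    from o have "(\<lambda>t. ln (real t) / lambda_min X \<alpha> S0 (\<lambda>s. xhat s \<omega>) t) \<longlonglongrightarrow> 0"
      by (rule smalloD_tendsto)
    then have "(\<lambda>t. ln (real t) / lambda_min X \<alpha> S0 (\<lambda>s. xhat s \<omega>) t) \<in> o(\<lambda>_. 1)"
      by (intro smalloI_tendsto) auto
    with O have "(\<lambda>t. (norm (rls_estimate X \<alpha> S0 \<Theta>0 (\<lambda>s. xhat s \<omega>) (\<lambda>s. phat s \<omega>) t - \<Theta>star))\<^sup>2) \<in> o(\<lambda>_. 1)"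
      by (rule landau_o.big_small_trans)
    then have "(\<lambda>t. (norm (rls_estimate X \<alpha> S0 \<Theta>0 (\<lambda>s. xhat s \<omega>) (\<lambda>s. phat s \<omega>) t - \<Theta>star))\<^sup>2) \<longlonglongrightarrow> 0"
      using smalloD_tendsto by fastforce
    then have "(\<lambda>t. norm (rls_estimate X \<alpha> S0 \<Theta>0 (\<lambda>s. xhat s \<omega>) (\<lambda>s. phat s \<omega>) t - \<Theta>star)) \<longlonglongrightarrow> 0"
      using tendsto_real_sqrt by fastforce
    then show "(\<lambda>t. rls_estimate X \<alpha> S0 \<Theta>0 (\<lambda>s. xhat s \<omega>) (\<lambda>s. phat s \<omega>) t) \<longlonglongrightarrow> \<Theta>star"
      by (simp add: LIM_zero_iff tendsto_norm_zero_iff)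
  qed
  then show ?thesis using AE_estimation_error by blast
qed

end
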